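(* Let $u^\dag\in L^2(\Omega)$, $y^\dag:=F(u^\dag)$, and assume that for some $\frac d2<p<2$, $p':=\frac{2p}{2-p}$, and some $\mu\in(0,1)$, $$L_p|\Omega|^{1/2}\bigl(2|\{F(u^\dag)=0\}|\bigr)^{1/p'}<\mu .$$ Then there exist $\rho>0$, $0<\lambda\le\Lambda$ and $\tau>1$ such that for all starting points $u_0\in\overline B_{L^2(\Omega)}(u^\dag,\rho)$ and all step sizes $w_n\in[\lambda,\Lambda]$, the Bouligand--Landweber iteration stopped according to the discrepancy principle with constant $\tau$ is a well-posed and strongly convergent regularization method, that is: (a) for every $\delta>0$ and every $y^\delta\in L^2(\Omega)$ with $\|y^\delta-y^\dag\|_{L^2(\Omega)}\le\delta$, the stopping index $N(\delta,y^\delta)$ is finite; (b) for exact data ($\delta=0$, $y^\delta=y^\dag$) the iteration either stops after finitely many steps with the iterate $u^\dag$ or generates a sequence converging strongly to $u^\dag$ in $L^2(\Omega)$; (c) for every sequence $\delta_k>0$ with $\delta_k\to0$ and all $y^{\delta_k}\in L^2(\Omega)$ with $\|y^{\delta_k}-y^\dag\|_{L^2(\Omega)}\le\delta_k$, one has $u^{\delta_k}_{N(\delta_k,y^{\delta_k})}\to u^\dag$ strongly in $L^2(\Omega)$ as $k\to\infty$.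
   Context: $\Omega\subset\mathbb R^d$, $d\in\{2,3\}$, is a bounded domain with Lipschitz boundary; $|S|$ is Lebesgue measure. $F:L^2(\Omega)\to H^1_0(\Omega)\cap C(\overline\Omega)\hookrightarrow L^2(\Omega)$ is the solution operator $u\mapsto y_u$ of $-\Delta y+y^+=u$ in $\Omega$, $y=0$ on $\partial\Omega$ (weak sense; uniquely solvable), where $y^+=\max(y,0)$ pointwise. For $u\in L^2(\Omega)$, $G_u$ is the solution operator $h\mapsto\eta\in H^1_0(\Omega)$ of $-\Delta\eta+\mathbf 1_{\{y_u>0\}}\eta=h$ in $\Omega$, $\eta=0$ on $\partial\Omega$, with $y_u=F(u)$; it is considered for $h\in L^2(\Omega)$ and also for $h\in L^p(\Omega)$, $\frac d2<p\le2$; as an operator on $L^2(\Omega)$ its adjoint is denoted $G_u^*$ (and $G_u$ is self-adjoint). $L_p>0$ is a constant such that $\|G_uh\|_{C(\overline\Omega)}\le L_p\|h\|_{L^p(\Omega)}$ for all $h\in L^p(\Omega)$, $u\in L^2(\Omega)$ (such a constant exists). Bouligand--Landweber iteration: for $y^\delta\in L^2(\Omega)$ with $\|y^\delta-y^\dag\|_{L^2(\Omega)}\le\delta$, $u_0^\delta:=u_0$, $u_{n+1}^\delta=u_n^\delta+w_nG_{u_n^\delta}^*(y^\delta-F(u_n^\delta))$, $n\ge0$. Discrepancy principle: for a constant $\tau>1$, the stopping index $N=N(\delta,y^\delta)$ is the first index with $\|y^\delta-F(u_N^\delta)\|_{L^2(\Omega)}\le\tau\delta$ (for $\delta=0$: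 the first index, if any, with $F(u_N)=y^\dag$). *)

theory Defs
  imports "HOL-Analysis.Analysis"
begin

text \<open>
  Elements of Lebesgue and Sobolev spaces are represented by functions on the ambient space, of
  which only the values on \<open>\<Omega>\<close> matter; equality in these spaces is equality almost everywhere
  on \<open>\<Omega>\<close>. Solution operators return an arbitrary representative, so everything below has to be
  (and is) invariant under changes on null sets.
\<close>

subsection \<open>Bounded Lipschitz domains\<close>

text \<open>
  Near each boundary point the set is the strict epigraph of a Lipschitz function after a rigid
  change of coordinates. The last coordinate axis is given by a unit vector \<open>e\<close>; the hyperplane
  orthogonal to \<open>e\<close> plays the role of \<open>\<real>\<^sup>d\<^sup>-\<^sup>1\<close>.
\<close>

definition lipschitz_boundary :: "'a::euclidean_space set \<Rightarrow> bool" where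
  "lipschitz_boundary \<Omega> \<longleftrightarrow>
     (\<forall>x\<in>frontier \<Omega>. \<exists>r>0. \<exists>e C \<gamma>. norm e = 1 \<and> C-lipschitz_on {v. v \<bullet> e = 0} \<gamma> \<and>
        \<Omega> \<inter> ball x r = {z \<in> ball x r. \<gamma> (z - (z \<bullet> e) *\<^sub>R e) < z \<bullet> e})"

definition bounded_lipschitz_domain :: "'a::euclidean_space set \<Rightarrow> bool" where
  "bounded_lipschitz_domain \<Omega> \<longleftrightarrow>
     open \<Omega> \<and> connected \<Omega> \<and> \<Omega> \<noteq> {} \<and> bounded \<Omega> \<and> lipschitz_boundary \<Omega>"

subsection \<open>Lebesgue spaces\<close>

definition Lp :: "real \<Rightarrow> 'a::euclidean_space set \<Rightarrow> ('a \<Rightarrow> 'b::euclidean_space) set" where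
  "Lp p \<Omega> = {f. f \<in> borel_measurable (lebesgue_on \<Omega>) \<and>
                 integrable (lebesgue_on \<Omega>) (\<lambda>x. norm (f x) powr p)}"

definition Lp_norm :: "real \<Rightarrow> 'a::euclidean_space set \<Rightarrow> ('a \<Rightarrow> 'b::euclidean_space) \<Rightarrow> real" where
  "Lp_norm p \<Omega> f = (\<integral>x. norm (f x) powr p \<partial>lebesgue_on \<Omega>) powr (1 / p)"

definition L2_inner :: "'a::euclidean_space set \<Rightarrow> ('a \<Rightarrow> 'b::euclidean_space) \<Rightarrow> ('a \<Rightarrow> 'b) \<Rightarrow> real" where
  "L2_inner \<Omega> f g = (\<integral>x. f x \<bullet> g x \<partial>lebesgue_on \<Omega>)"

definition L2_adjoint ::
  "'a::euclidean_space set \<Rightarrow> (('a \<Rightarrow> real) \<Rightarrow> ('a \<Rightarrow> real)) \<Rightarrow> ('a \<Rightarrow> real) \<Rightarrow> ('a \<Rightarrow> real)" where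
  "L2_adjoint \<Omega> T k =
     (SOME g. g \<in> Lp 2 \<Omega> \<and> (\<forall>h\<in>Lp 2 \<Omega>. L2_inner \<Omega> (T h) k = L2_inner \<Omega> h g))"

subsection \<open>Sobolev spaces\<close>

fun C_k :: "nat \<Rightarrow> ('a::euclidean_space \<Rightarrow> real) \<Rightarrow> bool" where
  "C_k 0 f \<longleftrightarrow> continuous_on UNIV f"
| "C_k (Suc k) f \<longleftrightarrow> (\<forall>x. f differentiable at x) \<and>
     (\<forall>b\<in>Basis. C_k k (\<lambda>x. frechet_derivative f (at x) b))"

definition test_functions :: "'a::euclidean_space set \<Rightarrow> ('a \<Rightarrow> real) set" where
  "test_functions \<Omega> = {\<phi>. (\<forall>k. C_k k \<phi>) \<and> compact (closure {x. \<phi> x \<noteq> 0}) \<and>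
                           closure {x. \<phi> x \<noteq> 0} \<subseteq> \<Omega>}"

definition has_weak_gradient ::
  "'a::euclidean_space set \<Rightarrow> ('a \<Rightarrow> real) \<Rightarrow> ('a \<Rightarrow> 'a) \<Rightarrow> bool" where
  "has_weak_gradient \<Omega> f g \<longleftrightarrow>
     (\<forall>\<phi>\<in>test_functions \<Omega>. \<forall>b\<in>Basis.
        (\<integral>x. f x * frechet_derivative \<phi> (at x) b \<partial>lebesgue_on \<Omega>)
          = - (\<integral>x. (g x \<bullet> b) * \<phi> x \<partial>lebesgue_on \<Omega>))"

definition H1 :: "'a::euclidean_space set \<Rightarrow> ('a \<Rightarrow> real) set" where
  "H1 \<Omega> = {f \<in> Lp 2 \<Omega>. \<exists>g\<in>Lp 2 \<Omega>. has_weak_gradient \<Omega> f g}"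

definition weak_grad :: "'a::euclidean_space set \<Rightarrow> ('a \<Rightarrow> real) \<Rightarrow> ('a \<Rightarrow> 'a)" where
  "weak_grad \<Omega> f = (SOME g. g \<in> Lp 2 \<Omega> \<and> has_weak_gradient \<Omega> f g)"

definition H1_norm :: "'a::euclidean_space set \<Rightarrow> ('a \<Rightarrow> real) \<Rightarrow> real" where
  "H1_norm \<Omega> f = sqrt ((Lp_norm 2 \<Omega> f)\<^sup>2 + (Lp_norm 2 \<Omega> (weak_grad \<Omega> f))\<^sup>2)"

definition H10 :: "'a::euclidean_space set \<Rightarrow> ('a \<Rightarrow> real) set" where
  "H10 \<Omega> = {f \<in> H1 \<Omega>. \<exists>\<phi>. (\<forall>k. \<phi> k \<in> test_functions \<Omega>) \<and>
                (\<lambda>k. H1_norm \<Omega> (\<lambda>x. \<phi> k x - f x)) \<longlonglongrightarrow> 0}"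

subsection \<open>The state equation and its Bouligand derivative\<close>

definition state_solution ::
  "'a::euclidean_space set \<Rightarrow> ('a \<Rightarrow> real) \<Rightarrow> ('a \<Rightarrow> real) \<Rightarrow> bool" where
  "state_solution \<Omega> u y \<longleftrightarrow> y \<in> H10 \<Omega> \<and>
     (\<forall>v\<in>H10 \<Omega>. L2_inner \<Omega> (weak_grad \<Omega> y) (weak_grad \<Omega> v) + L2_inner \<Omega> (\<lambda>x. max (y x) 0) v
        = L2_inner \<Omega> u v)"

definition F_op :: "'a::euclidean_space set \<Rightarrow> ('a \<Rightarrow> real) \<Rightarrow> ('a \<Rightarrow> real)" where
  "F_op \<Omega> u = (SOME y. state_solution \<Omega> u y)"

text \<open>
  The right-hand side \<open>h\<close> may be merely in \<open>L\<^sup>p\<close> with \<open>d / 2 < p \<le> 2\<close>. Then \<open>L2_inner \<Omega> h v\<close> is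
  the duality pairing, and the integral exists for \<open>v\<close> in \<open>H10 \<Omega>\<close> by Sobolev embedding (\<open>d \<le> 3\<close>).
\<close>

definition linearized_solution ::
  "'a::euclidean_space set \<Rightarrow> ('a \<Rightarrow> real) \<Rightarrow> ('a \<Rightarrow> real) \<Rightarrow> ('a \<Rightarrow> real) \<Rightarrow> bool" where
  "linearized_solution \<Omega> u h \<eta> \<longleftrightarrow> \<eta> \<in> H10 \<Omega> \<and>
     (\<forall>v\<in>H10 \<Omega>. L2_inner \<Omega> (weak_grad \<Omega> \<eta>) (weak_grad \<Omega> v)
          + L2_inner \<Omega> (\<lambda>x. indicator {z. F_op \<Omega> u z > 0} x * \<eta> x) v
        = L2_inner \<Omega> h v)"

definition G_op :: "'a::euclidean_space set \<Rightarrow> ('a \<Rightarrow> real) \<Rightarrow> ('a \<Rightarrow> real) \<Rightarrow> ('a \<Rightarrow> real)" where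
  "G_op \<Omega> u h = (SOME \<eta>. linearized_solution \<Omega> u h \<eta>)"

text \<open>
  \<open>C_norm_le \<Omega> f M\<close>: the class of \<open>f\<close> contains a function that is continuous on \<open>closure \<Omega>\<close>
  and whose norm in \<open>C(closure \<Omega>)\<close> is at most \<open>M\<close>.
\<close>

definition C_norm_le :: "'a::euclidean_space set \<Rightarrow> ('a \<Rightarrow> real) \<Rightarrow> real \<Rightarrow> bool" where
  "C_norm_le \<Omega> f M \<longleftrightarrow>
     (\<exists>c. continuous_on (closure \<Omega>) c \<and> (AE x in lebesgue_on \<Omega>. f x = c x) \<and>
          (SUP x\<in>closure \<Omega>. \<bar>c x\<bar>) \<le> M)"

subsection \<open>Bouligand--Landweber iteration and discrepancy principle\<close>

primrec BL_iterate ::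
  "'a::euclidean_space set \<Rightarrow> (nat \<Rightarrow> real) \<Rightarrow> ('a \<Rightarrow> real) \<Rightarrow> ('a \<Rightarrow> real) \<Rightarrow> nat \<Rightarrow> ('a \<Rightarrow> real)" where
  "BL_iterate \<Omega> w u0 y 0 = u0"
| "BL_iterate \<Omega> w u0 y (Suc n) =
     (let u = BL_iterate \<Omega> w u0 y n
      in (\<lambda>x. u x + w n * L2_adjoint \<Omega> (G_op \<Omega> u) (\<lambda>z. y z - F_op \<Omega> u z) x))"

text \<open>For \<open>\<delta> = 0\<close> the criterion says that \<open>F_op \<Omega> u\<^sub>n\<close> and \<open>y\<close> agree as elements of \<open>L\<^sup>2\<close>.\<close>

definition discrepancy_met ::
  "'a::euclidean_space set \<Rightarrow> real \<Rightarrow> (nat \<Rightarrow> real) \<Rightarrow> ('a \<Rightarrow> real) \<Rightarrow> real \<Rightarrow> ('a \<Rightarrow> real) \<Rightarrow> nat \<Rightarrow> bool" where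
  "discrepancy_met \<Omega> \<tau> w u0 \<delta> y n \<longleftrightarrow>
     Lp_norm 2 \<Omega> (\<lambda>x. y x - F_op \<Omega> (BL_iterate \<Omega> w u0 y n) x) \<le> \<tau> * \<delta>"

text \<open>Only meaningful if \<open>discrepancy_met\<close> holds for some index.\<close>

definition stopping_index ::
  "'a::euclidean_space set \<Rightarrow> real \<Rightarrow> (nat \<Rightarrow> real) \<Rightarrow> ('a \<Rightarrow> real) \<Rightarrow> real \<Rightarrow> ('a \<Rightarrow> real) \<Rightarrow> nat" where
  "stopping_index \<Omega> \<tau> w u0 \<delta> y = (LEAST n. discrepancy_met \<Omega> \<tau> w u0 \<delta> y n)"

end

theory Submission imports Defs
begin

text \<open>
  Write \<open>e\<^sub>m\<close> for the error \<open>u\<^sub>m - u\<dagger>\<close> of an iterate and \<open>r\<^sub>m\<close> for its residual \<open>y - F u\<^sub>m\<close>.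

  The linearisation error \<open>F v - F u - G u (v - u)\<close> is again of the form \<open>G u h\<close>, where \<open>h\<close> is
  dominated by \<open>F v - F u\<close> and lives on the set where \<open>F u\<close> and \<open>F v\<close> have different signs. The
  bound on \<open>G\<close> and Hoelder's inequality estimate it by \<open>\<parallel>F v - F u\<parallel>\<close> times a power of the measure
  of that set. Near \<open>v = u\<dagger>\<close> the set is, up to a small measure, part of the zero set of \<open>F u\<dagger>\<close>; so
  the smallness assumption gives a tangential cone condition with constant \<open>\<mu> < 1\<close>
  (\<open>tangential_cone\<close>). As in the smooth theory it follows that errors decrease until the iteration
  is stopped and that the sum of \<open>\<parallel>r\<^sub>j\<parallel>\<^sup>2\<close> over the steps before stopping is bounded independently
  of the data (\<open>descent\<close>, \<open>before_stopping\<close>). In particular the iteration stops.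

  The smooth theory would now pass to the limit in the data for a fixed number of steps. Here \<open>G u\<close>
  need not depend continuously on \<open>u\<close>, and the following estimate takes the place of that argument.
  Unrolling the iteration and moving \<open>G\<close>, which is self-adjoint, to the other side,
  \<open>\<parallel>e\<^sub>m\<parallel>\<^sup>2 = \<langle>e\<^sub>0, e\<^sub>m\<rangle> + (\<Sum>j<m. w\<^sub>j \<langle>r\<^sub>j, G u\<^sub>j e\<^sub>m\<rangle>)\<close>.
  Both terms are controlled by the state error \<open>z\<^sub>m = F u\<^sub>m - F u\<dagger>\<close>: the first one because bounded
  controls converge weakly when their states converge (\<open>weak_stability\<close>), the second one because
  \<open>\<parallel>G u\<^sub>j e\<^sub>m\<parallel>\<close> is at most a constant times \<open>\<parallel>z\<^sub>m\<parallel>\<close> for every \<open>j\<close> (\<open>G_le_state_difference\<close>). Hence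
  \<open>\<parallel>e\<^sub>m\<parallel>\<^sup>2 \<le> \<epsilon> + C \<parallel>z\<^sub>m\<parallel> (1 + (\<Sum>j<m. \<parallel>r\<^sub>j\<parallel>))\<close> with a constant that does not depend on the data. Since
  the residuals are square summable, \<open>\<parallel>r\<^sub>m\<parallel> (1 + (\<Sum>j<m. \<parallel>r\<^sub>j\<parallel>))\<close> must be small for some \<open>m < M\<close>, again
  with \<open>M\<close> independent of the data (\<open>square_summable_weighted_small\<close>). A run of at least \<open>M\<close> steps
  therefore ends with a small error by monotonicity; a shorter run ends with \<open>\<parallel>z\<^sub>m\<parallel> \<le> (\<tau> + 1) \<delta>\<close>
  and a bounded sum of residuals. All claims follow from this uniform statement
  (\<open>uniform_convergence\<close>).

  The operators \<open>F\<close> and \<open>G\<close> are only given as arbitrary choices among weak solutions, so their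
  existence has to be proved: solutions minimise a strongly convex energy on \<open>H10\<close>
  (\<open>semilinear_solvable\<close>), which needs completeness of \<open>L\<^sup>2\<close> and of \<open>H10\<close>, the Poincare inequality,
  and the density of test functions in \<open>L\<^sup>2\<close>. The latter also makes weak gradients unique and
  provides the weak convergence mentioned above.
\<close>

section \<open>The space of square integrable functions\<close>

lemma Lp2_iff:
  "f \<in> Lp 2 \<Omega> \<longleftrightarrow> f \<in> borel_measurable (lebesgue_on \<Omega>) \<and>
     integrable (lebesgue_on \<Omega>) (\<lambda>x. (norm (f x))\<^sup>2)"
  unfolding Lp_def by simp

lemma Lp2_measurable [measurable_dest]: "f \<in> Lp 2 \<Omega> \<Longrightarrow> f \<in> borel_measurable (lebesgue_on \<Omega>)"
  by (simp add: Lp2_iff)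

lemma Lp2_dominated:
  assumes "g \<in> Lp 2 \<Omega>" "f \<in> borel_measurable (lebesgue_on \<Omega>)"
    and "AE x in lebesgue_on \<Omega>. norm (f x) \<le> norm (g x)"
  shows "f \<in> Lp 2 \<Omega>"
proof -
  have [measurable]: "f \<in> borel_measurable (lebesgue_on \<Omega>)" by fact
  have "integrable (lebesgue_on \<Omega>) (\<lambda>x. (norm (f x))\<^sup>2)"
  proof (rule Bochner_Integration.integrable_bound)
    show "integrable (lebesgue_on \<Omega>) (\<lambda>x. (norm (g x))\<^sup>2)" using assms by (simp add: Lp2_iff)
    show "AE x in lebesgue_on \<Omega>. norm ((norm (f x))\<^sup>2) \<le> norm ((norm (g x))\<^sup>2)"
      using assms(3) by eventually_elim (simp add: power_mono)
  qed measurable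
  then show ?thesis using assms by (simp add: Lp2_iff)
qed

lemma Lp2_inner_integrable:
  assumes "f \<in> Lp 2 \<Omega>" "g \<in> Lp 2 \<Omega>"
  shows "integrable (lebesgue_on \<Omega>) (\<lambda>x. f x \<bullet> g x)"
proof -
  have [measurable]: "f \<in> borel_measurable (lebesgue_on \<Omega>)" "g \<in> borel_measurable (lebesgue_on \<Omega>)"
    using assms by (auto simp: Lp2_iff)
  show ?thesis
  proof (rule Bochner_Integration.integrable_bound)
    show "integrable (lebesgue_on \<Omega>) (\<lambda>x. (norm (f x))\<^sup>2 + (norm (g x))\<^sup>2)"
      using assms by (simp add: Lp2_iff)
    have "norm (f x \<bullet> g x) \<le> norm ((norm (f x))\<^sup>2 + (norm (g x))\<^sup>2)" for x
    proof -
      have "\<bar>f x \<bullet> g x\<bar> \<le> norm (f x) * norm (g x)" by (rule Cauchy_Schwarz_ineq2)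
      also have "\<dots> \<le> (norm (f x))\<^sup>2 + (norm (g x))\<^sup>2"
        using sum_squares_bound[of "norm (f x)" "norm (g x)"]
          mult_nonneg_nonneg[OF norm_ge_zero[of "f x"] norm_ge_zero[of "g x"]] by linarith
      finally show ?thesis by simp
    qed
    then show "AE x in lebesgue_on \<Omega>. norm (f x \<bullet> g x) \<le> norm ((norm (f x))\<^sup>2 + (norm (g x))\<^sup>2)"
      by simp
  qed measurable
qed

lemma Lp2_mult_integrable:
  fixes f g :: "'a::euclidean_space \<Rightarrow> real"
  shows "f \<in> Lp 2 \<Omega> \<Longrightarrow> g \<in> Lp 2 \<Omega> \<Longrightarrow> integrable (lebesgue_on \<Omega>) (\<lambda>x. f x * g x)"
  using Lp2_inner_integrable[of f \<Omega> g] by simp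

lemma Lp2_zero [simp]: "(\<lambda>x. 0) \<in> Lp 2 \<Omega>"
  by (simp add: Lp2_iff)

lemma Lp2_scaleR: "f \<in> Lp 2 \<Omega> \<Longrightarrow> (\<lambda>x. c *\<^sub>R f x) \<in> Lp 2 \<Omega>"
  by (auto simp: Lp2_iff power_mult_distrib)

lemma Lp2_scale:
  fixes f :: "'a::euclidean_space \<Rightarrow> real"
  shows "f \<in> Lp 2 \<Omega> \<Longrightarrow> (\<lambda>x. c * f x) \<in> Lp 2 \<Omega>"
  using Lp2_scaleR[of f \<Omega> c] by simp

lemma Lp2_add:
  assumes "f \<in> Lp 2 \<Omega>" "g \<in> Lp 2 \<Omega>"
  shows "(\<lambda>x. f x + g x) \<in> Lp 2 \<Omega>"
proof -
  have [measurable]: "f \<in> borel_measurable (lebesgue_on \<Omega>)" "g \<in> borel_measurable (lebesgue_on \<Omega>)"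
    using assms by (auto simp: Lp2_iff)
  have "(\<lambda>x. (norm (f x + g x))\<^sup>2) = (\<lambda>x. (norm (f x))\<^sup>2 + 2 * (f x \<bullet> g x) + (norm (g x))\<^sup>2)"
    by (auto simp: power2_norm_eq_inner inner_add_left inner_add_right inner_commute algebra_simps)
  moreover have "integrable (lebesgue_on \<Omega>) \<dots>"
    using assms Lp2_inner_integrable[OF assms] by (simp add: Lp2_iff)
  ultimately have "integrable (lebesgue_on \<Omega>) (\<lambda>x. (norm (f x + g x))\<^sup>2)" by (simp only:)
  then show ?thesis by (simp add: Lp2_iff)
qed

lemma Lp2_diff:
  assumes "f \<in> Lp 2 \<Omega>" "g \<in> Lp 2 \<Omega>"
  shows "(\<lambda>x. f x - g x) \<in> Lp 2 \<Omega>"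
  using Lp2_add[OF assms(1) Lp2_scaleR[OF assms(2), of "-1"]] by simp

lemmas Lp2_closed = Lp2_add Lp2_diff Lp2_scale Lp2_scaleR

lemma L2_inner_commute: "L2_inner \<Omega> f g = L2_inner \<Omega> g f"
  by (simp add: L2_inner_def inner_commute)

lemma L2_inner_add_left:
  "f \<in> Lp 2 \<Omega> \<Longrightarrow> g \<in> Lp 2 \<Omega> \<Longrightarrow> h \<in> Lp 2 \<Omega> \<Longrightarrow>
    L2_inner \<Omega> (\<lambda>x. f x + g x) h = L2_inner \<Omega> f h + L2_inner \<Omega> g h"
  by (simp add: L2_inner_def inner_add_left Lp2_inner_integrable)

lemma L2_inner_diff_left:
  "f \<in> Lp 2 \<Omega> \<Longrightarrow> g \<in> Lp 2 \<Omega> \<Longrightarrow> h \<in> Lp 2 \<Omega> \<Longrightarrow>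
    L2_inner \<Omega> (\<lambda>x. f x - g x) h = L2_inner \<Omega> f h - L2_inner \<Omega> g h"
  by (simp add: L2_inner_def inner_diff_left Lp2_inner_integrable)

lemma L2_inner_scaleR_left: "L2_inner \<Omega> (\<lambda>x. c *\<^sub>R f x) h = c * L2_inner \<Omega> f h"
  by (simp add: L2_inner_def)

lemma L2_inner_scale_left:
  fixes f :: "'a::euclidean_space \<Rightarrow> real"
  shows "L2_inner \<Omega> (\<lambda>x. c * f x) h = c * L2_inner \<Omega> f h"
  using L2_inner_scaleR_left[of \<Omega> c f h] by simp

lemma L2_inner_add_right:
  "f \<in> Lp 2 \<Omega> \<Longrightarrow> g \<in> Lp 2 \<Omega> \<Longrightarrow> h \<in> Lp 2 \<Omega> \<Longrightarrow>
    L2_inner \<Omega> h (\<lambda>x. f x + g x) = L2_inner \<Omega> h f + L2_inner \<Omega> h g"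
  by (simp add: L2_inner_def inner_add_right Lp2_inner_integrable)

lemma L2_inner_diff_right:
  "f \<in> Lp 2 \<Omega> \<Longrightarrow> g \<in> Lp 2 \<Omega> \<Longrightarrow> h \<in> Lp 2 \<Omega> \<Longrightarrow>
    L2_inner \<Omega> h (\<lambda>x. f x - g x) = L2_inner \<Omega> h f - L2_inner \<Omega> h g"
  by (simp add: L2_inner_def inner_diff_right Lp2_inner_integrable)

lemma L2_inner_scaleR_right: "L2_inner \<Omega> h (\<lambda>x. c *\<^sub>R f x) = c * L2_inner \<Omega> h f"
  by (simp add: L2_inner_def)

lemma L2_inner_scale_right:
  fixes f :: "'a::euclidean_space \<Rightarrow> real"
  shows "L2_inner \<Omega> h (\<lambda>x. c * f x) = c * L2_inner \<Omega> h f"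
  using L2_inner_scaleR_right[of \<Omega> h c f] by simp

lemmas L2_inner_linear = L2_inner_add_left L2_inner_diff_left L2_inner_scaleR_left
  L2_inner_scale_left L2_inner_add_right L2_inner_diff_right L2_inner_scaleR_right
  L2_inner_scale_right

lemma L2_inner_zero [simp]: "L2_inner \<Omega> (\<lambda>x. 0) g = 0" "L2_inner \<Omega> g (\<lambda>x. 0) = 0"
  by (simp_all add: L2_inner_def)

lemma L2_inner_cong_AE:
  assumes "f \<in> Lp 2 \<Omega>" "f' \<in> Lp 2 \<Omega>" "g \<in> Lp 2 \<Omega>" "g' \<in> Lp 2 \<Omega>"
    and "AE x in lebesgue_on \<Omega>. f x = f' x" "AE x in lebesgue_on \<Omega>. g x = g' x"
  shows "L2_inner \<Omega> f g = L2_inner \<Omega> f' g'"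
proof -
  note [measurable] = assms(1-4)[THEN Lp2_measurable]
  show ?thesis unfolding L2_inner_def
    by (rule integral_cong_AE) (use assms(5,6) in \<open>auto elim: eventually_elim2\<close>)
qed

lemma L2_inner_self_nonneg [simp]: "0 \<le> L2_inner \<Omega> f f"
  by (simp add: L2_inner_def)

lemma L2_norm_eq: "Lp_norm 2 \<Omega> f = sqrt (L2_inner \<Omega> f f)"
  by (simp add: Lp_norm_def L2_inner_def powr_half_sqrt power2_norm_eq_inner)

lemma L2_norm_sq: "(Lp_norm 2 \<Omega> f)\<^sup>2 = L2_inner \<Omega> f f"
  by (simp add: L2_norm_eq)

lemma L2_norm_nonneg [simp]: "0 \<le> Lp_norm 2 \<Omega> f"
  by (simp add: L2_norm_eq)

lemma L2_norm_zero [simp]: "Lp_norm 2 \<Omega> (\<lambda>x. 0) = 0"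
  by (simp add: L2_norm_eq)

lemma L2_norm_scaleR: "Lp_norm 2 \<Omega> (\<lambda>x. c *\<^sub>R f x) = \<bar>c\<bar> * Lp_norm 2 \<Omega> f"
  by (simp add: L2_norm_eq L2_inner_scaleR_left L2_inner_scaleR_right real_sqrt_mult
      flip: mult.assoc power2_eq_square)

lemma L2_norm_scale:
  fixes f :: "'a::euclidean_space \<Rightarrow> real"
  shows "Lp_norm 2 \<Omega> (\<lambda>x. c * f x) = \<bar>c\<bar> * Lp_norm 2 \<Omega> f"
  using L2_norm_scaleR[of \<Omega> c f] by simp

lemma L2_norm_diff_commute:
  "Lp_norm 2 \<Omega> (\<lambda>x. f x - g x) = Lp_norm 2 \<Omega> (\<lambda>x. g x - f x)"
  unfolding L2_norm_eq L2_inner_def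
  by (simp add: inner_diff_left inner_diff_right inner_commute algebra_simps)

lemma L2_norm_cong_AE:
  assumes "f \<in> Lp 2 \<Omega>" "f' \<in> Lp 2 \<Omega>" "AE x in lebesgue_on \<Omega>. f x = f' x"
  shows "Lp_norm 2 \<Omega> f = Lp_norm 2 \<Omega> f'"
  unfolding L2_norm_eq using L2_inner_cong_AE[OF assms(1,2) assms(1,2) assms(3,3)] by simp

lemma L2_norm_mono:
  assumes "f \<in> Lp 2 \<Omega>" "g \<in> Lp 2 \<Omega>" "AE x in lebesgue_on \<Omega>. norm (f x) \<le> norm (g x)"
  shows "Lp_norm 2 \<Omega> f \<le> Lp_norm 2 \<Omega> g"
proof -
  have "L2_inner \<Omega> f f \<le> L2_inner \<Omega> g g"
    unfolding L2_inner_def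
    using assms by (intro integral_mono_AE Lp2_inner_integrable)
      (auto elim!: eventually_mono simp: power_mono simp flip: power2_norm_eq_inner)
  then show ?thesis by (simp add: L2_norm_eq)
qed

text \<open>
  The quadratic polynomial \<open>t \<mapsto> \<parallel>f + t g\<parallel>\<^sup>2\<close> is nonnegative; it is evaluated at its minimum.
\<close>

lemma L2_Cauchy_Schwarz:
  assumes "f \<in> Lp 2 \<Omega>" "g \<in> Lp 2 \<Omega>"
  shows "\<bar>L2_inner \<Omega> f g\<bar> \<le> Lp_norm 2 \<Omega> f * Lp_norm 2 \<Omega> g"
proof -
  define A B C where "A = L2_inner \<Omega> f f" and "B = L2_inner \<Omega> f g" and "C = L2_inner \<Omega> g g"
  have quad: "0 \<le> A + 2 * t * B + t\<^sup>2 * C" for t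
  proof -
    have "0 \<le> L2_inner \<Omega> (\<lambda>x. f x + t *\<^sub>R g x) (\<lambda>x. f x + t *\<^sub>R g x)" by simp
    also have "\<dots> = A + 2 * t * B + t\<^sup>2 * C"
      using assms by (simp add: L2_inner_linear Lp2_closed A_def B_def C_def
          L2_inner_commute[of \<Omega> g f] algebra_simps power2_eq_square)
    finally show ?thesis .
  qed
  have "A \<ge> 0" "C \<ge> 0" by (simp_all add: A_def C_def)
  have "B\<^sup>2 \<le> A * C"
  proof (cases "C = 0")
    case True
    have "B = 0"
    proof (rule ccontr)
      assume "B \<noteq> 0"
      with quad[of "- (A + 1) / (2 * B)"] True show False by (simp add: field_simps)
    qed
    then show ?thesis using \<open>A \<ge> 0\<close> \<open>C \<ge> 0\<close> by simp
  next
    case False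
    then have "C > 0" using \<open>C \<ge> 0\<close> by simp
    have "0 \<le> C * (A + 2 * (- B / C) * B + (- B / C)\<^sup>2 * C)"
      using quad[of "- B / C"] \<open>C > 0\<close> by (intro mult_nonneg_nonneg) auto
    also have "\<dots> = A * C - B\<^sup>2" using \<open>C > 0\<close> by (simp add: field_simps power2_eq_square)
    finally show ?thesis by simp
  qed
  then have "\<bar>B\<bar> \<le> sqrt (A * C)" by (metis real_sqrt_abs real_sqrt_le_mono)
  then show ?thesis by (simp add: L2_norm_eq A_def B_def C_def real_sqrt_mult)
qed

lemma L2_inner_le:
  assumes "f \<in> Lp 2 \<Omega>" "g \<in> Lp 2 \<Omega>"
  shows "L2_inner \<Omega> f g \<le> Lp_norm 2 \<Omega> f * Lp_norm 2 \<Omega> g"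
  using L2_Cauchy_Schwarz[OF assms] by linarith

lemma L2_norm_triangle:
  assumes "f \<in> Lp 2 \<Omega>" "g \<in> Lp 2 \<Omega>"
  shows "Lp_norm 2 \<Omega> (\<lambda>x. f x + g x) \<le> Lp_norm 2 \<Omega> f + Lp_norm 2 \<Omega> g"
proof (rule power2_le_imp_le)
  show "(Lp_norm 2 \<Omega> (\<lambda>x. f x + g x))\<^sup>2 \<le> (Lp_norm 2 \<Omega> f + Lp_norm 2 \<Omega> g)\<^sup>2"
    using assms L2_inner_le[OF assms]
    by (simp add: L2_norm_sq power2_sum L2_inner_linear Lp2_closed L2_inner_commute[of \<Omega> g f])
qed simp

lemma L2_norm_triangle_diff:
  assumes "f \<in> Lp 2 \<Omega>" "g \<in> Lp 2 \<Omega>"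
  shows "Lp_norm 2 \<Omega> (\<lambda>x. f x - g x) \<le> Lp_norm 2 \<Omega> f + Lp_norm 2 \<Omega> g"
  using L2_norm_triangle[OF assms(1) Lp2_scaleR[OF assms(2), of "-1"]]
    L2_norm_scaleR[of \<Omega> "-1" g] by simp

lemma L2_norm_triangle3:
  assumes "f \<in> Lp 2 \<Omega>" "g \<in> Lp 2 \<Omega>" "h \<in> Lp 2 \<Omega>"
  shows "Lp_norm 2 \<Omega> (\<lambda>x. f x - h x)
    \<le> Lp_norm 2 \<Omega> (\<lambda>x. f x - g x) + Lp_norm 2 \<Omega> (\<lambda>x. g x - h x)"
  using L2_norm_triangle[OF Lp2_diff[OF assms(1,2)] Lp2_diff[OF assms(2,3)]] by simp

lemma L2_norm_eq_0_AE:
  assumes "f \<in> Lp 2 \<Omega>" "Lp_norm 2 \<Omega> f = 0"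
  shows "AE x in lebesgue_on \<Omega>. f x = 0"
proof -
  have "(\<integral>x. (norm (f x))\<^sup>2 \<partial>lebesgue_on \<Omega>) = 0"
    using assms(2) by (simp add: L2_norm_eq L2_inner_def power2_norm_eq_inner)
  then have "AE x in lebesgue_on \<Omega>. (norm (f x))\<^sup>2 = 0"
    using assms(1) integral_nonneg_eq_0_iff_AE[of "lebesgue_on \<Omega>" "\<lambda>x. (norm (f x))\<^sup>2"]
    by (simp add: Lp2_iff)
  then show ?thesis by simp
qed

lemma nn_integral_L2_norm:
  assumes "f \<in> Lp 2 \<Omega>"
  shows "(\<integral>\<^sup>+x. ennreal ((norm (f x))\<^sup>2) \<partial>lebesgue_on \<Omega>) = ennreal ((Lp_norm 2 \<Omega> f)\<^sup>2)"
  using assms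
  by (simp add: nn_integral_eq_integral Lp2_iff L2_norm_sq L2_inner_def power2_norm_eq_inner)

text \<open>
  Riesz--Fischer. Along a subsequence the squared \<open>L\<^sup>2\<close> norms of the increments \<open>d\<^sub>k\<close> are at most
  \<open>4\<^sup>-\<^sup>k\<close>, so \<open>\<Sum>k. 2\<^sup>k d\<^sub>k\<^sup>2\<close> has a finite integral. Hence almost everywhere
  \<open>d\<^sub>k = O(2\<^sup>-\<^sup>k\<^sup>/\<^sup>2)\<close> and the subsequence converges pointwise; Fatou's lemma
  upgrades this to convergence in norm of the whole sequence.
\<close>

lemma L2_complete:
  fixes f :: "nat \<Rightarrow> 'a::euclidean_space \<Rightarrow> 'b::euclidean_space"
  assumes f: "\<And>n. f n \<in> Lp 2 \<Omega>"
    and Cauchy: "\<And>e. e > 0 \<Longrightarrow> \<exists>N. \<forall>m\<ge>N. \<forall>n\<ge>N. Lp_norm 2 \<Omega> (\<lambda>x. f m x - f n x) < e"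
  obtains g where "g \<in> Lp 2 \<Omega>" "(\<lambda>n. Lp_norm 2 \<Omega> (\<lambda>x. f n x - g x)) \<longlonglongrightarrow> 0"
proof -
  let ?M = "lebesgue_on \<Omega>"
  have [measurable]: "f n \<in> borel_measurable ?M" for n using f by (simp add: Lp2_iff)
  have "\<forall>k. \<exists>N. \<forall>m\<ge>N. \<forall>n\<ge>N. Lp_norm 2 \<Omega> (\<lambda>x. f m x - f n x) < (1/2)^k"
    using Cauchy by simp
  then obtain N where N: "\<And>k m n. m \<ge> N k \<Longrightarrow> n \<ge> N k \<Longrightarrow> Lp_norm 2 \<Omega> (\<lambda>x. f m x - f n x) < (1/2)^k"
    by metis
  \<comment> \<open>Increasing indices beyond \<open>N k\<close>; the summand \<open>k\<close> makes them tend to infinity.\<close>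
  define r where "r k = (\<Sum>j\<le>k. N j) + k" for k
  have r_ge: "N k \<le> r k" "k \<le> r k" "r k \<le> r (Suc k)" for k
    using member_le_sum[of k "{..k}" N] by (auto simp: r_def intro: trans_le_add1)
  define d where "d k x = norm (f (r (Suc k)) x - f (r k) x)" for k x
  have [measurable]: "d k \<in> borel_measurable ?M" for k unfolding d_def by measurable
  have dint: "(\<integral>\<^sup>+x. ennreal (2^k * (d k x)\<^sup>2) \<partial>?M) \<le> ennreal ((1/2)^k)" for k
  proof -
    let ?c = "Lp_norm 2 \<Omega> (\<lambda>x. f (r (Suc k)) x - f (r k) x)"
    have c: "?c \<le> (1/2)^k" using N[of k "r (Suc k)" "r k"] r_ge[of k] by simp
    have "(\<integral>\<^sup>+x. ennreal (2^k * (d k x)\<^sup>2) \<partial>?M) = ennreal (2^k) * (\<integral>\<^sup>+x. ennreal ((d k x)\<^sup>2) \<partial>?M)"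
      by (subst nn_integral_cmult[symmetric]) (auto simp: ennreal_mult)
    also have "\<dots> = ennreal (2^k * ?c\<^sup>2)"
      unfolding d_def using nn_integral_L2_norm[OF Lp2_diff[OF f f], of "r (Suc k)" "r k"]
      by (simp add: ennreal_mult)
    also have "\<dots> \<le> ennreal (2^k * ((1/2)^k)\<^sup>2)"
      using c by (intro ennreal_leI mult_left_mono power_mono) auto
    also have "2^k * ((1/2)^k)\<^sup>2 = ((1/2)^k::real)"
      by (simp add: power2_eq_square power_divide)
    finally show ?thesis .
  qed
  have "(\<integral>\<^sup>+x. (\<Sum>k. ennreal (2^k * (d k x)\<^sup>2)) \<partial>?M) = (\<Sum>k. \<integral>\<^sup>+x. ennreal (2^k * (d k x)\<^sup>2) \<partial>?M)"
    by (rule nn_integral_suminf) measurable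
  also have "\<dots> \<le> (\<Sum>k. ennreal ((1/2)^k))" by (intro suminf_le dint) auto
  also have "\<dots> < \<infinity>" by (subst suminf_ennreal2) auto
  finally have "AE x in ?M. (\<Sum>k. ennreal (2^k * (d k x)\<^sup>2)) \<noteq> \<infinity>"
    by (intro nn_integral_PInf_AE) auto
  then have conv: "AE x in ?M. convergent (\<lambda>k. f (r k) x)"
  proof eventually_elim
    case (elim x)
    then have "summable (\<lambda>k. 2^k * (d k x)\<^sup>2)"
      using summable_suminf_not_top[of "\<lambda>k. 2^k * (d k x)\<^sup>2"] by simp
    then have "bounded (range (\<lambda>k. 2^k * (d k x)\<^sup>2))"
      using summable_LIMSEQ_zero convergent_imp_bounded convergentI by blast
    then obtain B where B: "\<And>k. norm (2^k * (d k x)\<^sup>2) \<le> B" by (auto simp: bounded_iff)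
    have "d k x \<le> sqrt B * (sqrt (1/2))^k" for k
    proof -
      have "(d k x)\<^sup>2 \<le> B * (1/2)^k" using B[of k] by (simp add: field_simps)
      then have "sqrt ((d k x)\<^sup>2) \<le> sqrt (B * (1/2)^k)" by (rule real_sqrt_le_mono)
      then show ?thesis by (simp add: d_def real_sqrt_mult real_sqrt_power)
    qed
    moreover have "summable (\<lambda>k. sqrt B * (sqrt (1/2))^k)"
      by (intro summable_mult summable_geometric) (simp add: real_sqrt_divide)
    moreover have "norm (d k x) = d k x" for k by (simp add: d_def)
    ultimately have "summable (\<lambda>k. d k x)"
      by (metis summable_comparison_test')
    then have "summable (\<lambda>k. f (r (Suc k)) x - f (r k) x)"
      unfolding d_def by (rule summable_norm_cancel)
    then have "convergent (\<lambda>n. \<Sum>k<n. f (r (Suc k)) x - f (r k) x)"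
      by (simp only: summable_iff_convergent)
    then have "convergent (\<lambda>n. f (r n) x - f (r 0) x)"
      by (simp only: sum_lessThan_telescope[of "\<lambda>k. f (r k) x"])
    then show ?case by (simp only: convergent_diff_const_right_iff)
  qed
  define g where "g x = lim (\<lambda>k. f (r k) x)" for x
  have gm [measurable]: "g \<in> borel_measurable ?M"
    unfolding g_def by (rule borel_measurable_lim_metric) measurable
  have bound: "(\<integral>\<^sup>+x. ennreal ((norm (f n x - g x))\<^sup>2) \<partial>?M) \<le> ennreal (((1/2)^j)\<^sup>2)"
    if "n \<ge> N j" for n j
  proof -
    have "(\<integral>\<^sup>+x. ennreal ((norm (f n x - g x))\<^sup>2) \<partial>?M)
        = (\<integral>\<^sup>+x. liminf (\<lambda>k. ennreal ((norm (f n x - f (r k) x))\<^sup>2)) \<partial>?M)"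
    proof (rule nn_integral_cong_AE, use conv in eventually_elim)
      case (elim x)
      then have "(\<lambda>k. f (r k) x) \<longlonglongrightarrow> g x" by (simp add: g_def convergent_LIMSEQ_iff)
      then have "(\<lambda>k. ennreal ((norm (f n x - f (r k) x))\<^sup>2)) \<longlonglongrightarrow> ennreal ((norm (f n x - g x))\<^sup>2)"
        by (intro tendsto_intros)
      then show ?case by (rule lim_imp_Liminf[symmetric, rotated]) simp
    qed
    also have "\<dots> \<le> liminf (\<lambda>k. \<integral>\<^sup>+x. ennreal ((norm (f n x - f (r k) x))\<^sup>2) \<partial>?M)"
      by (rule nn_integral_liminf) measurable
    also have "\<dots> \<le> ennreal (((1/2)^j)\<^sup>2)"
    proof (rule Liminf_le, simp, rule eventually_sequentiallyI[of "N j"])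
      fix k assume "k \<ge> N j"
      then have "Lp_norm 2 \<Omega> (\<lambda>x. f n x - f (r k) x) \<le> (1/2)^j"
        using N[of j n "r k"] that r_ge(2)[of k] by simp
      then show "(\<integral>\<^sup>+x. ennreal ((norm (f n x - f (r k) x))\<^sup>2) \<partial>?M) \<le> ennreal (((1/2)^j)\<^sup>2)"
        by (subst nn_integral_L2_norm) (auto intro!: ennreal_leI power_mono Lp2_diff f)
    qed
    finally show ?thesis .
  qed
  have diff: "(\<lambda>x. f n x - g x) \<in> Lp 2 \<Omega>" if "n \<ge> N j" for n j
  proof -
    have "(\<integral>\<^sup>+x. ennreal ((norm (f n x - g x))\<^sup>2) \<partial>?M) < \<infinity>"
      using bound[OF that] by (metis ennreal_less_top infinity_ennreal_def order_le_less_trans)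
    then have "integrable ?M (\<lambda>x. (norm (f n x - g x))\<^sup>2)"
      by (intro integrableI_bounded) auto
    then show ?thesis by (simp add: Lp2_iff)
  qed
  have "g \<in> Lp 2 \<Omega>"
    using Lp2_diff[OF f diff[OF order_refl], of "N 0" 0] by simp
  moreover have "(\<lambda>n. Lp_norm 2 \<Omega> (\<lambda>x. f n x - g x)) \<longlonglongrightarrow> 0"
  proof (rule LIMSEQ_I)
    fix e :: real assume "e > 0"
    then obtain j where j: "(1/2)^j < e" using real_arch_pow_inv[of e "1/2"] by auto
    have "Lp_norm 2 \<Omega> (\<lambda>x. f n x - g x) < e" if "n \<ge> N j" for n
    proof -
      have "ennreal ((Lp_norm 2 \<Omega> (\<lambda>x. f n x - g x))\<^sup>2) \<le> ennreal (((1/2)^j)\<^sup>2)"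
        using bound[OF that] by (simp add: nn_integral_L2_norm[OF diff[OF that]])
      then have "Lp_norm 2 \<Omega> (\<lambda>x. f n x - g x) \<le> (1/2)^j"
        by (simp add: power_mono_iff)
      then show ?thesis using j by (rule order_le_less_trans)
    qed
    then show "\<exists>no. \<forall>n\<ge>no. norm (Lp_norm 2 \<Omega> (\<lambda>x. f n x - g x) - 0) < e"
      by (auto intro!: exI[of _ "N j"])
  qed
  ultimately show thesis using that by blast
qed

section \<open>Integration by parts for test functions\<close>

lemma has_derivative_frechet:
  "f differentiable at x \<Longrightarrow> (f has_derivative frechet_derivative f (at x)) (at x)"
  by (simp add: frechet_derivative_works)

lemma DERIV_along_line:
  fixes f :: "'a::euclidean_space \<Rightarrow> real"
  assumes "f differentiable at (x + s *\<^sub>R b)"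
  shows "((\<lambda>s. f (x + s *\<^sub>R b)) has_real_derivative frechet_derivative f (at (x + s *\<^sub>R b)) b) (at s)"
proof -
  have "((\<lambda>s. x + s *\<^sub>R b) has_derivative (\<lambda>h. h *\<^sub>R b)) (at s)"
    by (auto intro!: derivative_eq_intros)
  from has_derivative_compose[OF this has_derivative_frechet[OF assms]]
  have "((\<lambda>s. f (x + s *\<^sub>R b)) has_derivative (\<lambda>h. frechet_derivative f (at (x + s *\<^sub>R b)) (h *\<^sub>R b))) (at s)" .
  moreover have "(\<lambda>h. frechet_derivative f (at (x + s *\<^sub>R b)) (h *\<^sub>R b))
      = (*) (frechet_derivative f (at (x + s *\<^sub>R b)) b)"
    using linear_frechet_derivative[OF assms] by (auto simp: linear_scale)
  ultimately show ?thesis by (simp add: has_field_derivative_def)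
qed

lemma frechet_derivative_outside_support:
  fixes f :: "'a::euclidean_space \<Rightarrow> real"
  assumes "closed K" "\<And>x. x \<notin> K \<Longrightarrow> f x = 0" "x \<notin> K"
  shows "frechet_derivative f (at x) b = 0"
proof -
  have "(f has_derivative (\<lambda>_. 0)) (at x)"
    by (rule has_derivative_transform_within_open[OF has_derivative_const, where s = "- K"])
      (use assms in auto)
  then show ?thesis by (metis frechet_derivative_at)
qed

text \<open>
  Difference quotients have integral \<open>0\<close> because Lebesgue measure is translation invariant; the
  mean value theorem provides the majorant needed to pass to the limit.
\<close>

lemma integral_partial_derivative_eq_0:
  fixes f :: "'a::euclidean_space \<Rightarrow> real"
  assumes diff: "\<And>x. f differentiable at x"
    and cont: "continuous_on UNIV (\<lambda>x. frechet_derivative f (at x) b)"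
    and K: "compact K" "\<And>x. x \<notin> K \<Longrightarrow> f x = 0"
  shows "(\<integral>x. frechet_derivative f (at x) b \<partial>lborel) = 0"
proof -
  define D where "D x = frechet_derivative f (at x) b" for x
  have D0: "D x = 0" if "x \<notin> K" for x
    unfolding D_def using frechet_derivative_outside_support[OF compact_imp_closed] K that by blast
  have contf: "continuous_on UNIV f"
    using diff by (simp add: differentiable_imp_continuous_on differentiable_on_def
        differentiable_at_withinI)
  have contD: "continuous_on UNIV D" using cont by (simp add: D_def)
  have [measurable]: "f \<in> borel_measurable borel" "D \<in> borel_measurable borel"
    using contf contD by (auto intro: borel_measurable_continuous_onI)
  have "bounded (D ` K)"
    using K contD by (meson compact_continuous_image compact_imp_bounded continuous_on_subset top_greatest)
  then obtain B' where B': "\<And>x. x \<in> K \<Longrightarrow> norm (D x) \<le> B'" by (auto simp: bounded_iff)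
  define B where "B = max B' 0"
  have B: "\<bar>D x\<bar> \<le> B" "0 \<le> B" for x using B'[of x] D0[of x] by (cases "x \<in> K"; force simp: B_def)+
  \<comment> \<open>All difference quotients with steps up to \<open>1\<close> are supported in this compact set.\<close>
  define K' where "K' = {x + y | x y. x \<in> K \<and> y \<in> cball 0 (norm b)}"
  have "compact K'" unfolding K'_def by (rule compact_sums[OF K(1) compact_cball])
  have K'0: "f x = 0" "f (x + t *\<^sub>R b) = 0" if "x \<notin> K'" "0 < t" "t \<le> 1" for x t
  proof -
    have *: "x + s *\<^sub>R b \<notin> K" if "0 \<le> s" "s \<le> 1" for s
    proof
      assume "x + s *\<^sub>R b \<in> K"
      moreover have "- (s *\<^sub>R b) \<in> cball 0 (norm b)" using that by (simp add: mult_left_le_one_le)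
      moreover have "x = (x + s *\<^sub>R b) + - (s *\<^sub>R b)" by simp
      ultimately have "x \<in> K'" unfolding K'_def by blast
      with \<open>x \<notin> K'\<close> show False ..
    qed
    show "f x = 0" "f (x + t *\<^sub>R b) = 0" using *[of 0] *[of t] that K(2) by auto
  qed
  define t where "t n = 1 / real (Suc n)" for n
  have t: "0 < t n" "t n \<le> 1" for n by (auto simp: t_def)
  have t0: "t \<longlonglongrightarrow> 0" unfolding t_def using LIMSEQ_inverse_real_of_nat by (simp add: inverse_eq_divide)
  define g where "g n x = (f (x + t n *\<^sub>R b) - f x) / t n" for n x
  have g_le: "\<bar>g n x\<bar> \<le> B * indicator K' x" for n x
  proof (cases "x \<in> K'")
    case True
    have "\<exists>z::real. z > 0 \<and> z < t n \<and> f (x + t n *\<^sub>R b) - f (x + 0 *\<^sub>R b) = (t n - 0) * D (x + z *\<^sub>R b)"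
      using MVT2[of 0 "t n" "\<lambda>s. f (x + s *\<^sub>R b)" "\<lambda>s. D (x + s *\<^sub>R b)"] t(1)[of n]
        DERIV_along_line[OF diff] by (auto simp: D_def)
    then obtain z where "f (x + t n *\<^sub>R b) - f x = t n * D (x + z *\<^sub>R b)" by auto
    then have "g n x = D (x + z *\<^sub>R b)" using t(1)[of n] by (simp add: g_def)
    then show ?thesis using B True by simp
  next
    case False
    then show ?thesis using K'0[OF False t] by (simp add: g_def)
  qed
  have "(\<lambda>n. \<integral>x. g n x \<partial>lborel) \<longlonglongrightarrow> (\<integral>x. D x \<partial>lborel)"
  proof (rule integral_dominated_convergence[where w = "\<lambda>x. B * indicator K' x"])
    show "g n \<in> borel_measurable lborel" for n unfolding g_def by measurable
    show "D \<in> borel_measurable lborel" by measurable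
    show "integrable lborel (\<lambda>x. B * indicator K' x)"
      using emeasure_compact_finite[OF \<open>compact K'\<close>] borel_compact[OF \<open>compact K'\<close>]
      by (intro integrable_mult_right integrable_real_indicator) auto
    show "AE x in lborel. (\<lambda>n. g n x) \<longlonglongrightarrow> D x"
    proof (rule AE_I2)
      fix x
      have "((\<lambda>s. f (x + s *\<^sub>R b)) has_real_derivative D x) (at 0)"
        using DERIV_along_line[of f x 0 b] diff by (simp add: D_def)
      then have "((\<lambda>h. (f (x + (0 + h) *\<^sub>R b) - f (x + 0 *\<^sub>R b)) / h) \<longlongrightarrow> D x) (at 0)"
        by (rule DERIV_D)
      moreover have "filterlim t (at 0) sequentially"
        using t0 t(1) by (auto simp: filterlim_at less_imp_neq[symmetric] intro!: always_eventually)
      ultimately show "(\<lambda>n. g n x) \<longlonglongrightarrow> D x"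
        unfolding g_def by (auto dest: filterlim_compose)
    qed
  qed (use g_le in auto)
  moreover have "(\<integral>x. g n x \<partial>lborel) = 0" for n
  proof -
    have "integrable lborel (\<lambda>x. indicator K x *\<^sub>R f x)"
      using contf K(1) by (intro borel_integrable_compact) (auto intro: continuous_on_subset)
    also have "(\<lambda>x. indicator K x *\<^sub>R f x) = f"
      using K(2) by (auto simp: indicator_def fun_eq_iff)
    finally have int: "integrable lborel f" .
    have "integrable (distr lborel borel ((+) (t n *\<^sub>R b))) f" by (subst lborel_distr_plus) fact
    then have int': "integrable lborel (\<lambda>x. f (t n *\<^sub>R b + x))"
      by (subst (asm) integrable_distr_eq) auto
    have "(\<integral>x. f x \<partial>lborel) = (\<integral>x. f x \<partial>distr lborel borel ((+) (t n *\<^sub>R b)))"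
      by (subst lborel_distr_plus) rule
    also have "\<dots> = (\<integral>x. f (t n *\<^sub>R b + x) \<partial>lborel)" by (rule integral_distr) auto
    finally show ?thesis using int int' by (simp add: g_def add.commute)
  qed
  ultimately show ?thesis by (simp add: D_def LIMSEQ_const_iff)
qed

lemma C_k_add_scale:
  assumes "C_k k f" "C_k k g"
  shows "C_k k (\<lambda>x. f x + c * g x)"
  using assms
proof (induction k arbitrary: f g)
  case 0
  then show ?case by (auto intro!: continuous_intros)
next
  case (Suc k)
  have fd: "f differentiable at x" "g differentiable at x" for x using Suc.prems by auto
  have "(\<lambda>x. frechet_derivative (\<lambda>x. f x + c * g x) (at x) b)
      = (\<lambda>x. frechet_derivative f (at x) b + c * frechet_derivative g (at x) b)" for b
  proof
    fix x
    have "((\<lambda>x. f x + c * g x) has_derivative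
        (\<lambda>h. frechet_derivative f (at x) h + c * frechet_derivative g (at x) h)) (at x)"
      by (intro derivative_intros has_derivative_frechet fd)
    then show "frechet_derivative (\<lambda>x. f x + c * g x) (at x) b
      = frechet_derivative f (at x) b + c * frechet_derivative g (at x) b"
      by (simp only: frechet_derivative_at[symmetric])
  qed
  moreover have "(\<lambda>x. f x + c * g x) differentiable at x" for x
    by (intro differentiable_add differentiable_mult differentiable_const fd)
  ultimately show ?case using Suc by simp
qed

lemma test_functionsD:
  assumes "\<phi> \<in> test_functions \<Omega>"
  obtains K where "compact K" "K \<subseteq> \<Omega>" "\<And>x. x \<notin> K \<Longrightarrow> \<phi> x = 0"
    "\<And>x b. x \<notin> K \<Longrightarrow> frechet_derivative \<phi> (at x) b = 0"
proof -
  define K where "K = closure {x. \<phi> x \<noteq> 0}"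
  have K: "compact K" "K \<subseteq> \<Omega>" "\<And>x. x \<notin> K \<Longrightarrow> \<phi> x = 0"
    using assms closure_subset[of "{x. \<phi> x \<noteq> 0}"] by (auto simp: test_functions_def K_def)
  show thesis
    by (rule that[OF K]) (auto intro: frechet_derivative_outside_support[OF compact_imp_closed[OF K(1)] K(3)])
qed

lemma test_functions_regular:
  assumes "\<phi> \<in> test_functions \<Omega>"
  shows "\<phi> differentiable at x" "continuous_on UNIV \<phi>"
    "b \<in> Basis \<Longrightarrow> continuous_on UNIV (\<lambda>x. frechet_derivative \<phi> (at x) b)"
proof -
  have "C_k 0 \<phi>" "C_k (Suc 0) \<phi>" using assms unfolding test_functions_def by blast+
  then show "\<phi> differentiable at x" "continuous_on UNIV \<phi>"
    "b \<in> Basis \<Longrightarrow> continuous_on UNIV (\<lambda>x. frechet_derivative \<phi> (at x) b)" by auto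
qed

lemma test_functionsI:
  assumes "\<And>k. C_k k \<phi>" "compact K" "K \<subseteq> \<Omega>" "\<And>x. x \<notin> K \<Longrightarrow> \<phi> x = 0"
  shows "\<phi> \<in> test_functions \<Omega>"
proof -
  have "closure {x. \<phi> x \<noteq> 0} \<subseteq> K"
    using assms(2,4) by (intro closure_minimal) (auto intro: compact_imp_closed)
  then show ?thesis
    using assms compact_Int_closed[of K "closure {x. \<phi> x \<noteq> 0}"]
    by (auto simp: test_functions_def Int_absorb1)
qed

lemma test_functions_add_scale:
  assumes "\<phi> \<in> test_functions \<Omega>" "\<psi> \<in> test_functions \<Omega>"
  shows "(\<lambda>x. \<phi> x + c * \<psi> x) \<in> test_functions \<Omega>"
proof -
  obtain K where K: "compact K" "K \<subseteq> \<Omega>" "\<And>x. x \<notin> K \<Longrightarrow> \<phi> x = 0"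
    by (rule test_functionsD[OF assms(1)]) blast
  obtain L where L: "compact L" "L \<subseteq> \<Omega>" "\<And>x. x \<notin> L \<Longrightarrow> \<psi> x = 0"
    by (rule test_functionsD[OF assms(2)]) blast
  show ?thesis
    by (rule test_functionsI[of _ "K \<union> L"])
      (use K L assms in \<open>auto simp: test_functions_def intro!: C_k_add_scale compact_Un\<close>)
qed

lemma test_functions_zero [simp]: "(\<lambda>x. 0) \<in> test_functions \<Omega>"
proof -
  have "C_k k (\<lambda>x::'a. 0)" for k
    by (induction k) simp_all
  then show ?thesis by (intro test_functionsI[where K = "{}"]) simp_all
qed

lemma integral_lebesgue_on_compact_support:
  fixes f :: "'a::euclidean_space \<Rightarrow> real"
  assumes "\<Omega> \<in> sets lebesgue" "K \<subseteq> \<Omega>" "\<And>x. x \<notin> K \<Longrightarrow> f x = 0" "f \<in> borel_measurable borel"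
  shows "(\<integral>x. f x \<partial>lebesgue_on \<Omega>) = (\<integral>x. f x \<partial>lborel)"
proof -
  have "(\<lambda>x. if x \<in> \<Omega> then f x else 0) = f" using assms(2,3) by fastforce
  then have "(\<integral>x. f x \<partial>lebesgue_on \<Omega>) = (\<integral>x. f x \<partial>lebesgue)"
    using Lebesgue_Measure.integral_restrict_UNIV[OF assms(1), of f] by simp
  also have "\<dots> = (\<integral>x. f x \<partial>lborel)" using assms(4) by (intro integral_completion) auto
  finally show ?thesis .
qed

lemma Lp2_bounded:
  assumes "\<Omega> \<in> lmeasurable" "f \<in> borel_measurable (lebesgue_on \<Omega>)" "\<And>x. x \<in> \<Omega> \<Longrightarrow> norm (f x) \<le> B"
  shows "f \<in> Lp 2 \<Omega>"
proof -
  have [measurable]: "f \<in> borel_measurable (lebesgue_on \<Omega>)" by fact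
  interpret finite_measure "lebesgue_on \<Omega>"
    by (rule finite_measure_lebesgue_on) fact
  have "integrable (lebesgue_on \<Omega>) (\<lambda>x. (norm (f x))\<^sup>2)"
    by (rule integrable_const_bound[of _ "B\<^sup>2"]) (use assms(3) in \<open>auto intro!: power_mono\<close>)
  then show ?thesis by (simp add: Lp2_iff)
qed

lemma Lp2_continuous:
  fixes f :: "'a::euclidean_space \<Rightarrow> 'b::euclidean_space"
  assumes "\<Omega> \<in> sets lebesgue" "bounded \<Omega>" "continuous_on UNIV f"
  shows "f \<in> Lp 2 \<Omega>"
proof -
  have "bounded (f ` closure \<Omega>)"
    using assms by (meson compact_closure compact_continuous_image compact_imp_bounded
        continuous_on_subset top_greatest)
  then obtain B where B: "\<And>x. x \<in> closure \<Omega> \<Longrightarrow> norm (f x) \<le> B" by (auto simp: bounded_iff)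
  have "f \<in> borel_measurable (lebesgue_on \<Omega>)"
    using assms by (meson continuous_imp_measurable_on_sets_lebesgue continuous_on_subset top_greatest)
  moreover have "\<Omega> \<in> lmeasurable" using assms by (simp add: bounded_set_imp_lmeasurable)
  ultimately show ?thesis using B closure_subset by (intro Lp2_bounded[of _ _ B]) auto
qed

definition classical_gradient :: "('a::euclidean_space \<Rightarrow> real) \<Rightarrow> 'a \<Rightarrow> 'a" where
  "classical_gradient \<phi> x = (\<Sum>b\<in>Basis. frechet_derivative \<phi> (at x) b *\<^sub>R b)"

lemma classical_gradient_inner:
  "b \<in> Basis \<Longrightarrow> classical_gradient \<phi> x \<bullet> b = frechet_derivative \<phi> (at x) b"
  by (simp add: classical_gradient_def inner_sum_left inner_Basis if_distrib sum.If_cases cong: if_cong)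

lemma test_functions_Lp2:
  assumes "\<Omega> \<in> sets lebesgue" "bounded \<Omega>" "\<phi> \<in> test_functions \<Omega>"
  shows "\<phi> \<in> Lp 2 \<Omega>" "classical_gradient \<phi> \<in> Lp 2 \<Omega>"
    "b \<in> Basis \<Longrightarrow> (\<lambda>x. frechet_derivative \<phi> (at x) b) \<in> Lp 2 \<Omega>"
proof -
  note p = test_functions_regular[OF assms(3)]
  show "\<phi> \<in> Lp 2 \<Omega>" by (rule Lp2_continuous[OF assms(1,2) p(2)])
  show "(\<lambda>x. frechet_derivative \<phi> (at x) b) \<in> Lp 2 \<Omega>" if "b \<in> Basis" for b
    by (rule Lp2_continuous[OF assms(1,2) p(3)[OF that]])
  have "continuous_on UNIV (classical_gradient \<phi>)"
    unfolding classical_gradient_def[abs_def]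
    by (intro continuous_on_sum continuous_on_scaleR continuous_on_const p(3))
  then show "classical_gradient \<phi> \<in> Lp 2 \<Omega>" by (rule Lp2_continuous[OF assms(1,2)])
qed

text \<open>
  Integration by parts is the vanishing of \<open>\<integral> \<partial>\<^sub>b (\<phi> \<psi>)\<close>.
\<close>

lemma test_functions_weak_gradient:
  assumes \<Omega>: "\<Omega> \<in> sets lebesgue" "bounded \<Omega>" and \<phi>: "\<phi> \<in> test_functions \<Omega>"
  shows "has_weak_gradient \<Omega> \<phi> (classical_gradient \<phi>)"
  unfolding has_weak_gradient_def
proof (intro ballI)
  fix \<psi> b assume \<psi>: "\<psi> \<in> test_functions \<Omega>" and b: "b \<in> (Basis :: 'a set)"
  note p = test_functions_regular[OF \<phi>] and q = test_functions_regular[OF \<psi>]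
  obtain K where K: "compact K" "K \<subseteq> \<Omega>" "\<And>x. x \<notin> K \<Longrightarrow> \<phi> x = 0"
    "\<And>x b. x \<notin> K \<Longrightarrow> frechet_derivative \<phi> (at x) b = 0"
    by (rule test_functionsD[OF \<phi>]) blast
  let ?D = "\<lambda>x. frechet_derivative \<phi> (at x) b * \<psi> x + \<phi> x * frechet_derivative \<psi> (at x) b"
  have D: "frechet_derivative (\<lambda>x. \<phi> x * \<psi> x) (at x) b = ?D x" for x
  proof -
    have "((\<lambda>x. \<phi> x * \<psi> x) has_derivative
      (\<lambda>h. \<phi> x * frechet_derivative \<psi> (at x) h + frechet_derivative \<phi> (at x) h * \<psi> x)) (at x)"
      by (intro derivative_intros has_derivative_frechet p q)
    then show ?thesis by (subst frechet_derivative_at[symmetric]) (auto simp: algebra_simps)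
  qed
  have contD: "continuous_on UNIV ?D" using p q b by (auto intro!: continuous_intros)
  have "0 = (\<integral>x. ?D x \<partial>lborel)"
    using integral_partial_derivative_eq_0[of "\<lambda>x. \<phi> x * \<psi> x" b K] D p q K(1,3) contD
    by (simp add: differentiable_mult)
  also have "\<dots> = (\<integral>x. ?D x \<partial>lebesgue_on \<Omega>)"
    using contD K \<Omega>(1)
    by (intro integral_lebesgue_on_compact_support[symmetric, of _ K]) (auto intro: borel_measurable_continuous_onI)
  also have "\<dots> = (\<integral>x. frechet_derivative \<phi> (at x) b * \<psi> x \<partial>lebesgue_on \<Omega>)
      + (\<integral>x. \<phi> x * frechet_derivative \<psi> (at x) b \<partial>lebesgue_on \<Omega>)"
    using test_functions_Lp2[OF \<Omega> \<phi>] test_functions_Lp2[OF \<Omega> \<psi>] b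
    by (intro Bochner_Integration.integral_add Lp2_mult_integrable) auto
  finally show "(\<integral>x. \<phi> x * frechet_derivative \<psi> (at x) b \<partial>lebesgue_on \<Omega>)
      = - (\<integral>x. (classical_gradient \<phi> x \<bullet> b) * \<psi> x \<partial>lebesgue_on \<Omega>)"
    using b by (simp add: classical_gradient_inner)
qed

text \<open>
  The Poincare inequality: for a coordinate direction \<open>b\<close>, integrating
  \<open>\<partial>\<^sub>b ((x \<bullet> b) \<phi>\<^sup>2) = \<phi>\<^sup>2 + 2 (x \<bullet> b) \<phi> \<partial>\<^sub>b\<phi>\<close> gives \<open>\<parallel>\<phi>\<parallel>\<^sup>2 \<le> 2 R \<parallel>\<phi>\<parallel> \<parallel>\<partial>\<^sub>b\<phi>\<parallel>\<close>.
\<close>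

lemma Poincare_test_functions:
  assumes \<Omega>: "\<Omega> \<in> sets lebesgue" "\<And>x. x \<in> \<Omega> \<Longrightarrow> norm x \<le> R" and \<phi>: "\<phi> \<in> test_functions \<Omega>"
    and R: "0 \<le> R"
  shows "Lp_norm 2 \<Omega> \<phi> \<le> 2 * R * Lp_norm 2 \<Omega> (classical_gradient \<phi>)"
proof -
  obtain b :: 'a where b: "b \<in> Basis" using nonempty_Basis by blast
  have bdd: "bounded \<Omega>" using \<Omega>(2) by (auto simp: bounded_iff)
  note p = test_functions_regular[OF \<phi>] and L = test_functions_Lp2[OF \<Omega>(1) bdd \<phi>]
  obtain K where K: "compact K" "K \<subseteq> \<Omega>" "\<And>x. x \<notin> K \<Longrightarrow> \<phi> x = 0"
    "\<And>x b. x \<notin> K \<Longrightarrow> frechet_derivative \<phi> (at x) b = 0"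
    by (rule test_functionsD[OF \<phi>]) blast
  let ?f = "\<lambda>x. (x \<bullet> b) * (\<phi> x * \<phi> x)"
  let ?g = "\<lambda>x. (x \<bullet> b) * frechet_derivative \<phi> (at x) b"
  let ?D = "\<lambda>x. \<phi> x * \<phi> x + 2 * (\<phi> x * ?g x)"
  have D: "frechet_derivative ?f (at x) b = ?D x" "?f differentiable at x" for x
  proof -
    have *: "(?f has_derivative (\<lambda>h. (x \<bullet> b) * (\<phi> x * frechet_derivative \<phi> (at x) h + frechet_derivative \<phi> (at x) h * \<phi> x)
       + (h \<bullet> b) * (\<phi> x * \<phi> x))) (at x)"
      by (intro derivative_intros has_derivative_frechet p)
    then show "?f differentiable at x" by (auto simp: differentiable_def)
    show "frechet_derivative ?f (at x) b = ?D x"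
      using b by (subst frechet_derivative_at[OF *, symmetric]) (auto simp: algebra_simps)
  qed
  have contD: "continuous_on UNIV ?D" using p b by (auto intro!: continuous_intros)
  have gL: "?g \<in> Lp 2 \<Omega>"
    using b p by (intro Lp2_continuous \<Omega>(1) bdd) (auto intro!: continuous_intros)
  have "0 = (\<integral>x. ?D x \<partial>lborel)"
    using integral_partial_derivative_eq_0[of ?f b K] D K(1,3) contD by simp
  also have "\<dots> = (\<integral>x. ?D x \<partial>lebesgue_on \<Omega>)"
    using contD K \<Omega>(1)
    by (intro integral_lebesgue_on_compact_support[symmetric, of _ K]) (auto intro: borel_measurable_continuous_onI)
  also have "\<dots> = L2_inner \<Omega> \<phi> \<phi> + 2 * L2_inner \<Omega> \<phi> ?g"
    unfolding L2_inner_def using Lp2_mult_integrable[OF L(1) L(1)] Lp2_mult_integrable[OF L(1) gL] by simp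
  finally have "(Lp_norm 2 \<Omega> \<phi>)\<^sup>2 = - 2 * L2_inner \<Omega> \<phi> ?g" by (simp add: L2_norm_sq)
  also have "\<dots> \<le> 2 * (Lp_norm 2 \<Omega> \<phi> * Lp_norm 2 \<Omega> ?g)"
    using L2_Cauchy_Schwarz[OF L(1) gL] by linarith
  finally have "Lp_norm 2 \<Omega> \<phi> * Lp_norm 2 \<Omega> \<phi> \<le> Lp_norm 2 \<Omega> \<phi> * (2 * Lp_norm 2 \<Omega> ?g)"
    by (simp add: power2_eq_square)
  then have 1: "Lp_norm 2 \<Omega> \<phi> \<le> 2 * Lp_norm 2 \<Omega> ?g"
    using L2_norm_nonneg[of \<Omega> \<phi>] L2_norm_nonneg[of \<Omega> ?g]
    by (smt (verit) mult_le_cancel_left_pos)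
  have "norm (?g x) \<le> norm (R *\<^sub>R classical_gradient \<phi> x)" if "x \<in> \<Omega>" for x
  proof -
    have "\<bar>x \<bullet> b\<bar> \<le> R" using Basis_le_norm[OF b, of x] \<Omega>(2)[OF that] by simp
    moreover have "\<bar>frechet_derivative \<phi> (at x) b\<bar> \<le> norm (classical_gradient \<phi> x)"
      using Basis_le_norm[OF b, of "classical_gradient \<phi> x"] by (simp add: classical_gradient_inner b)
    ultimately show ?thesis using R by (auto simp: abs_mult intro!: mult_mono)
  qed
  then have "Lp_norm 2 \<Omega> ?g \<le> Lp_norm 2 \<Omega> (\<lambda>x. R *\<^sub>R classical_gradient \<phi> x)"
    using gL L(2) by (intro L2_norm_mono Lp2_scaleR) (auto intro!: AE_I2)
  also have "\<dots> = R * Lp_norm 2 \<Omega> (classical_gradient \<phi>)" using R by (simp add: L2_norm_scaleR)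
  finally show ?thesis using 1 by simp
qed

section \<open>Density of test functions\<close>

text \<open>
  The functions \<open>P(1/t) exp(-1/t)\<close>, extended by \<open>0\<close> to \<open>t \<le> 0\<close>. Allowing all polynomials \<open>P\<close> makes
  the family closed under differentiation; \<open>flat 1\<close> is the usual building block of bump functions.
\<close>

definition flat :: "real poly \<Rightarrow> real \<Rightarrow> real" where
  "flat P t = (if t > 0 then poly P (1 / t) * exp (- (1 / t)) else 0)"

lemma flat_tendsto_0: "((flat P) \<longlongrightarrow> 0) (at 0)"
proof -
  have "((\<lambda>s. poly P s * exp (- s)) \<longlongrightarrow> 0) at_top"
  proof -
    have "((\<lambda>s::real. \<Sum>i\<le>degree P. coeff P i * (s ^ i / exp s)) \<longlongrightarrow> (\<Sum>i\<le>degree P. coeff P i * 0)) at_top"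
      by (intro tendsto_intros tendsto_power_div_exp_0)
    moreover have "(\<lambda>s. poly P s * exp (- s)) = (\<lambda>s. \<Sum>i\<le>degree P. coeff P i * (s ^ i / exp s))"
      by (auto simp: poly_altdef exp_minus sum_distrib_right divide_inverse mult.assoc)
    ultimately show ?thesis by simp
  qed
  moreover have "filterlim (\<lambda>t::real. 1 / t) at_top (at_right 0)"
    using filterlim_inverse_at_top_right by (simp add: inverse_eq_divide)
  ultimately have "((\<lambda>t. poly P (1 / t) * exp (- (1 / t))) \<longlongrightarrow> 0) (at_right 0)"
    by (rule filterlim_compose)
  then have "(flat P \<longlongrightarrow> 0) (at_right 0)"
    by (rule Lim_transform_eventually) (auto simp: flat_def eventually_at_filter)
  moreover have "(flat P \<longlongrightarrow> 0) (at_left 0)"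
    by (rule tendsto_eventually) (auto simp: flat_def eventually_at_filter)
  ultimately show ?thesis by (simp add: filterlim_split_at)
qed

text \<open>The derivative at \<open>0\<close> is \<open>0\<close>, because \<open>flat P t / t = flat (s P(s)) t\<close> tends to \<open>0\<close>.\<close>

lemma DERIV_flat:
  "(flat P has_real_derivative flat ([:0, 0, 1:] * (P - pderiv P)) t) (at t)"
proof (cases t "0::real" rule: linorder_cases)
  case less
  have "(flat P has_real_derivative 0) (at t)"
    by (rule has_field_derivative_transform_within_open[OF DERIV_const[of 0], where S = "{..<0}"])
      (use less in \<open>auto simp: flat_def\<close>)
  then show ?thesis using less by (simp add: flat_def)
next
  case equal
  have "((\<lambda>h. (flat P h - flat P 0) / (h - 0)) \<longlongrightarrow> 0) (at 0)"
    by (rule Lim_transform_eventually[OF flat_tendsto_0[of "pCons 0 P"]])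
      (auto simp: flat_def eventually_at_filter)
  then show ?thesis using equal by (simp add: flat_def has_field_derivative_iff)
next
  case greater
  have "((\<lambda>t. poly P (1 / t) * exp (- (1 / t))) has_real_derivative
      flat ([:0, 0, 1:] * (P - pderiv P)) t) (at t)"
    using greater by (auto intro!: derivative_eq_intros DERIV_chain2[OF poly_DERIV]
        simp: flat_def field_simps power2_eq_square)
  then show ?thesis
    by (rule has_field_derivative_transform_within_open[where S = "{0<..}"])
      (use greater in \<open>auto simp: flat_def\<close>)
qed

text \<open>
  A class of functions that is closed under partial derivatives, so that its members are smooth;
  closure under products makes it contain bump functions on boxes.
\<close>

inductive_set smooth_algebra :: "('a::euclidean_space \<Rightarrow> real) set" where
  const: "(\<lambda>x. c) \<in> smooth_algebra"
| flat: "(\<lambda>x. flat P (s * (x \<bullet> e) + c)) \<in> smooth_algebra"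
| add: "f \<in> smooth_algebra \<Longrightarrow> g \<in> smooth_algebra \<Longrightarrow> (\<lambda>x. f x + g x) \<in> smooth_algebra"
| mult: "f \<in> smooth_algebra \<Longrightarrow> g \<in> smooth_algebra \<Longrightarrow> (\<lambda>x. f x * g x) \<in> smooth_algebra"

lemma smooth_algebra_derivative:
  assumes "f \<in> smooth_algebra"
  shows "\<exists>f'. (\<forall>x. (f has_derivative f' x) (at x)) \<and> (\<forall>b. (\<lambda>x. f' x b) \<in> smooth_algebra)"
  using assms
proof induction
  case (const c)
  show ?case by (rule exI[of _ "\<lambda>x h. 0"]) (auto intro: smooth_algebra.const)
next
  case (flat P s e c)
  let ?Q = "[:0, 0, 1:] * (P - pderiv P)"
  show ?case
  proof (intro exI conjI allI)
    fix x
    have "((\<lambda>x. s * (x \<bullet> e) + c) has_derivative (\<lambda>h. s * (h \<bullet> e))) (at x)"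
      by (auto intro!: derivative_eq_intros)
    from has_derivative_compose[OF this DERIV_flat[unfolded has_field_derivative_def]]
    show "((\<lambda>x. flat P (s * (x \<bullet> e) + c)) has_derivative
      (\<lambda>h. flat ?Q (s * (x \<bullet> e) + c) * (s * (h \<bullet> e)))) (at x)" .
  next
    fix b
    show "(\<lambda>x. flat ?Q (s * (x \<bullet> e) + c) * (s * (b \<bullet> e))) \<in> smooth_algebra"
      by (intro smooth_algebra.intros)
  qed
next
  case (add f g)
  then obtain f' g' where
    f': "\<And>x. (f has_derivative f' x) (at x)" "\<And>b. (\<lambda>x. f' x b) \<in> smooth_algebra" and
    g': "\<And>x. (g has_derivative g' x) (at x)" "\<And>b. (\<lambda>x. g' x b) \<in> smooth_algebra" by blast
  show ?case
    by (rule exI[of _ "\<lambda>x h. f' x h + g' x h"])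
      (auto intro!: derivative_intros f' g' smooth_algebra.intros)
next
  case (mult f g)
  then obtain f' g' where
    f': "\<And>x. (f has_derivative f' x) (at x)" "\<And>b. (\<lambda>x. f' x b) \<in> smooth_algebra" and
    g': "\<And>x. (g has_derivative g' x) (at x)" "\<And>b. (\<lambda>x. g' x b) \<in> smooth_algebra" by blast
  show ?case
    by (rule exI[of _ "\<lambda>x h. f x * g' x h + f' x h * g x"])
      (auto intro!: has_derivative_mult f' g' smooth_algebra.intros mult)
qed

lemma smooth_algebra_C_k: "f \<in> smooth_algebra \<Longrightarrow> C_k k f"
proof (induction k arbitrary: f)
  case 0
  then obtain f' where "\<And>x. (f has_derivative f' x) (at x)"
    using smooth_algebra_derivative by blast
  then have "isCont f x" for x by (rule has_derivative_continuous)
  then show ?case by (simp add: continuous_at_imp_continuous_on)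
next
  case (Suc k)
  obtain f' where f': "\<And>x. (f has_derivative f' x) (at x)" "\<And>b. (\<lambda>x. f' x b) \<in> smooth_algebra"
    using smooth_algebra_derivative[OF Suc.prems] by blast
  have "frechet_derivative f (at x) = f' x" for x using frechet_derivative_at[OF f'(1)] by simp
  then show ?case using f' Suc.IH by (auto simp: differentiable_def)
qed

lemma smooth_algebra_prod:
  "finite I \<Longrightarrow> (\<And>i. i \<in> I \<Longrightarrow> f i \<in> smooth_algebra) \<Longrightarrow> (\<lambda>x. \<Prod>i\<in>I. f i x) \<in> smooth_algebra"
  by (induction I rule: finite_induct) (auto intro: smooth_algebra.intros)

text \<open>
  Every factor is a value \<open>flat 1 (n s - 1)\<close>, where \<open>s\<close> is the signed distance to a face of the box. It
  vanishes for \<open>s \<le> 1/n\<close>, which keeps the support away from the boundary of the open box, and tends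
  to \<open>1\<close> as \<open>n \<rightarrow> \<infinity>\<close> for every \<open>s > 0\<close>.
\<close>

definition box_bump :: "real \<Rightarrow> 'a::euclidean_space \<Rightarrow> 'a \<Rightarrow> 'a \<Rightarrow> real" where
  "box_bump n a b x = (\<Prod>i\<in>Basis. flat 1 (n * (x \<bullet> i) + (- n * (a \<bullet> i) - 1)) *
      flat 1 (- n * (x \<bullet> i) + (n * (b \<bullet> i) - 1)))"

lemma box_bump_smooth: "box_bump n a b \<in> smooth_algebra"
  unfolding box_bump_def by (intro smooth_algebra_prod smooth_algebra.intros) auto

lemma flat_1_range: "0 \<le> flat 1 t" "flat 1 t \<le> 1"
  by (auto simp: flat_def)

lemma box_bump_range: "0 \<le> box_bump n a b x" "box_bump n a b x \<le> 1"
  unfolding box_bump_def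
  by (auto intro!: prod_nonneg prod_le_1 mult_nonneg_nonneg mult_le_one flat_1_range)

lemma box_bump_support:
  assumes "n > 0" "x \<notin> cbox (a + (1 / n) *\<^sub>R One) (b - (1 / n) *\<^sub>R One)"
  shows "box_bump n a b x = 0"
proof -
  obtain i where i: "i \<in> Basis" "x \<bullet> i < a \<bullet> i + 1 / n \<or> b \<bullet> i - 1 / n < x \<bullet> i"
    using assms(2) by (force simp: mem_box inner_add_left inner_diff_left not_le)
  then have "flat 1 (n * (x \<bullet> i) + (- n * (a \<bullet> i) - 1)) *
      flat 1 (- n * (x \<bullet> i) + (n * (b \<bullet> i) - 1)) = 0"
    using assms(1) by (auto simp: flat_def field_simps)
  then show ?thesis unfolding box_bump_def using i(1) by (auto intro!: prod_zero)
qed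

lemma flat_1_tendsto_1:
  assumes "c > 0"
  shows "(\<lambda>n. flat 1 (real (Suc n) * c - 1)) \<longlonglongrightarrow> 1"
proof -
  have "filterlim (\<lambda>n. - 1 + c * real (Suc n)) at_top sequentially"
    by (intro filterlim_tendsto_add_at_top[OF tendsto_const]
        filterlim_tendsto_pos_mult_at_top[OF tendsto_const assms]
        filterlim_compose[OF filterlim_real_sequentially filterlim_Suc])
  then have lim: "filterlim (\<lambda>n. real (Suc n) * c - 1) at_top sequentially"
    by (simp add: algebra_simps)
  have "((\<lambda>t::real. exp (- (1 / t))) \<longlongrightarrow> exp (- 0)) at_top"
    by (intro tendsto_intros tendsto_divide_0[OF tendsto_const] filterlim_at_top_imp_at_infinity filterlim_ident)
  moreover have "\<forall>\<^sub>F t in at_top. exp (- (1 / t)) = flat 1 t"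
    by (rule eventually_mono[OF eventually_gt_at_top[of 0]]) (simp add: flat_def)
  ultimately have "(flat 1 \<longlongrightarrow> exp (- 0)) at_top" by (rule Lim_transform_eventually)
  then have "(flat 1 \<longlongrightarrow> 1) at_top" by simp
  from filterlim_compose[OF this lim] show ?thesis .
qed

lemma box_bump_tendsto_1:
  assumes "x \<in> box a b"
  shows "(\<lambda>n. box_bump (real (Suc n)) a b x) \<longlonglongrightarrow> 1"
proof -
  have "(\<lambda>n. \<Prod>i\<in>Basis. flat 1 (real (Suc n) * (x \<bullet> i - a \<bullet> i) - 1) * flat 1 (real (Suc n) * (b \<bullet> i - x \<bullet> i) - 1))
    \<longlonglongrightarrow> (\<Prod>i\<in>(Basis :: 'a set). 1 * 1)"
    using assms by (intro tendsto_prod tendsto_mult flat_1_tendsto_1) (auto simp: mem_box)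
  then show ?thesis by (simp add: box_bump_def algebra_simps)
qed

text \<open>
  If \<open>U\<close> is the union of open boxes with bump functions \<open>\<phi>\<^sub>i\<close>, then
  \<open>1 - (\<Prod>i<n. 1 - \<phi>\<^sub>i)\<close> tends to the indicator function of \<open>U\<close>, no matter how the
  boxes overlap.
\<close>

lemma open_indicator_approx:
  fixes U :: "'a::euclidean_space set"
  assumes "open U"
  obtains F where "\<And>n. F n \<in> test_functions U" "\<And>n x. \<bar>F n x\<bar> \<le> indicator U x"
    "\<And>x. (\<lambda>n. F n x) \<longlonglongrightarrow> indicator U x"
proof -
  obtain D where D: "countable D" "\<And>X. X \<in> D \<Longrightarrow> X \<subseteq> U" "\<And>X. X \<in> D \<Longrightarrow> \<exists>a b. X = box a b" "\<Union>D = U"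
    using open_countable_Union_open_box[OF assms] by (metis Pow_iff subsetD)
  \<comment> \<open>The empty box is added so that the enumeration makes sense even if \<open>D\<close> is empty.\<close>
  define E where "E = insert {} D"
  have "\<exists>a b. from_nat_into E i = box a (b :: 'a) \<and> box a b \<subseteq> U" for i
  proof -
    have "from_nat_into E i \<in> E" by (rule from_nat_into) (simp add: E_def)
    moreover have "\<exists>a b. {} = box a (b :: 'a)"
      by (metis box_eq_empty(1) nonempty_Basis ex_in_conv order_refl)
    ultimately show ?thesis using D(2,3) unfolding E_def by (metis empty_subsetI insertE)
  qed
  then obtain a b where ab: "\<And>i. from_nat_into E i = box (a i) (b i)" "\<And>i. box (a i) (b i) \<subseteq> U"
    by metis
  have "U = \<Union>(range (from_nat_into E))"
    using D(1,4) by (subst range_from_nat_into) (auto simp: E_def)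
  then have cover: "U = (\<Union>i. box (a i) (b i))" using ab(1) by simp
  define F where "F n x = 1 - (\<Prod>i<n. 1 - box_bump (real (Suc n)) (a i) (b i) x)" for n x
  have F01: "0 \<le> F n x" "F n x \<le> 1" for n x
    by (auto simp: F_def box_bump_range intro!: prod_le_1 prod_nonneg)
  have Fsupp: "F n x = 0"
    if "x \<notin> (\<Union>i<n. cbox (a i + (1 / real (Suc n)) *\<^sub>R One) (b i - (1 / real (Suc n)) *\<^sub>R One))" for n x
  proof -
    have "box_bump (real (Suc n)) (a i) (b i) x = 0" if "i < n" for i
      by (rule box_bump_support) (use that \<open>x \<notin> _\<close> in auto)
    then show ?thesis by (simp add: F_def)
  qed
  have sub: "(\<Union>i<n. cbox (a i + (1 / real (Suc n)) *\<^sub>R One) (b i - (1 / real (Suc n)) *\<^sub>R One)) \<subseteq> U" for n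
  proof -
    have "cbox (a i + (1 / real (Suc n)) *\<^sub>R One) (b i - (1 / real (Suc n)) *\<^sub>R One) \<subseteq> box (a i) (b i)" for i
    proof
      fix x assume x: "x \<in> cbox (a i + (1 / real (Suc n)) *\<^sub>R One) (b i - (1 / real (Suc n)) *\<^sub>R One)"
      have pos: "(0::real) < 1 / real (Suc n)" by simp
      have "a i \<bullet> k < x \<bullet> k \<and> x \<bullet> k < b i \<bullet> k" if "k \<in> Basis" for k
      proof -
        have "a i \<bullet> k + 1 / real (Suc n) \<le> x \<bullet> k \<and> x \<bullet> k \<le> b i \<bullet> k - 1 / real (Suc n)"
          using x that unfolding mem_box by (simp add: inner_add_left inner_diff_left)
        then show ?thesis using pos by linarith
      qed
      then show "x \<in> box (a i) (b i)" unfolding mem_box by blast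
    qed
    then show ?thesis using cover by blast
  qed
  show thesis
  proof
    fix n
    have "F n \<in> smooth_algebra"
    proof -
      have "(\<lambda>x. 1 + (- 1) * (\<Prod>i<n. 1 + (- 1) * box_bump (real (Suc n)) (a i) (b i) x)) \<in> smooth_algebra"
        by (intro smooth_algebra.intros smooth_algebra_prod box_bump_smooth finite_lessThan)
      then show ?thesis by (simp add: F_def[abs_def])
    qed
    then show "F n \<in> test_functions U"
      by (intro test_functionsI[OF _ _ sub Fsupp] compact_UN) (auto intro: smooth_algebra_C_k)
  next
    fix n x
    show "\<bar>F n x\<bar> \<le> indicator U x"
      using F01[of n x] Fsupp[of x n] sub[of n] by (cases "x \<in> U") (auto simp: indicator_def)
  next
    fix x
    show "(\<lambda>n. F n x) \<longlonglongrightarrow> indicator U x"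
    proof (cases "x \<in> U")
      case False
      then have "F n x = 0" for n using Fsupp[of x n] sub[of n] by blast
      then show ?thesis using False by simp
    next
      case True
      then obtain j where j: "x \<in> box (a j) (b j)" using cover by blast
      have le: "box_bump (real (Suc n)) (a j) (b j) x \<le> F n x" if "j < n" for n
      proof -
        have "(\<Prod>i<n. 1 - box_bump (real (Suc n)) (a i) (b i) x)
          = (1 - box_bump (real (Suc n)) (a j) (b j) x) * (\<Prod>i\<in>{..<n} - {j}. 1 - box_bump (real (Suc n)) (a i) (b i) x)"
          using that by (intro prod.remove) auto
        also have "\<dots> \<le> (1 - box_bump (real (Suc n)) (a j) (b j) x) * 1"
          by (intro mult_left_mono prod_le_1) (auto simp: box_bump_range)
        finally show ?thesis by (simp add: F_def)
      qed
      have "(\<lambda>n. F n x) \<longlonglongrightarrow> 1"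
        by (rule tendsto_sandwich[OF _ _ box_bump_tendsto_1[OF j] tendsto_const])
          (use le F01 in \<open>auto intro!: eventually_mono[OF eventually_gt_at_top[of j]]\<close>)
      then show ?thesis using True by simp
    qed
  qed
qed

lemma L2_dominated_convergence:
  fixes f :: "nat \<Rightarrow> 'a::euclidean_space \<Rightarrow> real"
  assumes "g \<in> Lp 2 \<Omega>" "\<And>n. f n \<in> borel_measurable (lebesgue_on \<Omega>)" "F \<in> borel_measurable (lebesgue_on \<Omega>)"
    and "\<And>n x. x \<in> \<Omega> \<Longrightarrow> \<bar>f n x\<bar> \<le> \<bar>g x\<bar>" "\<And>x. x \<in> \<Omega> \<Longrightarrow> (\<lambda>n. f n x) \<longlonglongrightarrow> F x"
  shows "(\<lambda>n. Lp_norm 2 \<Omega> (\<lambda>x. f n x - F x)) \<longlonglongrightarrow> 0"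
proof -
  note [measurable] = assms(2,3)
  have F: "\<bar>F x\<bar> \<le> \<bar>g x\<bar>" if "x \<in> \<Omega>" for x
    by (rule tendsto_upperbound[OF tendsto_rabs[OF assms(5)[OF that]]]) (use assms(4) that in auto)
  have "(\<lambda>n. \<integral>x. (f n x - F x)\<^sup>2 \<partial>lebesgue_on \<Omega>) \<longlonglongrightarrow> (\<integral>x. 0 \<partial>lebesgue_on \<Omega>)"
  proof (rule integral_dominated_convergence[where w = "\<lambda>x. 4 * (g x)\<^sup>2"])
    show "integrable (lebesgue_on \<Omega>) (\<lambda>x. 4 * (g x)\<^sup>2)" using assms(1) by (simp add: Lp2_iff)
    show "AE x in lebesgue_on \<Omega>. (\<lambda>n. (f n x - F x)\<^sup>2) \<longlonglongrightarrow> 0"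
    proof (rule AE_I2)
      fix x assume "x \<in> space (lebesgue_on \<Omega>)"
      then have "(\<lambda>n. (f n x - F x)\<^sup>2) \<longlonglongrightarrow> (F x - F x)\<^sup>2" by (intro tendsto_intros assms(5)) auto
      then show "(\<lambda>n. (f n x - F x)\<^sup>2) \<longlonglongrightarrow> 0" by simp
    qed
    show "AE x in lebesgue_on \<Omega>. norm ((f n x - F x)\<^sup>2) \<le> 4 * (g x)\<^sup>2" for n
    proof (rule AE_I2)
      fix x assume "x \<in> space (lebesgue_on \<Omega>)"
      then have "\<bar>f n x - F x\<bar> \<le> 2 * \<bar>g x\<bar>" using assms(4)[of x n] F[of x] by simp
      then have "\<bar>f n x - F x\<bar>\<^sup>2 \<le> (2 * \<bar>g x\<bar>)\<^sup>2" by (intro power_mono) auto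
      then show "norm ((f n x - F x)\<^sup>2) \<le> 4 * (g x)\<^sup>2" by (simp add: power_mult_distrib)
    qed
  qed measurable
  then have "(\<lambda>n. sqrt (\<integral>x. (f n x - F x)\<^sup>2 \<partial>lebesgue_on \<Omega>)) \<longlonglongrightarrow> sqrt 0"
    by (intro tendsto_intros) simp
  then show ?thesis by (simp add: L2_norm_eq L2_inner_def power2_eq_square)
qed

definition test_closure :: "'a::euclidean_space set \<Rightarrow> ('a \<Rightarrow> real) set" where
  "test_closure \<Omega> = {f \<in> Lp 2 \<Omega>. \<forall>e>0. \<exists>\<phi>\<in>test_functions \<Omega>. Lp_norm 2 \<Omega> (\<lambda>x. f x - \<phi> x) < e}"

lemma test_closureD:
  assumes "f \<in> test_closure \<Omega>" "e > 0"
  obtains \<phi> where "\<phi> \<in> test_functions \<Omega>" "Lp_norm 2 \<Omega> (\<lambda>x. f x - \<phi> x) < e"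
  using assms unfolding test_closure_def by blast

lemma test_closure_limit:
  assumes "\<Omega> \<in> sets lebesgue" "bounded \<Omega>" "f \<in> Lp 2 \<Omega>"
    "\<And>n. g n \<in> test_closure \<Omega>" "(\<lambda>n. Lp_norm 2 \<Omega> (\<lambda>x. g n x - f x)) \<longlonglongrightarrow> 0"
  shows "f \<in> test_closure \<Omega>"
  unfolding test_closure_def
proof (safe intro!: assms)
  fix e :: real assume "e > 0"
  then obtain n where n: "Lp_norm 2 \<Omega> (\<lambda>x. g n x - f x) < e / 2"
    using LIMSEQ_D[OF assms(5), of "e/2"] by auto
  obtain \<phi> where \<phi>: "\<phi> \<in> test_functions \<Omega>" "Lp_norm 2 \<Omega> (\<lambda>x. g n x - \<phi> x) < e / 2"
    using test_closureD[OF assms(4), of "e / 2" n] \<open>e > 0\<close> half_gt_zero by blast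
  have "Lp_norm 2 \<Omega> (\<lambda>x. f x - \<phi> x) \<le> Lp_norm 2 \<Omega> (\<lambda>x. f x - g n x) + Lp_norm 2 \<Omega> (\<lambda>x. g n x - \<phi> x)"
    using assms(4)[of n] test_functions_Lp2[OF assms(1,2) \<phi>(1)]
    by (intro L2_norm_triangle3 assms(3)) (auto simp: test_closure_def)
  then show "\<exists>\<phi>\<in>test_functions \<Omega>. Lp_norm 2 \<Omega> (\<lambda>x. f x - \<phi> x) < e"
    using n \<phi> by (intro bexI[of _ \<phi>]) (auto simp: L2_norm_diff_commute)
qed

lemma test_functions_subset_test_closure:
  assumes "\<Omega> \<in> sets lebesgue" "bounded \<Omega>" "\<phi> \<in> test_functions \<Omega>"
  shows "\<phi> \<in> test_closure \<Omega>"
  using test_functions_Lp2[OF assms] assms(3) by (auto simp: test_closure_def intro!: bexI[of _ \<phi>])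

lemma test_closure_add_scale:
  assumes \<Omega>: "\<Omega> \<in> sets lebesgue" "bounded \<Omega>" and f: "f \<in> test_closure \<Omega>" and g: "g \<in> test_closure \<Omega>"
  shows "(\<lambda>x. f x + c * g x) \<in> test_closure \<Omega>"
  unfolding test_closure_def
proof safe
  have fg: "f \<in> Lp 2 \<Omega>" "g \<in> Lp 2 \<Omega>" using f g by (auto simp: test_closure_def)
  then show "(\<lambda>x. f x + c * g x) \<in> Lp 2 \<Omega>" by (intro Lp2_closed)
  fix e :: real assume "e > 0"
  then obtain \<phi> where \<phi>: "\<phi> \<in> test_functions \<Omega>" "Lp_norm 2 \<Omega> (\<lambda>x. f x - \<phi> x) < e / 2"
    using test_closureD[OF f, of "e / 2"] half_gt_zero by blast
  have "e / 2 / (\<bar>c\<bar> + 1) > 0" using \<open>e > 0\<close> by simp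
  then obtain \<psi> where \<psi>: "\<psi> \<in> test_functions \<Omega>" "Lp_norm 2 \<Omega> (\<lambda>x. g x - \<psi> x) < e / 2 / (\<bar>c\<bar> + 1)"
    using test_closureD[OF g] by blast
  have L: "\<phi> \<in> Lp 2 \<Omega>" "\<psi> \<in> Lp 2 \<Omega>" using test_functions_Lp2 \<Omega> \<phi> \<psi> by auto
  have "Lp_norm 2 \<Omega> (\<lambda>x. (f x + c * g x) - (\<phi> x + c * \<psi> x))
      = Lp_norm 2 \<Omega> (\<lambda>x. (f x - \<phi> x) + c * (g x - \<psi> x))" by (simp add: algebra_simps)
  also have "\<dots> \<le> Lp_norm 2 \<Omega> (\<lambda>x. f x - \<phi> x) + Lp_norm 2 \<Omega> (\<lambda>x. c * (g x - \<psi> x))"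
    by (intro L2_norm_triangle Lp2_closed fg L)
  also have "Lp_norm 2 \<Omega> (\<lambda>x. c * (g x - \<psi> x)) = \<bar>c\<bar> * Lp_norm 2 \<Omega> (\<lambda>x. g x - \<psi> x)"
    by (rule L2_norm_scale)
  also have "\<dots> \<le> (\<bar>c\<bar> + 1) * Lp_norm 2 \<Omega> (\<lambda>x. g x - \<psi> x)" by (intro mult_right_mono) auto
  also have "\<dots> \<le> e / 2" using \<psi>(2) by (simp add: pos_less_divide_eq algebra_simps)
  finally have "Lp_norm 2 \<Omega> (\<lambda>x. (f x + c * g x) - (\<phi> x + c * \<psi> x)) < e" using \<phi>(2) by simp
  then show "\<exists>\<phi>\<in>test_functions \<Omega>. Lp_norm 2 \<Omega> (\<lambda>x. f x + c * g x - \<phi> x) < e"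
    by (intro bexI[of _ "\<lambda>x. \<phi> x + c * \<psi> x"]) (auto intro: test_functions_add_scale \<phi> \<psi>)
qed

text \<open>
  For open sets the approximation by bump functions converges in \<open>L\<^sup>2\<close> by dominated convergence;
  outer regularity of Lebesgue measure passes to measurable sets.
\<close>

lemma indicator_in_test_closure:
  assumes \<Omega>: "open \<Omega>" "bounded \<Omega>" and A: "A \<in> sets lebesgue" "A \<subseteq> \<Omega>"
  shows "indicator A \<in> test_closure \<Omega>"
proof -
  have \<Omega>L: "\<Omega> \<in> sets lebesgue" "\<Omega> \<in> lmeasurable"
    using \<Omega> by (auto simp: bounded_set_imp_lmeasurable)
  have ind: "(indicator B :: 'a \<Rightarrow> real) \<in> Lp 2 \<Omega>" if "B \<in> sets lebesgue" for B
  proof -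
    have "(indicator B :: 'a \<Rightarrow> real) \<in> borel_measurable lebesgue" using that by simp
    then show ?thesis
      by (intro Lp2_bounded[of _ _ 1] \<Omega>L) (auto intro: measurable_restrict_space1 simp: indicator_def)
  qed
  have opn: "indicator U \<in> test_closure \<Omega>" if "open U" "U \<subseteq> \<Omega>" for U
  proof -
    obtain F where F: "\<And>n. F n \<in> test_functions U" "\<And>n x. \<bar>F n x\<bar> \<le> indicator U x"
      "\<And>x. (\<lambda>n. F n x) \<longlonglongrightarrow> indicator U x"
      by (rule open_indicator_approx[OF \<open>open U\<close>]) blast
    have F': "F n \<in> test_functions \<Omega>" for n using F(1)[of n] that(2) by (auto simp: test_functions_def)
    have indU: "(indicator U :: 'a \<Rightarrow> real) \<in> Lp 2 \<Omega>" using that by (intro ind) auto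
    show ?thesis
    proof (rule test_closure_limit[OF \<Omega>L(1) \<Omega>(2) indU])
      show "F n \<in> test_closure \<Omega>" for n
        by (rule test_functions_subset_test_closure[OF \<Omega>L(1) \<Omega>(2) F'])
      show "(\<lambda>n. Lp_norm 2 \<Omega> (\<lambda>x. F n x - indicator U x)) \<longlonglongrightarrow> 0"
        by (rule L2_dominated_convergence[OF indU])
          (use F(2,3) indU test_functions_Lp2[OF \<Omega>L(1) \<Omega>(2) F'] in \<open>auto simp: Lp2_iff\<close>)
    qed
  qed
  have "\<exists>U. open U \<and> A \<subseteq> U \<and> U \<subseteq> \<Omega> \<and> measure lebesgue (U - A) < (1 / real (Suc n))\<^sup>2" for n
  proof -
    obtain T where T: "open T" "A \<subseteq> T" "T - A \<in> lmeasurable" "emeasure lebesgue (T - A) < ennreal ((1 / real (Suc n))\<^sup>2)"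
      using sets_lebesgue_outer_open[OF A(1), of "(1 / real (Suc n))\<^sup>2"] by auto
    have "measure lebesgue (T \<inter> \<Omega> - A) \<le> measure lebesgue (T - A)"
      using T(1,3) \<Omega>(1) A(1) by (intro measure_mono_fmeasurable sets.Diff sets.Int) auto
    also have "\<dots> < (1 / real (Suc n))\<^sup>2"
      using T(3,4) by (simp add: emeasure_eq_measure2 ennreal_less_iff)
    finally show ?thesis using T A \<Omega> by (intro exI[of _ "T \<inter> \<Omega>"]) auto
  qed
  then obtain U where U: "\<And>n. open (U n)" "\<And>n. A \<subseteq> U n" "\<And>n. U n \<subseteq> \<Omega>"
    "\<And>n. measure lebesgue (U n - A) < (1 / real (Suc n))\<^sup>2" by metis
  show ?thesis
  proof (rule test_closure_limit[OF \<Omega>L(1) \<Omega>(2) ind[OF A(1)]])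
    show "indicator (U n) \<in> test_closure \<Omega>" for n by (rule opn[OF U(1,3)])
    have eq: "Lp_norm 2 \<Omega> (\<lambda>x. indicator (U n) x - indicator A x :: real) = sqrt (measure lebesgue (U n - A))" for n
    proof -
      have "L2_inner \<Omega> (\<lambda>x. indicator (U n) x - indicator A x) (\<lambda>x. indicator (U n) x - indicator A x :: real)
        = (\<integral>x. indicator (U n - A) x \<partial>lebesgue_on \<Omega>)"
        unfolding L2_inner_def using U(2)[of n]
        by (intro Bochner_Integration.integral_cong) (auto simp: indicator_def)
      also have "\<dots> = measure (lebesgue_on \<Omega>) (U n - A)"
        using U(3)[of n] by (simp add: Int_absorb1 inf.absorb2 Diff_subset_conv le_supI2 Int_commute Diff_Int_distrib2 Int_Diff)
      also have "\<dots> = measure lebesgue (U n - A)"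
        using U(3)[of n] \<Omega>L by (intro measure_restrict_space) auto
      finally show ?thesis by (simp add: L2_norm_eq)
    qed
    show "(\<lambda>n. Lp_norm 2 \<Omega> (\<lambda>x. indicator (U n) x - indicator A x :: real)) \<longlonglongrightarrow> 0"
    proof (rule tendsto_sandwich[OF _ _ tendsto_const])
      show "\<forall>\<^sub>F n in sequentially. Lp_norm 2 \<Omega> (\<lambda>x. indicator (U n) x - indicator A x :: real) \<le> inverse (real (Suc n))"
        unfolding eq using U(4) less_imp_le[OF real_sqrt_less_mono[OF U(4)]]
        by (auto simp: inverse_eq_divide real_sqrt_divide intro!: always_eventually)
    qed (use LIMSEQ_inverse_real_of_nat in auto)
  qed
qed

text \<open>
  Indicator functions span the simple functions, which are dense.
\<close>

proposition test_functions_dense: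
  fixes f :: "'a::euclidean_space \<Rightarrow> real"
  assumes \<Omega>: "open \<Omega>" "bounded \<Omega>" and f: "f \<in> Lp 2 \<Omega>" and "e > 0"
  obtains \<phi> where "\<phi> \<in> test_functions \<Omega>" "Lp_norm 2 \<Omega> (\<lambda>x. f x - \<phi> x) < e"
proof -
  have \<Omega>L: "\<Omega> \<in> sets lebesgue" using \<Omega> by auto
  have simple: "s \<in> test_closure \<Omega>" if "simple_function (lebesgue_on \<Omega>) s" "s \<in> Lp 2 \<Omega>" for s :: "'a \<Rightarrow> real"
  proof -
    let ?S = "\<lambda>Y x. \<Sum>y\<in>Y. y * indicator (s -` {y} \<inter> \<Omega>) x :: real"
    have fin: "finite (s ` \<Omega>)" using simple_functionD(1)[OF that(1)] by simp
    have "?S Y \<in> test_closure \<Omega>" if "finite Y" "Y \<subseteq> s ` \<Omega>" for Y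
      using that
    proof (induction Y rule: finite_induct)
      case empty
      then show ?case using test_functions_subset_test_closure[OF \<Omega>L \<Omega>(2) test_functions_zero] by simp
    next
      case (insert y Y)
      have "s -` {y} \<inter> space (lebesgue_on \<Omega>) \<in> sets (lebesgue_on \<Omega>)"
        by (rule simple_functionD(2)) fact
      then have "s -` {y} \<inter> \<Omega> \<in> sets lebesgue" using \<Omega>L by (simp add: sets_restrict_space_iff)
      then have "(\<lambda>x. ?S Y x + y * indicator (s -` {y} \<inter> \<Omega>) x) \<in> test_closure \<Omega>"
        using insert by (intro test_closure_add_scale \<Omega>L \<Omega> indicator_in_test_closure) auto
      then show ?case by (simp only: sum.insert[OF insert(1,2)] add.commute)
    qed
    from this[OF fin order_refl] have *: "?S (s ` \<Omega>) \<in> test_closure \<Omega>" .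
    have eq: "?S (s ` \<Omega>) x = s x" if "x \<in> \<Omega>" for x
    proof -
      have "?S (s ` \<Omega>) x = (\<Sum>y\<in>s ` \<Omega>. if y = s x then y else 0)"
        using that by (intro sum.cong) (auto simp: indicator_def)
      then show ?thesis using fin that by simp
    qed
    have **: "L2_inner \<Omega> (\<lambda>x. s x - \<phi> x) (\<lambda>x. s x - \<phi> x)
      = L2_inner \<Omega> (\<lambda>x. ?S (s ` \<Omega>) x - \<phi> x) (\<lambda>x. ?S (s ` \<Omega>) x - \<phi> x)" for \<phi>
      unfolding L2_inner_def by (intro Bochner_Integration.integral_cong) (auto simp: eq)
    show ?thesis using * that(2) by (auto simp: test_closure_def L2_norm_eq **)
  qed
  obtain s where s: "\<And>i. simple_function (lebesgue_on \<Omega>) (s i)" "\<And>x. x \<in> \<Omega> \<Longrightarrow> (\<lambda>i. s i x) \<longlonglongrightarrow> f x"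
    "\<And>i x. x \<in> \<Omega> \<Longrightarrow> dist (s i x) 0 \<le> 2 * dist (f x) 0"
    using borel_measurable_implies_sequence_metric[OF Lp2_measurable[OF f], of 0] space_lebesgue_on
    by metis
  have sm: "s i \<in> borel_measurable (lebesgue_on \<Omega>)" for i
    using s(1) by (rule borel_measurable_simple_function)
  have g: "(\<lambda>x. 2 * f x) \<in> Lp 2 \<Omega>" using f by (rule Lp2_scale)
  have sL: "s i \<in> Lp 2 \<Omega>" for i
    by (rule Lp2_dominated[OF g sm]) (use s(3) in \<open>auto simp: abs_mult intro!: AE_I2\<close>)
  have "f \<in> test_closure \<Omega>"
    by (rule test_closure_limit[OF \<Omega>L \<Omega>(2) f simple[OF s(1) sL]], rule L2_dominated_convergence[OF g sm])
      (use f s(2,3) in \<open>auto simp: Lp2_iff abs_mult\<close>)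
  then show thesis using that \<open>e > 0\<close> by (auto simp: test_closure_def)
qed

section \<open>The Sobolev space with zero boundary values\<close>

lemma frechet_derivative_Lp2:
  assumes "open \<Omega>" "bounded \<Omega>" "\<phi> \<in> test_functions \<Omega>" "b \<in> Basis"
  shows "(\<lambda>x. frechet_derivative \<phi> (at x) b) \<in> Lp 2 \<Omega>"
  using test_functions_Lp2(3)[of \<Omega> \<phi> b] assms by auto

lemma Lp2_inner_Basis:
  assumes "g \<in> Lp 2 \<Omega>" "b \<in> Basis"
  shows "(\<lambda>x. g x \<bullet> b) \<in> Lp 2 \<Omega>"
  using assms(1)
proof (rule Lp2_dominated)
  have [measurable]: "g \<in> borel_measurable (lebesgue_on \<Omega>)" by (rule Lp2_measurable) fact
  show "(\<lambda>x. g x \<bullet> b) \<in> borel_measurable (lebesgue_on \<Omega>)" by measurable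
qed (use Basis_le_norm[OF assms(2)] in auto)

text \<open>
  The fundamental lemma of the calculus of variations is a consequence of density: a function
  orthogonal to all test functions is orthogonal to itself.
\<close>

lemma orthogonal_test_functions_AE_0:
  fixes k :: "'a::euclidean_space \<Rightarrow> real"
  assumes \<Omega>: "open \<Omega>" "bounded \<Omega>" and k: "k \<in> Lp 2 \<Omega>"
    and orth: "\<And>\<phi>. \<phi> \<in> test_functions \<Omega> \<Longrightarrow> L2_inner \<Omega> k \<phi> = 0"
  shows "AE x in lebesgue_on \<Omega>. k x = 0"
proof -
  have \<Omega>L: "\<Omega> \<in> sets lebesgue" using \<Omega> by auto
  have "(Lp_norm 2 \<Omega> k)\<^sup>2 \<le> Lp_norm 2 \<Omega> k * e" if "e > 0" for e
  proof -
    obtain \<phi> where \<phi>: "\<phi> \<in> test_functions \<Omega>" "Lp_norm 2 \<Omega> (\<lambda>x. k x - \<phi> x) < e"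
      by (rule test_functions_dense[OF \<Omega> k \<open>e > 0\<close>])
    have \<phi>L: "\<phi> \<in> Lp 2 \<Omega>" by (rule test_functions_Lp2[OF \<Omega>L \<Omega>(2) \<phi>(1)])
    have "(Lp_norm 2 \<Omega> k)\<^sup>2 = L2_inner \<Omega> k (\<lambda>x. k x - \<phi> x)"
      using orth[OF \<phi>(1)] by (simp add: L2_norm_sq L2_inner_linear k \<phi>L)
    also have "\<dots> \<le> Lp_norm 2 \<Omega> k * Lp_norm 2 \<Omega> (\<lambda>x. k x - \<phi> x)"
      by (intro L2_inner_le Lp2_closed k \<phi>L)
    also have "\<dots> \<le> Lp_norm 2 \<Omega> k * e" using \<phi>(2) by (intro mult_left_mono) auto
    finally show ?thesis .
  qed
  then have "Lp_norm 2 \<Omega> k \<le> e" if "e > 0" for e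
    using that L2_norm_nonneg[of \<Omega> k]
    by (cases "Lp_norm 2 \<Omega> k = 0") (auto simp: power2_eq_square mult_le_cancel_left)
  then have "Lp_norm 2 \<Omega> k = 0"
    using L2_norm_nonneg[of \<Omega> k] by (meson dense_le_bounded field_le_epsilon antisym field_lbound_gt_zero leD leI)
  then show ?thesis by (rule L2_norm_eq_0_AE[OF k])
qed

lemma weak_gradient_iff:
  assumes "open \<Omega>" "bounded \<Omega>" "f \<in> Lp 2 \<Omega>" "g \<in> Lp 2 \<Omega>"
  shows "has_weak_gradient \<Omega> f g \<longleftrightarrow> (\<forall>\<phi>\<in>test_functions \<Omega>. \<forall>b\<in>Basis.
    L2_inner \<Omega> f (\<lambda>x. frechet_derivative \<phi> (at x) b) = - L2_inner \<Omega> (\<lambda>x. g x \<bullet> b) \<phi>)"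
  by (simp add: has_weak_gradient_def L2_inner_def)

lemma weak_gradient_unique:
  assumes \<Omega>: "open \<Omega>" "bounded \<Omega>" and f: "f \<in> Lp 2 \<Omega>" and g: "g \<in> Lp 2 \<Omega>" "h \<in> Lp 2 \<Omega>"
    and "has_weak_gradient \<Omega> f g" "has_weak_gradient \<Omega> f h"
  shows "AE x in lebesgue_on \<Omega>. g x = h x"
proof -
  have \<Omega>L: "\<Omega> \<in> sets lebesgue" using \<Omega> by auto
  have "AE x in lebesgue_on \<Omega>. g x \<bullet> b - h x \<bullet> b = 0" if b: "b \<in> Basis" for b
  proof (rule orthogonal_test_functions_AE_0[OF \<Omega>])
    show "(\<lambda>x. g x \<bullet> b - h x \<bullet> b) \<in> Lp 2 \<Omega>" by (intro Lp2_closed Lp2_inner_Basis g b)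
    fix \<phi> assume \<phi>: "\<phi> \<in> test_functions \<Omega>"
    have "L2_inner \<Omega> (\<lambda>x. g x \<bullet> b) \<phi> = L2_inner \<Omega> (\<lambda>x. h x \<bullet> b) \<phi>"
      using assms \<phi> b by (simp add: weak_gradient_iff)
    then show "L2_inner \<Omega> (\<lambda>x. g x \<bullet> b - h x \<bullet> b) \<phi> = 0"
      using test_functions_Lp2(1)[OF \<Omega>L \<Omega>(2) \<phi>] by (simp add: L2_inner_diff_left Lp2_inner_Basis g b)
  qed
  then have "AE x in lebesgue_on \<Omega>. \<forall>b\<in>Basis. g x \<bullet> b - h x \<bullet> b = 0"
    by (subst AE_ball_countable) (auto intro: countable_finite)
  then show ?thesis by eventually_elim (auto intro: euclidean_eqI)
qed

locale bounded_open =
  fixes \<Omega> :: "'a::euclidean_space set"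
  assumes open_dom: "open \<Omega>" and bounded_dom: "bounded \<Omega>"
begin

lemma lebesgue_dom: "\<Omega> \<in> sets lebesgue"
  using open_dom by auto

lemma lmeasurable_dom: "\<Omega> \<in> lmeasurable"
  using bounded_dom lebesgue_dom by (rule bounded_set_imp_lmeasurable)

abbreviation inn where "inn \<equiv> L2_inner \<Omega>"
abbreviation nrm where "nrm \<equiv> Lp_norm 2 \<Omega>"
abbreviation gnrm where "gnrm f \<equiv> nrm (weak_grad \<Omega> f)"

lemma H1_D:
  assumes "f \<in> H1 \<Omega>"
  shows "f \<in> Lp 2 \<Omega>" "weak_grad \<Omega> f \<in> Lp 2 \<Omega>" "has_weak_gradient \<Omega> f (weak_grad \<Omega> f)"
proof -
  show "f \<in> Lp 2 \<Omega>" using assms by (simp add: H1_def)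
  have "\<exists>g. g \<in> Lp 2 \<Omega> \<and> has_weak_gradient \<Omega> f g" using assms by (auto simp: H1_def)
  then have "weak_grad \<Omega> f \<in> Lp 2 \<Omega> \<and> has_weak_gradient \<Omega> f (weak_grad \<Omega> f)"
    unfolding weak_grad_def by (rule someI_ex)
  then show "weak_grad \<Omega> f \<in> Lp 2 \<Omega>" "has_weak_gradient \<Omega> f (weak_grad \<Omega> f)" by auto
qed

lemma H1_I:
  assumes "f \<in> Lp 2 \<Omega>" "g \<in> Lp 2 \<Omega>" "has_weak_gradient \<Omega> f g"
  shows "f \<in> H1 \<Omega>" "AE x in lebesgue_on \<Omega>. weak_grad \<Omega> f x = g x"
proof -
  show f: "f \<in> H1 \<Omega>" using assms by (auto simp: H1_def)
  show "AE x in lebesgue_on \<Omega>. weak_grad \<Omega> f x = g x"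
    by (rule weak_gradient_unique[OF open_dom bounded_dom assms(1) H1_D(2)[OF f] assms(2) H1_D(3)[OF f] assms(3)])
qed

lemma has_weak_gradient_add_scale:
  assumes f: "f \<in> Lp 2 \<Omega>" "f' \<in> Lp 2 \<Omega>" "has_weak_gradient \<Omega> f f'"
    and g: "g \<in> Lp 2 \<Omega>" "g' \<in> Lp 2 \<Omega>" "has_weak_gradient \<Omega> g g'"
  shows "has_weak_gradient \<Omega> (\<lambda>x. f x + c * g x) (\<lambda>x. f' x + c *\<^sub>R g' x)"
proof (subst weak_gradient_iff[OF open_dom bounded_dom]; (intro Lp2_closed f g)?; (intro ballI)?)
  fix \<phi> and b :: 'a assume \<phi>: "\<phi> \<in> test_functions \<Omega>" and b: "b \<in> Basis"
  note L = test_functions_Lp2(1)[OF lebesgue_dom bounded_dom \<phi>]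
    frechet_derivative_Lp2[OF open_dom bounded_dom \<phi> b]
  have "inn (\<lambda>x. f x + c * g x) (\<lambda>x. frechet_derivative \<phi> (at x) b)
      = inn f (\<lambda>x. frechet_derivative \<phi> (at x) b) + c * inn g (\<lambda>x. frechet_derivative \<phi> (at x) b)"
    by (simp add: L2_inner_linear f g L Lp2_closed)
  also have "\<dots> = - (inn (\<lambda>x. f' x \<bullet> b) \<phi> + c * inn (\<lambda>x. g' x \<bullet> b) \<phi>)"
    using f g \<phi> b by (simp add: weak_gradient_iff[OF open_dom bounded_dom])
  also have "inn (\<lambda>x. f' x \<bullet> b) \<phi> + c * inn (\<lambda>x. g' x \<bullet> b) \<phi> = inn (\<lambda>x. f' x \<bullet> b + c * (g' x \<bullet> b)) \<phi>"
    by (simp add: L2_inner_linear f g L b Lp2_closed Lp2_inner_Basis)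
  finally show "inn (\<lambda>x. f x + c * g x) (\<lambda>x. frechet_derivative \<phi> (at x) b)
      = - inn (\<lambda>x. (f' x + c *\<^sub>R g' x) \<bullet> b) \<phi>"
    by (simp add: inner_add_left)
qed

lemma H1_add_scale:
  assumes "f \<in> H1 \<Omega>" "g \<in> H1 \<Omega>"
  shows "(\<lambda>x. f x + c * g x) \<in> H1 \<Omega>"
    "AE x in lebesgue_on \<Omega>. weak_grad \<Omega> (\<lambda>x. f x + c * g x) x = weak_grad \<Omega> f x + c *\<^sub>R weak_grad \<Omega> g x"
proof -
  note f = H1_D[OF assms(1)] and g = H1_D[OF assms(2)]
  note * = H1_I[OF _ _ has_weak_gradient_add_scale[OF f g, of c]]
  show "(\<lambda>x. f x + c * g x) \<in> H1 \<Omega>"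
    "AE x in lebesgue_on \<Omega>. weak_grad \<Omega> (\<lambda>x. f x + c * g x) x = weak_grad \<Omega> f x + c *\<^sub>R weak_grad \<Omega> g x"
    by (rule *; intro Lp2_closed f g)+
qed

definition energy :: "('a \<Rightarrow> real) \<Rightarrow> ('a \<Rightarrow> real) \<Rightarrow> real" where
  "energy f g = inn (weak_grad \<Omega> f) (weak_grad \<Omega> g)"

lemma energy_commute: "energy f g = energy g f"
  by (simp add: energy_def L2_inner_commute)

lemma energy_add_scale_left:
  assumes "f \<in> H1 \<Omega>" "g \<in> H1 \<Omega>" "h \<in> H1 \<Omega>"
  shows "energy (\<lambda>x. f x + c * g x) h = energy f h + c * energy g h"
proof -
  note * = H1_add_scale[OF assms(1,2), of c]
  have "energy (\<lambda>x. f x + c * g x) h = inn (\<lambda>x. weak_grad \<Omega> f x + c *\<^sub>R weak_grad \<Omega> g x) (weak_grad \<Omega> h)"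
    unfolding energy_def by (intro L2_inner_cong_AE H1_D Lp2_closed assms *) auto
  then show ?thesis by (simp add: energy_def L2_inner_linear Lp2_closed H1_D assms)
qed

lemma energy_add_scale_right:
  assumes "f \<in> H1 \<Omega>" "g \<in> H1 \<Omega>" "h \<in> H1 \<Omega>"
  shows "energy h (\<lambda>x. f x + c * g x) = energy h f + c * energy h g"
  using energy_add_scale_left[OF assms] by (simp add: energy_commute)

lemma energy_self: "energy f f = (gnrm f)\<^sup>2"
  by (simp add: energy_def L2_norm_sq)

lemma energy_le:
  assumes "f \<in> H1 \<Omega>" "g \<in> H1 \<Omega>"
  shows "\<bar>energy f g\<bar> \<le> gnrm f * gnrm g"
  unfolding energy_def by (intro L2_Cauchy_Schwarz H1_D assms)

lemma test_functions_H1: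
  assumes "\<phi> \<in> test_functions \<Omega>"
  shows "\<phi> \<in> H1 \<Omega>" "AE x in lebesgue_on \<Omega>. weak_grad \<Omega> \<phi> x = classical_gradient \<phi> x"
  using H1_I[OF test_functions_Lp2(1,2)[OF lebesgue_dom bounded_dom assms]
    test_functions_weak_gradient[OF lebesgue_dom bounded_dom assms]] by auto

lemma H1_norm_bounds:
  "nrm f \<le> H1_norm \<Omega> f" "gnrm f \<le> H1_norm \<Omega> f"
  "H1_norm \<Omega> f \<le> nrm f + gnrm f"
  unfolding H1_norm_def by (simp_all add: real_le_rsqrt sqrt_sum_squares_le_sum)

lemma H1_norm_nonneg [simp]: "0 \<le> H1_norm \<Omega> f"
  by (simp add: H1_norm_def)

lemma H1_diff:
  assumes "f \<in> H1 \<Omega>" "g \<in> H1 \<Omega>"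
  shows "(\<lambda>x. f x - g x) \<in> H1 \<Omega>"
  using H1_add_scale(1)[OF assms, of "-1"] by simp

lemma nrm_grad_add_scale:
  assumes "f \<in> H1 \<Omega>" "g \<in> H1 \<Omega>"
  shows "gnrm (\<lambda>x. f x + c * g x) \<le> gnrm f + \<bar>c\<bar> * gnrm g"
proof -
  note * = H1_add_scale[OF assms, of c]
  have "gnrm (\<lambda>x. f x + c * g x) = nrm (\<lambda>x. weak_grad \<Omega> f x + c *\<^sub>R weak_grad \<Omega> g x)"
    by (intro L2_norm_cong_AE H1_D Lp2_closed assms *)
  also have "\<dots> \<le> gnrm f + nrm (\<lambda>x. c *\<^sub>R weak_grad \<Omega> g x)"
    by (intro L2_norm_triangle H1_D Lp2_closed assms)
  finally show ?thesis by (simp add: L2_norm_scaleR)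
qed

lemma H1_norm_add_scale:
  assumes "f \<in> H1 \<Omega>" "g \<in> H1 \<Omega>"
  shows "H1_norm \<Omega> (\<lambda>x. f x + c * g x) \<le> 2 * H1_norm \<Omega> f + 2 * \<bar>c\<bar> * H1_norm \<Omega> g"
proof -
  have "H1_norm \<Omega> (\<lambda>x. f x + c * g x) \<le> nrm (\<lambda>x. f x + c * g x) + gnrm (\<lambda>x. f x + c * g x)"
    by (rule H1_norm_bounds)
  also have "\<dots> \<le> (nrm f + \<bar>c\<bar> * nrm g) + (gnrm f + \<bar>c\<bar> * gnrm g)"
    using L2_norm_triangle[OF H1_D(1)[OF assms(1)] Lp2_scale[OF H1_D(1)[OF assms(2)], of c]]
    by (intro add_mono nrm_grad_add_scale assms) (simp add: L2_norm_scale)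
  also have "\<dots> \<le> (H1_norm \<Omega> f + \<bar>c\<bar> * H1_norm \<Omega> g) + (H1_norm \<Omega> f + \<bar>c\<bar> * H1_norm \<Omega> g)"
    by (intro add_mono mult_left_mono H1_norm_bounds) auto
  finally show ?thesis by simp
qed

lemma gnrm_scale:
  assumes f: "f \<in> H1 \<Omega>"
  shows "gnrm (\<lambda>x. c * f x) = \<bar>c\<bar> * gnrm f"
proof -
  have 0: "has_weak_gradient \<Omega> (\<lambda>x. 0) (\<lambda>x. 0)" by (simp add: has_weak_gradient_def)
  have "has_weak_gradient \<Omega> (\<lambda>x. c * f x) (\<lambda>x. c *\<^sub>R weak_grad \<Omega> f x)"
    using has_weak_gradient_add_scale[OF Lp2_zero Lp2_zero 0 H1_D[OF f], of c] by simp
  note * = H1_I[OF Lp2_scale[OF H1_D(1)[OF f]] Lp2_scaleR[OF H1_D(2)[OF f]] this]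
  have "gnrm (\<lambda>x. c * f x) = nrm (\<lambda>x. c *\<^sub>R weak_grad \<Omega> f x)"
    by (rule L2_norm_cong_AE[OF H1_D(2)[OF *(1)] Lp2_scaleR[OF H1_D(2)[OF f]] *(2)])
  then show ?thesis by (simp add: L2_norm_scaleR)
qed

lemma H10_H1: "f \<in> H10 \<Omega> \<Longrightarrow> f \<in> H1 \<Omega>"
  by (simp add: H10_def)

lemmas H10_D = H1_D[OF H10_H1]

text \<open>
  A form of the definition without sequences, better suited for nested approximations.
\<close>

lemma H10_iff:
  "f \<in> H10 \<Omega> \<longleftrightarrow> f \<in> H1 \<Omega> \<and>
     (\<forall>e>0. \<exists>\<phi>\<in>test_functions \<Omega>. H1_norm \<Omega> (\<lambda>x. \<phi> x - f x) < e)"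
proof (intro iffI conjI allI impI)
  fix e :: real assume "f \<in> H10 \<Omega>" "e > 0"
  then obtain \<phi> where \<phi>: "\<And>n. \<phi> n \<in> test_functions \<Omega>"
    "(\<lambda>n. H1_norm \<Omega> (\<lambda>x. \<phi> n x - f x)) \<longlonglongrightarrow> 0" by (auto simp: H10_def)
  obtain n where "\<bar>H1_norm \<Omega> (\<lambda>x. \<phi> n x - f x)\<bar> < e"
    using LIMSEQ_D[OF \<phi>(2) \<open>e > 0\<close>] by auto
  then show "\<exists>\<phi>\<in>test_functions \<Omega>. H1_norm \<Omega> (\<lambda>x. \<phi> x - f x) < e"
    using \<phi>(1)[of n] by (intro bexI[of _ "\<phi> n"]) auto
next
  assume *: "f \<in> H1 \<Omega> \<and> (\<forall>e>0. \<exists>\<phi>\<in>test_functions \<Omega>. H1_norm \<Omega> (\<lambda>x. \<phi> x - f x) < e)"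
  then have "\<exists>\<phi>\<in>test_functions \<Omega>. H1_norm \<Omega> (\<lambda>x. \<phi> x - f x) < inverse (real (Suc n))" for n
    by simp
  then obtain \<phi> where \<phi>: "\<And>n. \<phi> n \<in> test_functions \<Omega>"
    "\<And>n. H1_norm \<Omega> (\<lambda>x. \<phi> n x - f x) < inverse (real (Suc n))" by metis
  have "(\<lambda>n. H1_norm \<Omega> (\<lambda>x. \<phi> n x - f x)) \<longlonglongrightarrow> 0"
    by (rule tendsto_sandwich[OF _ _ tendsto_const LIMSEQ_inverse_real_of_nat])
      (auto intro!: always_eventually less_imp_le[OF \<phi>(2)] simp del: of_nat_Suc)
  then show "f \<in> H10 \<Omega>" using * \<phi>(1) by (auto simp: H10_def)
qed (auto simp: H10_def)

lemma H10_limit: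
  assumes "f \<in> H1 \<Omega>" "\<And>e. e > 0 \<Longrightarrow> \<exists>g\<in>H10 \<Omega>. H1_norm \<Omega> (\<lambda>x. g x - f x) < e"
  shows "f \<in> H10 \<Omega>"
  unfolding H10_iff
proof (intro conjI allI impI)
  fix e :: real assume "e > 0"
  then obtain g where g: "g \<in> H10 \<Omega>" "H1_norm \<Omega> (\<lambda>x. g x - f x) < e / 4"
    using assms(2)[of "e / 4"] by auto
  have "e / 4 > 0" using \<open>e > 0\<close> by simp
  then obtain \<phi> where \<phi>: "\<phi> \<in> test_functions \<Omega>" "H1_norm \<Omega> (\<lambda>x. \<phi> x - g x) < e / 4"
    using g(1) unfolding H10_iff by blast
  have "H1_norm \<Omega> (\<lambda>x. (\<phi> x - g x) + 1 * (g x - f x)) \<le> 2 * H1_norm \<Omega> (\<lambda>x. \<phi> x - g x) + 2 * \<bar>1\<bar> * H1_norm \<Omega> (\<lambda>x. g x - f x)"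
    by (intro H1_norm_add_scale H1_diff H10_H1 g assms test_functions_H1 \<phi>)
  also have "\<dots> < e" using g \<phi> by simp
  finally show "\<exists>\<phi>\<in>test_functions \<Omega>. H1_norm \<Omega> (\<lambda>x. \<phi> x - f x) < e"
    using \<phi>(1) by auto
qed fact

lemma H1_norm_zero: "H1_norm \<Omega> (\<lambda>x. 0) = 0"
  using gnrm_scale[OF test_functions_H1(1)[OF test_functions_zero], of 0] by (simp add: H1_norm_def)

lemma test_functions_H10: "\<phi> \<in> test_functions \<Omega> \<Longrightarrow> \<phi> \<in> H10 \<Omega>"
  unfolding H10_iff using H1_norm_zero by (auto intro!: test_functions_H1 bexI[of _ \<phi>])

lemma H10_add_scale:
  assumes "f \<in> H10 \<Omega>" "g \<in> H10 \<Omega>"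
  shows "(\<lambda>x. f x + c * g x) \<in> H10 \<Omega>"
  unfolding H10_iff
proof (intro conjI allI impI)
  show "(\<lambda>x. f x + c * g x) \<in> H1 \<Omega>" by (intro H1_add_scale H10_H1 assms)
  fix e :: real assume "e > 0"
  then have "e / 4 > 0" "e / 4 / (\<bar>c\<bar> + 1) > 0" by simp_all
  then obtain \<phi> \<psi> where \<phi>: "\<phi> \<in> test_functions \<Omega>" "H1_norm \<Omega> (\<lambda>x. \<phi> x - f x) < e / 4"
    and \<psi>: "\<psi> \<in> test_functions \<Omega>" "H1_norm \<Omega> (\<lambda>x. \<psi> x - g x) < e / 4 / (\<bar>c\<bar> + 1)"
    using assms unfolding H10_iff by blast
  have "0 \<le> H1_norm \<Omega> (\<lambda>x. \<psi> x - g x)" by simp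
  have "H1_norm \<Omega> (\<lambda>x. (\<phi> x - f x) + c * (\<psi> x - g x))
      \<le> 2 * H1_norm \<Omega> (\<lambda>x. \<phi> x - f x) + 2 * \<bar>c\<bar> * H1_norm \<Omega> (\<lambda>x. \<psi> x - g x)"
    by (intro H1_norm_add_scale H1_diff H10_H1 assms test_functions_H1 \<phi> \<psi>)
  also have "\<dots> \<le> 2 * H1_norm \<Omega> (\<lambda>x. \<phi> x - f x) + 2 * ((\<bar>c\<bar> + 1) * H1_norm \<Omega> (\<lambda>x. \<psi> x - g x))"
    using \<open>0 \<le> _\<close> by (simp add: algebra_simps)
  also have "(\<bar>c\<bar> + 1) * H1_norm \<Omega> (\<lambda>x. \<psi> x - g x) < e / 4"
    using \<psi>(2) by (simp add: pos_less_divide_eq algebra_simps)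
  finally have "H1_norm \<Omega> (\<lambda>x. (\<phi> x - f x) + c * (\<psi> x - g x)) < e" using \<phi>(2) by simp
  moreover have "(\<lambda>x. (\<phi> x - f x) + c * (\<psi> x - g x)) = (\<lambda>x. (\<phi> x + c * \<psi> x) - (f x + c * g x))"
    by (simp add: algebra_simps)
  ultimately show "\<exists>\<phi>\<in>test_functions \<Omega>. H1_norm \<Omega> (\<lambda>x. \<phi> x - (f x + c * g x)) < e"
    by (intro bexI[of _ "\<lambda>x. \<phi> x + c * \<psi> x"] test_functions_add_scale \<phi> \<psi>) simp
qed

lemma H10_zero [simp]: "(\<lambda>x. 0) \<in> H10 \<Omega>"
  by (intro test_functions_H10) simp

lemma H10_scale: "f \<in> H10 \<Omega> \<Longrightarrow> (\<lambda>x. c * f x) \<in> H10 \<Omega>"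
  using H10_add_scale[of "\<lambda>x. 0" f c] by simp

lemma H10_add: "f \<in> H10 \<Omega> \<Longrightarrow> g \<in> H10 \<Omega> \<Longrightarrow> (\<lambda>x. f x + g x) \<in> H10 \<Omega>"
  using H10_add_scale[of f g 1] by simp

lemma H10_diff: "f \<in> H10 \<Omega> \<Longrightarrow> g \<in> H10 \<Omega> \<Longrightarrow> (\<lambda>x. f x - g x) \<in> H10 \<Omega>"
  using H10_add_scale[of f g "-1"] by simp

text \<open>
  The inequality extends from test functions by approximation in the norm of \<open>H1\<close>.
\<close>

proposition Poincare:
  obtains C where "C > 0" "\<And>f. f \<in> H10 \<Omega> \<Longrightarrow> nrm f \<le> C * gnrm f"
proof -
  obtain R where R: "R > 0" "\<And>x. x \<in> \<Omega> \<Longrightarrow> norm x \<le> R"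
    using bounded_dom by (auto simp: bounded_pos)
  have "nrm f \<le> 2 * R * gnrm f" if f: "f \<in> H10 \<Omega>" for f
  proof (rule field_le_epsilon)
    fix e :: real assume "e > 0"
    then have "e / (1 + 2 * R) > 0" using R by simp
    then obtain \<phi> where \<phi>: "\<phi> \<in> test_functions \<Omega>" "H1_norm \<Omega> (\<lambda>x. \<phi> x - f x) < e / (1 + 2 * R)"
      using f unfolding H10_iff by blast
    let ?h = "\<lambda>x. \<phi> x - f x"
    note \<phi>1 = test_functions_H1[OF \<phi>(1)] and f1 = H10_H1[OF f]
    have h1: "?h \<in> H1 \<Omega>" by (intro H1_diff \<phi>1 f1)
    have "nrm f \<le> nrm \<phi> + nrm ?h"
      using L2_norm_triangle_diff[OF H1_D(1)[OF \<phi>1(1)] H1_D(1)[OF h1]] by simp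
    also have "nrm \<phi> \<le> 2 * R * nrm (classical_gradient \<phi>)"
      by (rule Poincare_test_functions[OF lebesgue_dom R(2) \<phi>(1)]) (use R in auto)
    also have "nrm (classical_gradient \<phi>) = gnrm \<phi>"
      by (rule L2_norm_cong_AE[symmetric])
        (intro H1_D \<phi>1 test_functions_Lp2[OF lebesgue_dom bounded_dom \<phi>(1)])+
    also have "gnrm \<phi> \<le> gnrm f + gnrm ?h"
      using nrm_grad_add_scale[OF f1 h1, of 1] by simp
    finally have "nrm f \<le> 2 * R * (gnrm f + gnrm ?h) + nrm ?h"
      using R by simp
    also have "\<dots> \<le> 2 * R * (gnrm f + H1_norm \<Omega> ?h) + H1_norm \<Omega> ?h"
      using R by (intro add_mono mult_left_mono H1_norm_bounds order_refl) auto
    also have "\<dots> = 2 * R * gnrm f + (1 + 2 * R) * H1_norm \<Omega> ?h"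
      by (simp add: algebra_simps)
    also have "(1 + 2 * R) * H1_norm \<Omega> ?h \<le> e"
      using \<phi>(2) R by (simp add: pos_less_divide_eq algebra_simps)
    finally show "nrm f \<le> 2 * R * gnrm f + e" by simp
  qed
  then show thesis using that[of "2 * R"] R by simp
qed

lemma weak_gradient_limit:
  assumes f: "\<And>n. f n \<in> H1 \<Omega>" and F: "F \<in> Lp 2 \<Omega>" "G \<in> Lp 2 \<Omega>"
    and lim: "(\<lambda>n. nrm (\<lambda>x. f n x - F x)) \<longlonglongrightarrow> 0" "(\<lambda>n. nrm (\<lambda>x. weak_grad \<Omega> (f n) x - G x)) \<longlonglongrightarrow> 0"
  shows "has_weak_gradient \<Omega> F G"
proof (subst weak_gradient_iff[OF open_dom bounded_dom F]; intro ballI)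
  fix \<phi> and b :: 'a assume \<phi>: "\<phi> \<in> test_functions \<Omega>" and b: "b \<in> Basis"
  note L = test_functions_Lp2(1)[OF lebesgue_dom bounded_dom \<phi>]
    frechet_derivative_Lp2[OF open_dom bounded_dom \<phi> b]
  let ?d = "\<lambda>x. frechet_derivative \<phi> (at x) b"
  note f' = H1_D[OF f]
  have bound: "\<bar>inn F ?d + inn (\<lambda>x. G x \<bullet> b) \<phi>\<bar>
      \<le> nrm (\<lambda>x. f n x - F x) * nrm ?d + nrm (\<lambda>x. weak_grad \<Omega> (f n) x - G x) * nrm \<phi>" for n
  proof -
    have "inn (f n) ?d = - inn (\<lambda>x. weak_grad \<Omega> (f n) x \<bullet> b) \<phi>"
      using f'[of n] \<phi> b by (simp add: weak_gradient_iff[OF open_dom bounded_dom])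
    then have "inn F ?d + inn (\<lambda>x. G x \<bullet> b) \<phi>
      = - (inn (\<lambda>x. f n x - F x) ?d + inn (\<lambda>x. (weak_grad \<Omega> (f n) x - G x) \<bullet> b) \<phi>)"
      by (simp add: L2_inner_linear inner_diff_left f' F L Lp2_inner_Basis b)
    moreover have "\<bar>inn (\<lambda>x. f n x - F x) ?d\<bar> \<le> nrm (\<lambda>x. f n x - F x) * nrm ?d"
      by (intro L2_Cauchy_Schwarz Lp2_closed f' F L)
    moreover have "\<bar>inn (\<lambda>x. (weak_grad \<Omega> (f n) x - G x) \<bullet> b) \<phi>\<bar>
      \<le> nrm (\<lambda>x. (weak_grad \<Omega> (f n) x - G x) \<bullet> b) * nrm \<phi>"
      by (intro L2_Cauchy_Schwarz Lp2_inner_Basis Lp2_closed f' F L b)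
    moreover have "nrm (\<lambda>x. (weak_grad \<Omega> (f n) x - G x) \<bullet> b) * nrm \<phi>
      \<le> nrm (\<lambda>x. weak_grad \<Omega> (f n) x - G x) * nrm \<phi>"
      by (intro mult_right_mono L2_norm_mono Lp2_inner_Basis Lp2_closed f' F b)
        (auto simp: Basis_le_norm[OF b])
    ultimately show ?thesis by linarith
  qed
  have "(\<lambda>n. nrm (\<lambda>x. f n x - F x) * nrm ?d + nrm (\<lambda>x. weak_grad \<Omega> (f n) x - G x) * nrm \<phi>)
      \<longlonglongrightarrow> 0 * nrm ?d + 0 * nrm \<phi>"
    by (intro tendsto_intros lim)
  then have "\<bar>inn F ?d + inn (\<lambda>x. G x \<bullet> b) \<phi>\<bar> \<le> 0"
    using bound by (intro LIMSEQ_le_const) auto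
  then show "inn F ?d = - inn (\<lambda>x. G x \<bullet> b) \<phi>" by simp
qed

text \<open>Because of the Poincare inequality the gradient alone controls convergence.\<close>

proposition H10_complete:
  assumes f: "\<And>n. f n \<in> H10 \<Omega>"
    and Cauchy: "\<And>e. e > 0 \<Longrightarrow> \<exists>N. \<forall>m\<ge>N. \<forall>n\<ge>N. gnrm (\<lambda>x. f m x - f n x) < e"
  obtains F where "F \<in> H10 \<Omega>" "(\<lambda>n. gnrm (\<lambda>x. f n x - F x)) \<longlonglongrightarrow> 0"
proof -
  obtain C where C: "C > 0" "\<And>f. f \<in> H10 \<Omega> \<Longrightarrow> nrm f \<le> C * gnrm f"
    using Poincare by blast
  note f1 = H10_H1[OF f] and f' = H10_D[OF f]
  have grad_diff: "gnrm (\<lambda>x. g x - h x) = nrm (\<lambda>x. weak_grad \<Omega> g x - weak_grad \<Omega> h x)"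
    if "g \<in> H1 \<Omega>" "h \<in> H1 \<Omega>" for g h
    using H1_add_scale[OF that, of "-1"] that
    by (intro L2_norm_cong_AE H1_D Lp2_closed H1_diff) auto
  obtain F where F: "F \<in> Lp 2 \<Omega>" "(\<lambda>n. nrm (\<lambda>x. f n x - F x)) \<longlonglongrightarrow> 0"
  proof (rule L2_complete[OF f'(1)])
    fix e :: real assume "e > 0"
    then have "e / C > 0" using C by simp
    then obtain N where N: "\<And>m n. m \<ge> N \<Longrightarrow> n \<ge> N \<Longrightarrow> gnrm (\<lambda>x. f m x - f n x) < e / C"
      using Cauchy by blast
    have "nrm (\<lambda>x. f m x - f n x) < e" if "m \<ge> N" "n \<ge> N" for m n
      using C(2)[OF H10_diff[OF f f], of m n] N[OF that] C(1) by (simp add: pos_less_divide_eq algebra_simps)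
    then show "\<exists>N. \<forall>m\<ge>N. \<forall>n\<ge>N. nrm (\<lambda>x. f m x - f n x) < e" by blast
  qed
  obtain G where G: "G \<in> Lp 2 \<Omega>" "(\<lambda>n. nrm (\<lambda>x. weak_grad \<Omega> (f n) x - G x)) \<longlonglongrightarrow> 0"
    by (rule L2_complete[OF f'(2)]) (use Cauchy in \<open>simp_all add: grad_diff f1\<close>)
  have wg: "has_weak_gradient \<Omega> F G" by (rule weak_gradient_limit[OF f1 F(1) G(1) F(2) G(2)])
  note F1 = H1_I[OF F(1) G(1) wg]
  have eq: "gnrm (\<lambda>x. f n x - F x) = nrm (\<lambda>x. weak_grad \<Omega> (f n) x - G x)" for n
    unfolding grad_diff[OF f1 F1(1)]
    using F1(2) by (intro L2_norm_cong_AE Lp2_diff f' G(1) H1_D(2)[OF F1(1)]) auto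
  have lim: "(\<lambda>n. gnrm (\<lambda>x. f n x - F x)) \<longlonglongrightarrow> 0" using G(2) by (simp add: eq)
  have "F \<in> H10 \<Omega>"
  proof (rule H10_limit[OF F1(1)])
    fix e :: real assume "e > 0"
    have "(\<lambda>n. nrm (\<lambda>x. f n x - F x) + gnrm (\<lambda>x. f n x - F x)) \<longlonglongrightarrow> 0 + 0"
      by (intro tendsto_add F(2) lim)
    then obtain n where "nrm (\<lambda>x. f n x - F x) + gnrm (\<lambda>x. f n x - F x) < e"
      using LIMSEQ_D[OF _ \<open>e > 0\<close>] by fastforce
    then show "\<exists>g\<in>H10 \<Omega>. H1_norm \<Omega> (\<lambda>x. g x - F x) < e"
      using H1_norm_bounds(3)[of "\<lambda>x. f n x - F x"] f by (intro bexI[of _ "f n"]) auto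
  qed
  then show thesis using that lim by blast
qed

end

section \<open>Solvability and stability of the state equation\<close>

text \<open>
  The nonlinearity \<open>a s\<^sup>+ - b s\<^sup>-\<close>; with \<open>a, b \<in> [0, 1]\<close> it covers the state equation and its
  linearisations alike.
\<close>

definition absorb :: "real \<Rightarrow> real \<Rightarrow> real \<Rightarrow> real" where
  "absorb a b s = a * max s 0 - b * max (- s) 0"

definition absorb_potential :: "real \<Rightarrow> real \<Rightarrow> real \<Rightarrow> real" where
  "absorb_potential a b s = (a * (max s 0)\<^sup>2 + b * (max (- s) 0)\<^sup>2) / 2"

text \<open>
  The potential is convex, and its derivative \<open>absorb a b\<close> is Lipschitz continuous with constant \<open>1\<close>.
\<close>

lemma absorb_potential_expansion:
  assumes "0 \<le> a" "a \<le> 1" "0 \<le> b" "b \<le> 1"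
  shows "absorb_potential a b s + absorb a b s * (t - s) \<le> absorb_potential a b t"
    "absorb_potential a b t \<le> absorb_potential a b s + absorb a b s * (t - s) + (t - s)\<^sup>2 / 2"
proof -
  define P where "P r = (max r 0)\<^sup>2 / 2" for r :: real
  have *: "P s + max s 0 * (t - s) \<le> P t"
    "P t \<le> P s + max s 0 * (t - s) + (t - s)\<^sup>2 / 2" for s t
  proof -
    have "0 \<le> (t - s)\<^sup>2" by simp
    show "P s + max s 0 * (t - s) \<le> P t"
    proof (cases "s > 0 \<and> t > 0")
      case True
      then show ?thesis using \<open>0 \<le> (t - s)\<^sup>2\<close>
        by (simp add: P_def max_def power2_eq_square algebra_simps)
    next
      case False
      then consider "s \<le> 0" | "s > 0" "t \<le> 0" by linarith
      then show ?thesis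
      proof cases
        case 2
        then have "s * t \<le> 0" by (simp add: mult_nonneg_nonpos)
        moreover have "0 \<le> s * s" by simp
        ultimately show ?thesis using 2 by (simp add: P_def max_def power2_eq_square algebra_simps)
      qed (simp add: P_def max_def)
    qed
    show "P t \<le> P s + max s 0 * (t - s) + (t - s)\<^sup>2 / 2"
    proof (cases "s > 0")
      case True
      have "P t \<le> t\<^sup>2 / 2" by (simp add: P_def max_def)
      also have "\<dots> = P s + max s 0 * (t - s) + (t - s)\<^sup>2 / 2"
        using True by (simp add: P_def power2_eq_square field_simps)
      finally show ?thesis .
    next
      case False
      then have "(max t 0)\<^sup>2 \<le> (t - s)\<^sup>2"
        by (intro abs_le_square_iff[THEN iffD1]) auto
      then show ?thesis using False by (simp add: P_def max_def split: if_splits)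
    qed
  qed
  have pot: "absorb_potential a b r = a * P r + b * P (- r)" for r
    by (simp add: absorb_potential_def P_def field_simps)
  have lin: "absorb a b s * (t - s) = a * (max s 0 * (t - s)) + b * (max (- s) 0 * (- t - - s))"
    by (simp add: absorb_def algebra_simps)
  show "absorb_potential a b s + absorb a b s * (t - s) \<le> absorb_potential a b t"
    using mult_left_mono[OF *(1)[of s t] assms(1)] mult_left_mono[OF *(1)[of "-s" "-t"] assms(3)]
    unfolding pot lin by (simp add: algebra_simps)
  \<comment> \<open>The remainders of both half lines add up to the remainder of \<open>s\<^sup>2/2\<close>.\<close>
  have split: "P t - P s - max s 0 * (t - s) + (P (- t) - P (- s) - max (- s) 0 * (- t - - s)) = (t - s)\<^sup>2 / 2"
    by (cases "s \<ge> 0"; cases "t \<ge> 0") (simp_all add: P_def max_def power2_eq_square field_simps)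
  have "a * (P t - P s - max s 0 * (t - s)) \<le> 1 * (P t - P s - max s 0 * (t - s))"
    using *(1)[of s t] assms by (intro mult_right_mono) auto
  moreover have "b * (P (- t) - P (- s) - max (- s) 0 * (- t - - s))
      \<le> 1 * (P (- t) - P (- s) - max (- s) 0 * (- t - - s))"
    using *(1)[of "-s" "-t"] assms by (intro mult_right_mono) auto
  ultimately show "absorb_potential a b t \<le> absorb_potential a b s + absorb a b s * (t - s) + (t - s)\<^sup>2 / 2"
    using split unfolding pot lin by (simp add: algebra_simps)
qed

lemma absorb_potential_bounds:
  assumes "0 \<le> a" "a \<le> 1" "0 \<le> b" "b \<le> 1"
  shows "0 \<le> absorb_potential a b s" "absorb_potential a b s \<le> s\<^sup>2 / 2"
  using absorb_potential_expansion[OF assms, where s = 0 and t = s] by (simp_all add: absorb_def absorb_potential_def)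

lemma absorb_bound:
  assumes "0 \<le> a" "a \<le> 1" "0 \<le> b" "b \<le> 1"
  shows "\<bar>absorb a b s\<bar> \<le> \<bar>s\<bar>"
  using mult_right_mono[OF assms(2), of "\<bar>s\<bar>"] mult_right_mono[OF assms(4), of "\<bar>s\<bar>"] assms
  by (cases "s \<ge> 0") (auto simp: absorb_def max_def abs_mult)

lemma absorb_linear: "absorb c c s = c * s" "absorb 1 0 s = max s 0"
  by (auto simp: absorb_def max_def)

context bounded_open
begin

text \<open>
  \<open>z\<close> is the weak solution of \<open>-\<Delta>z = g\<close> with zero boundary values. All lower order terms are
  moved into \<open>g\<close>, so that differences of solutions of different equations are covered as well.
\<close>

definition poisson :: "('a \<Rightarrow> real) \<Rightarrow> ('a \<Rightarrow> real) \<Rightarrow> bool" where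
  "poisson z g \<longleftrightarrow> z \<in> H10 \<Omega> \<and> g \<in> Lp 2 \<Omega> \<and> (\<forall>v\<in>H10 \<Omega>. energy z v = inn g v)"

lemma poissonD:
  assumes "poisson z g"
  shows "z \<in> H10 \<Omega>" "z \<in> Lp 2 \<Omega>" "g \<in> Lp 2 \<Omega>" "v \<in> H10 \<Omega> \<Longrightarrow> energy z v = inn g v"
  using assms H10_D(1) by (auto simp: poisson_def)

lemma poisson_diff:
  assumes "poisson z g" "poisson z' g'"
  shows "poisson (\<lambda>x. z x - z' x) (\<lambda>x. g x - g' x)"
  unfolding poisson_def
proof (intro conjI ballI)
  note p = poissonD[OF assms(1)] poissonD[OF assms(2)]
  show "(\<lambda>x. z x - z' x) \<in> H10 \<Omega>" "(\<lambda>x. g x - g' x) \<in> Lp 2 \<Omega>" by (intro H10_diff Lp2_diff p)+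
  fix v assume v: "v \<in> H10 \<Omega>"
  have "energy (\<lambda>x. z x - z' x) v = energy z v - energy z' v"
    using energy_add_scale_left[OF H10_H1[OF p(1)] H10_H1[OF p(5)] H10_H1[OF v], of "-1"] by simp
  then show "energy (\<lambda>x. z x - z' x) v = inn (\<lambda>x. g x - g' x) v"
    using p v H10_D(1)[OF v] by (simp add: L2_inner_diff_left)
qed

definition poincare :: real where
  "poincare = (SOME C. C > 0 \<and> (\<forall>f\<in>H10 \<Omega>. nrm f \<le> C * gnrm f))"

lemma poincare: "poincare > 0" "f \<in> H10 \<Omega> \<Longrightarrow> nrm f \<le> poincare * gnrm f"
proof -
  have "\<exists>C. C > 0 \<and> (\<forall>f\<in>H10 \<Omega>. nrm f \<le> C * gnrm f)"
    by (rule Poincare) blast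
  then have "poincare > 0 \<and> (\<forall>f\<in>H10 \<Omega>. nrm f \<le> poincare * gnrm f)"
    unfolding poincare_def by (rule someI_ex)
  then show "poincare > 0" "f \<in> H10 \<Omega> \<Longrightarrow> nrm f \<le> poincare * gnrm f" by auto
qed

text \<open>
  Solutions of \<open>-\<Delta>y + \<alpha> y\<^sup>+ - \<beta> y\<^sup>- = u\<close> are minimisers of the energy \<open>J\<close> below. A two-sided
  second order expansion of \<open>J\<close> carries the whole argument: its lower half says that \<open>J\<close> is strongly
  convex, so that minimising sequences are Cauchy sequences and their limit is a minimiser; its upper
  half yields the Euler--Lagrange equation. The state equation is the case \<open>\<alpha> = 1\<close>, \<open>\<beta> = 0\<close>
  and its linearisation the case \<open>\<alpha> = \<beta>\<close>.
\<close>

proposition semilinear_solvable: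
  assumes \<alpha>: "\<alpha> \<in> borel_measurable (lebesgue_on \<Omega>)" "\<And>x. 0 \<le> \<alpha> x" "\<And>x. \<alpha> x \<le> 1"
    and \<beta>: "\<beta> \<in> borel_measurable (lebesgue_on \<Omega>)" "\<And>x. 0 \<le> \<beta> x" "\<And>x. \<beta> x \<le> 1"
    and u: "u \<in> Lp 2 \<Omega>"
  obtains y where "poisson y (\<lambda>x. u x - absorb (\<alpha> x) (\<beta> x) (y x))"
proof -
  let ?A = "\<lambda>y x. absorb (\<alpha> x) (\<beta> x) (y x)" and ?B = "\<lambda>y x. absorb_potential (\<alpha> x) (\<beta> x) (y x)"
  note [measurable] = \<alpha>(1) \<beta>(1)
  have AL: "?A y \<in> Lp 2 \<Omega>" if "y \<in> Lp 2 \<Omega>" for y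
  proof (rule Lp2_dominated[OF that])
    note [measurable] = Lp2_measurable[OF that]
    show "?A y \<in> borel_measurable (lebesgue_on \<Omega>)" unfolding absorb_def by measurable
  qed (use absorb_bound \<alpha> \<beta> in auto)
  have BL: "integrable (lebesgue_on \<Omega>) (?B y)" if "y \<in> Lp 2 \<Omega>" for y
  proof (rule Bochner_Integration.integrable_bound)
    note [measurable] = Lp2_measurable[OF that]
    show "?B y \<in> borel_measurable (lebesgue_on \<Omega>)" unfolding absorb_potential_def by measurable
    show "integrable (lebesgue_on \<Omega>) (\<lambda>x. y x * y x / 2)"
      using Lp2_mult_integrable[OF that that] by simp
    show "AE x in lebesgue_on \<Omega>. norm (?B y x) \<le> norm (y x * y x / 2)"
      using absorb_potential_bounds[OF \<alpha>(2,3) \<beta>(2,3)] by (auto simp: power2_eq_square)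
  qed
  define J where "J y = energy y y / 2 + (\<integral>x. ?B y x \<partial>lebesgue_on \<Omega>) - inn u y" for y
  define D where "D y v = energy y v + inn (?A y) v - inn u v" for y v
  have D_scale: "D y (\<lambda>x. c * v x) = c * D y v" if "y \<in> H10 \<Omega>" "v \<in> H10 \<Omega>" for y v c
  proof -
    have "energy y (\<lambda>x. 0 + c * v x) = energy y (\<lambda>x. 0) + c * energy y v"
      by (intro energy_add_scale_right H10_H1 that H10_zero)
    moreover have "energy y (\<lambda>x. 0) = 0"
      using energy_add_scale_right[OF H10_H1[OF H10_zero] H10_H1[OF H10_zero] H10_H1[OF that(1)], of 1] by simp
    ultimately show ?thesis by (simp add: D_def L2_inner_scale_right algebra_simps)
  qed
  have expansion: "J y + D y (\<lambda>x. z x - y x) + (gnrm (\<lambda>x. z x - y x))\<^sup>2 / 2 \<le> J z"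
    "J z \<le> J y + D y (\<lambda>x. z x - y x) + (gnrm (\<lambda>x. z x - y x))\<^sup>2 / 2
       + (nrm (\<lambda>x. z x - y x))\<^sup>2 / 2"
    if y: "y \<in> H10 \<Omega>" and z: "z \<in> H10 \<Omega>" for y z
  proof -
    let ?w = "\<lambda>x. z x - y x"
    have w: "?w \<in> H10 \<Omega>" by (intro H10_diff y z)
    note L = H10_D(1)[OF y] H10_D(1)[OF z] H10_D(1)[OF w]
    have zw: "z = (\<lambda>x. y x + 1 * ?w x)" by simp
    have "energy z z = energy z (\<lambda>x. y x + 1 * ?w x)" by simp
    also have "\<dots> = energy z y + 1 * energy z ?w" by (intro energy_add_scale_right H10_H1 y z w)
    also have "energy z y = energy (\<lambda>x. y x + 1 * ?w x) y" by simp
    also have "\<dots> = energy y y + 1 * energy ?w y" by (intro energy_add_scale_left H10_H1 y z w)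
    also have "energy z ?w = energy (\<lambda>x. y x + 1 * ?w x) ?w" by simp
    also have "\<dots> = energy y ?w + 1 * energy ?w ?w" by (intro energy_add_scale_left H10_H1 y z w)
    finally have E: "energy z z = energy y y + 2 * energy y ?w + (gnrm ?w)\<^sup>2"
      by (simp add: energy_self energy_commute[of ?w y])
    have iA: "integrable (lebesgue_on \<Omega>) (\<lambda>x. ?A y x * ?w x)"
      by (intro Lp2_mult_integrable AL L)
    have iw: "integrable (lebesgue_on \<Omega>) (\<lambda>x. ?w x * ?w x / 2)"
      using Lp2_mult_integrable[OF L(3) L(3)] by simp
    have "(\<integral>x. ?B y x + ?A y x * ?w x \<partial>lebesgue_on \<Omega>) \<le> (\<integral>x. ?B z x \<partial>lebesgue_on \<Omega>)"
      using iA BL[OF L(1)] BL[OF L(2)] absorb_potential_expansion(1)[OF \<alpha>(2,3) \<beta>(2,3)]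
      by (intro integral_mono) auto
    then have lo: "(\<integral>x. ?B y x \<partial>lebesgue_on \<Omega>) + inn (?A y) ?w \<le> (\<integral>x. ?B z x \<partial>lebesgue_on \<Omega>)"
      using iA BL[OF L(1)] by (simp add: L2_inner_def)
    have "(\<integral>x. ?B z x \<partial>lebesgue_on \<Omega>) \<le> (\<integral>x. ?B y x + ?A y x * ?w x + ?w x * ?w x / 2 \<partial>lebesgue_on \<Omega>)"
      using iA iw BL[OF L(1)] BL[OF L(2)] absorb_potential_expansion(2)[OF \<alpha>(2,3) \<beta>(2,3)]
      by (intro integral_mono) (auto simp: power2_eq_square)
    also have "\<dots> = (\<integral>x. ?B y x \<partial>lebesgue_on \<Omega>) + inn (?A y) ?w + inn ?w ?w / 2"
      using iA iw BL[OF L(1)] by (simp add: L2_inner_def)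
    finally have hi: "(\<integral>x. ?B z x \<partial>lebesgue_on \<Omega>)
        \<le> (\<integral>x. ?B y x \<partial>lebesgue_on \<Omega>) + inn (?A y) ?w + (nrm ?w)\<^sup>2 / 2"
      by (simp add: L2_norm_sq)
    have uw: "inn u z = inn u y + inn u ?w"
      using L2_inner_diff_right[OF L(2) L(1) u] by simp
    show "J y + D y ?w + (gnrm ?w)\<^sup>2 / 2 \<le> J z"
      "J z \<le> J y + D y ?w + (gnrm ?w)\<^sup>2 / 2 + (nrm ?w)\<^sup>2 / 2"
      using E lo hi uw unfolding J_def D_def by linarith+
  qed
  have below: "- (nrm u * poincare)\<^sup>2 / 2 \<le> J z" if z: "z \<in> H10 \<Omega>" for z
  proof -
    let ?g = "gnrm z"
    have e0: "energy (\<lambda>x. 0) v = 0" if "v \<in> H10 \<Omega>" for v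
      using energy_add_scale_left[OF H10_H1[OF H10_zero] H10_H1[OF H10_zero] H10_H1[OF that], of 1] by simp
    have "inn u z \<le> nrm u * nrm z" by (intro L2_inner_le u H10_D z)
    also have "\<dots> \<le> nrm u * (poincare * ?g)" by (intro mult_left_mono poincare z) simp
    finally have "inn u z \<le> (nrm u * poincare) * ?g" by (simp add: mult.assoc)
    moreover have "- inn u z + ?g\<^sup>2 / 2 \<le> J z"
      using expansion(1)[OF H10_zero z] e0[OF z] e0[OF H10_zero]
      by (simp add: J_def D_def absorb_def absorb_potential_def)
    moreover have "0 \<le> (nrm u * poincare - ?g)\<^sup>2" by simp
    ultimately show ?thesis by (simp add: power2_diff)
  qed
  define m where "m = Inf (J ` H10 \<Omega>)"
  have bdd: "bdd_below (J ` H10 \<Omega>)" using below by (auto intro!: bdd_belowI2)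
  have ne: "J ` H10 \<Omega> \<noteq> {}" using H10_zero by blast
  have m_le: "m \<le> J z" if "z \<in> H10 \<Omega>" for z unfolding m_def using bdd that by (intro cInf_lower) auto
  define r where "r n = inverse (real (Suc n))" for n
  have r0: "r \<longlonglongrightarrow> 0" unfolding r_def by (rule LIMSEQ_inverse_real_of_nat)
  have "\<exists>z\<in>H10 \<Omega>. J z < m + r n" for n
    using cInf_lessD[OF ne, of "m + r n"] by (auto simp: m_def r_def)
  then obtain z where z: "\<And>n. z n \<in> H10 \<Omega>" "\<And>n. J (z n) < m + r n" by metis
  have strong: "(gnrm (\<lambda>x. y x - y' x))\<^sup>2 \<le> 4 * (J y + J y' - 2 * m)"
    if y: "y \<in> H10 \<Omega>" and y': "y' \<in> H10 \<Omega>" for y y'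
  proof -
    \<comment> \<open>Compare both points with their midpoint, where \<open>J \<ge> m\<close>; the linear terms cancel.\<close>
    let ?d = "\<lambda>x. y x - y' x" and ?mid = "\<lambda>x. (1/2) * y x + (1/2) * y' x"
    have d: "?d \<in> H10 \<Omega>" and mid: "?mid \<in> H10 \<Omega>"
      by (intro H10_diff H10_add H10_scale y y')+
    have e1: "(\<lambda>x. y x - ?mid x) = (\<lambda>x. (1/2) * ?d x)" and e2: "(\<lambda>x. y' x - ?mid x) = (\<lambda>x. (-1/2) * ?d x)"
      by (auto simp: field_simps)
    have sc: "(gnrm (\<lambda>x. c * ?d x))\<^sup>2 = c\<^sup>2 * (gnrm ?d)\<^sup>2" for c
      by (simp add: gnrm_scale H10_H1 d power_mult_distrib)
    have "J ?mid + D ?mid (\<lambda>x. (1/2) * ?d x) + (1/2)\<^sup>2 * (gnrm ?d)\<^sup>2 / 2 \<le> J y"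
      using expansion(1)[OF mid y] unfolding e1 sc .
    moreover have "J ?mid + D ?mid (\<lambda>x. (-1/2) * ?d x) + (-1/2)\<^sup>2 * (gnrm ?d)\<^sup>2 / 2 \<le> J y'"
      using expansion(1)[OF mid y'] unfolding e2 sc .
    ultimately show ?thesis
      using m_le[OF mid] unfolding D_scale[OF mid d] by (simp add: power_divide)
  qed
  obtain F where F: "F \<in> H10 \<Omega>" "(\<lambda>n. gnrm (\<lambda>x. z n x - F x)) \<longlonglongrightarrow> 0"
  proof (rule H10_complete[OF z(1)])
    fix e :: real assume "e > 0"
    then obtain N where N: "r N < e\<^sup>2 / 8"
      unfolding r_def using reals_Archimedean[of "e\<^sup>2 / 8"] by auto
    have "gnrm (\<lambda>x. z k x - z l x) < e" if "k \<ge> N" "l \<ge> N" for k l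
    proof -
      have "r k \<le> r N" "r l \<le> r N"
        using that by (auto simp: r_def intro!: le_imp_inverse_le)
      then have "(gnrm (\<lambda>x. z k x - z l x))\<^sup>2 < e\<^sup>2"
        using strong[OF z(1) z(1), of k l] z(2)[of k] z(2)[of l] N by argo
      then show ?thesis using \<open>e > 0\<close> by (simp add: power_less_imp_less_base)
    qed
    then show "\<exists>N. \<forall>m\<ge>N. \<forall>n\<ge>N. gnrm (\<lambda>x. z m x - z n x) < e" by blast
  qed
  note FL = H10_D(1)[OF F(1)]
  have JF: "J F \<le> m"
  proof -
    define K where "K = gnrm F + nrm (?A F) * poincare + nrm u * poincare"
    have D_bound: "\<bar>D F v\<bar> \<le> K * gnrm v" if v: "v \<in> H10 \<Omega>" for v
    proof -
      have "\<bar>energy F v\<bar> \<le> gnrm F * gnrm v"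
        by (intro energy_le H10_H1 F v)
      moreover have "\<bar>inn g v\<bar> \<le> nrm g * poincare * gnrm v" if "g \<in> Lp 2 \<Omega>" for g
        using L2_Cauchy_Schwarz[OF that H10_D(1)[OF v]] mult_left_mono[OF poincare(2)[OF v] L2_norm_nonneg[of \<Omega> g]]
        by (simp add: mult.assoc)
      from this[OF u] this[OF AL[OF FL]]
      have "\<bar>inn u v\<bar> \<le> nrm u * poincare * gnrm v"
        "\<bar>inn (?A F) v\<bar> \<le> nrm (?A F) * poincare * gnrm v" by auto
      ultimately show ?thesis unfolding D_def K_def by (simp add: algebra_simps)
    qed
    have "J F \<le> m + r n + K * gnrm (\<lambda>x. z n x - F x)" for n
      using expansion(1)[OF F(1) z(1), of n] D_bound[OF H10_diff[OF z(1) F(1)], of n] z(2)[of n]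
        zero_le_power2[of "gnrm (\<lambda>x. z n x - F x)"] by linarith
    moreover have "(\<lambda>n. m + r n + K * gnrm (\<lambda>x. z n x - F x)) \<longlonglongrightarrow> m + 0 + K * 0"
      by (intro tendsto_intros F r0)
    ultimately show ?thesis by (intro LIMSEQ_le_const) auto
  qed
  have crit: "D F v = 0" if v: "v \<in> H10 \<Omega>" for v
  proof (rule ccontr)
    assume nz: "D F v \<noteq> 0"
    define k where "k = (gnrm v)\<^sup>2 / 2 + (nrm v)\<^sup>2 / 2"
    have "k \<ge> 0" by (simp add: k_def)
    have quad: "0 \<le> t * D F v + t\<^sup>2 * k" for t
    proof -
      have Ftv: "(\<lambda>x. F x + t * v x) \<in> H10 \<Omega>" by (intro H10_add_scale F v)
      have e: "(\<lambda>x. F x + t * v x - F x) = (\<lambda>x. t * v x)" by simp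
      have "(gnrm (\<lambda>x. t * v x))\<^sup>2 = t\<^sup>2 * (gnrm v)\<^sup>2"
        by (simp add: gnrm_scale H10_H1 v power_mult_distrib)
      moreover have "(nrm (\<lambda>x. t * v x))\<^sup>2 = t\<^sup>2 * (nrm v)\<^sup>2"
        by (simp add: L2_norm_scale power_mult_distrib)
      moreover have "J (\<lambda>x. F x + t * v x) \<le> J F + t * D F v
          + (gnrm (\<lambda>x. t * v x))\<^sup>2 / 2 + (nrm (\<lambda>x. t * v x))\<^sup>2 / 2"
        using expansion(2)[OF F(1) Ftv] unfolding e D_scale[OF F(1) v] .
      moreover have "t\<^sup>2 * k = t\<^sup>2 * (gnrm v)\<^sup>2 / 2 + t\<^sup>2 * (nrm v)\<^sup>2 / 2"
        by (simp add: k_def algebra_simps)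
      ultimately show ?thesis using m_le[OF Ftv] JF by linarith
    qed
    \<comment> \<open>The slope beats the quadratic term at \<open>t = - D F v / c\<close> whenever \<open>c > k\<close>.\<close>
    define c where "c = k + 1"
    have c: "c > 0" "k < c" using \<open>k \<ge> 0\<close> by (auto simp: c_def)
    have "0 \<le> (- D F v / c) * D F v + (- D F v / c)\<^sup>2 * k" by (rule quad)
    also have "\<dots> = - ((D F v)\<^sup>2 * (c - k) / c\<^sup>2)"
      using c by (simp add: field_simps power2_eq_square)
    also have "\<dots> < 0" using nz c by simp
    finally show False by simp
  qed
  have "energy F v = inn (\<lambda>x. u x - ?A F x) v" if "v \<in> H10 \<Omega>" for v
  proof -
    have "inn (\<lambda>x. u x - ?A F x) v = inn u v - inn (?A F) v"
      by (rule L2_inner_diff_left[OF u AL[OF FL] H10_D(1)[OF that]])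
    then show ?thesis using crit[OF that] by (simp add: D_def)
  qed
  then show thesis by (intro that[of F]) (simp add: poisson_def F Lp2_diff u AL FL)
qed

text \<open>Testing an equation \<open>-\<Delta>z + q = h\<close> having \<open>q z \<ge> 0\<close> with its solution \<open>z\<close>.\<close>

lemma energy_estimate:
  assumes z: "poisson z (\<lambda>x. h x - q x)" and h: "h \<in> Lp 2 \<Omega>" and q: "q \<in> Lp 2 \<Omega>"
    and sgn: "\<And>x. x \<in> \<Omega> \<Longrightarrow> 0 \<le> q x * z x"
  shows "(gnrm z)\<^sup>2 \<le> nrm h * nrm z" "nrm z \<le> poincare\<^sup>2 * nrm h"
proof -
  note p = poissonD[OF z]
  have "(gnrm z)\<^sup>2 = inn h z - inn q z"
    using p(4)[OF p(1)] by (simp add: energy_self L2_inner_diff_left h q p)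
  moreover have "0 \<le> inn q z" unfolding L2_inner_def using sgn
    by (intro Bochner_Integration.integral_nonneg_AE AE_I2) auto
  moreover have "inn h z \<le> nrm h * nrm z" by (intro L2_inner_le h p)
  ultimately show 1: "(gnrm z)\<^sup>2 \<le> nrm h * nrm z" by linarith
  have "(nrm z)\<^sup>2 \<le> (poincare * gnrm z)\<^sup>2"
    using poincare(2)[OF p(1)] by (intro power_mono) auto
  also have "\<dots> \<le> poincare\<^sup>2 * (nrm h * nrm z)"
    unfolding power_mult_distrib by (intro mult_left_mono 1) auto
  finally have "nrm z * nrm z \<le> nrm z * (poincare\<^sup>2 * nrm h)" by (simp add: power2_eq_square mult_ac)
  then show "nrm z \<le> poincare\<^sup>2 * nrm h"
    using L2_norm_nonneg[of \<Omega> z] L2_norm_nonneg[of \<Omega> h]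
    by (cases "nrm z = 0") (auto simp: mult_le_cancel_left)
qed

lemma positive_part_Lp2:
  fixes y :: "'a \<Rightarrow> real"
  assumes "y \<in> Lp 2 \<Omega>"
  shows "(\<lambda>x. max (y x) 0) \<in> Lp 2 \<Omega>"
proof (rule Lp2_dominated[OF assms])
  show "(\<lambda>x. max (y x) 0) \<in> borel_measurable (lebesgue_on \<Omega>)"
    by (rule borel_measurable_max[OF borel_measurable_const Lp2_measurable[OF assms]])
qed auto

lemma poisson_iff:
  assumes h: "h \<in> Lp 2 \<Omega>" and q: "y \<in> Lp 2 \<Omega> \<Longrightarrow> q \<in> Lp 2 \<Omega>"
  shows "poisson y (\<lambda>x. h x - q x) \<longleftrightarrow>
    y \<in> H10 \<Omega> \<and> (\<forall>v\<in>H10 \<Omega>. energy y v + inn q v = inn h v)"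
proof (cases "y \<in> H10 \<Omega>")
  case True
  then have "q \<in> Lp 2 \<Omega>" using q H10_D(1) by blast
  then show ?thesis
    using True h H10_D(1) by (auto simp: poisson_def L2_inner_diff_left Lp2_diff)
qed (simp add: poisson_def)

abbreviation F where "F \<equiv> F_op \<Omega>"
abbreviation G where "G \<equiv> G_op \<Omega>"

lemma F_poisson:
  assumes u: "u \<in> Lp 2 \<Omega>"
  shows "poisson (F u) (\<lambda>x. u x - max (F u x) 0)"
proof -
  have iff: "state_solution \<Omega> u y \<longleftrightarrow> poisson y (\<lambda>x. u x - max (y x) 0)" for y
    using poisson_iff[OF u positive_part_Lp2, of y] by (simp add: state_solution_def energy_def)
  obtain y where "poisson y (\<lambda>x. u x - absorb 1 0 (y x))"
    by (rule semilinear_solvable[of "\<lambda>x. 1" "\<lambda>x. 0" u]) (use u in auto)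
  then have "state_solution \<Omega> u y" by (simp add: iff absorb_linear)
  then show ?thesis
    using someI[of "state_solution \<Omega> u" y] unfolding iff F_op_def by simp
qed

lemmas F_Lp2 = poissonD(2)[OF F_poisson]

definition active :: "('a \<Rightarrow> real) \<Rightarrow> 'a \<Rightarrow> real" where
  "active u x = indicator {z. F u z > 0} x"

lemma active_range: "0 \<le> active u x" "active u x \<le> 1"
  by (simp_all add: active_def)

lemma active_measurable:
  assumes "u \<in> Lp 2 \<Omega>"
  shows "active u \<in> borel_measurable (lebesgue_on \<Omega>)"
proof -
  have [measurable]: "F u \<in> borel_measurable (lebesgue_on \<Omega>)" by (intro Lp2_measurable F_Lp2 assms)
  have "active u = (\<lambda>x. if F u x > 0 then 1 else 0)" by (auto simp: active_def)
  then show ?thesis by simp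
qed

lemma active_Lp2:
  assumes "u \<in> Lp 2 \<Omega>" "y \<in> Lp 2 \<Omega>"
  shows "(\<lambda>x. active u x * y x) \<in> Lp 2 \<Omega>"
  using assms(2)
  by (rule Lp2_dominated)
    (intro borel_measurable_times active_measurable Lp2_measurable assms, simp add: active_def indicator_def)

lemma G_poisson:
  assumes u: "u \<in> Lp 2 \<Omega>" and h: "h \<in> Lp 2 \<Omega>"
  shows "poisson (G u h) (\<lambda>x. h x - active u x * G u h x)"
proof -
  have iff: "linearized_solution \<Omega> u h y \<longleftrightarrow> poisson y (\<lambda>x. h x - active u x * y x)" for y
    using poisson_iff[OF h active_Lp2[OF u], of y]
    by (simp add: linearized_solution_def energy_def active_def)
  obtain y where "poisson y (\<lambda>x. h x - absorb (active u x) (active u x) (y x))"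
    by (rule semilinear_solvable[of "active u" "active u" h]) (use u h active_measurable active_range in auto)
  then have "linearized_solution \<Omega> u h y" by (simp add: iff absorb_linear)
  then show ?thesis
    using someI[of "linearized_solution \<Omega> u h" y] unfolding iff G_op_def by simp
qed

lemmas G_Lp2 = poissonD(2)[OF G_poisson]

lemma F_difference_poisson:
  assumes "u \<in> Lp 2 \<Omega>" "v \<in> Lp 2 \<Omega>"
  shows "poisson (\<lambda>x. F u x - F v x) (\<lambda>x. (u x - v x) - (max (F u x) 0 - max (F v x) 0))"
  using poisson_diff[OF F_poisson[OF assms(1)] F_poisson[OF assms(2)]] by (simp add: algebra_simps)

lemma F_estimates:
  assumes u: "u \<in> Lp 2 \<Omega>" and v: "v \<in> Lp 2 \<Omega>"
  shows "(gnrm (\<lambda>x. F u x - F v x))\<^sup>2 \<le> nrm (\<lambda>x. u x - v x) * nrm (\<lambda>x. F u x - F v x)"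
    "nrm (\<lambda>x. F u x - F v x) \<le> poincare\<^sup>2 * nrm (\<lambda>x. u x - v x)"
proof -
  have sgn: "0 \<le> (max s 0 - max t 0) * (s - t)" for s t :: real
    by (cases "s \<le> t") (auto simp: mult_nonpos_nonpos)
  have L: "(\<lambda>x. u x - v x) \<in> Lp 2 \<Omega>" "(\<lambda>x. max (F u x) 0 - max (F v x) 0) \<in> Lp 2 \<Omega>"
    by (intro Lp2_diff positive_part_Lp2 F_Lp2 u v)+
  note * = energy_estimate[OF F_difference_poisson[OF u v] L sgn]
  show "(gnrm (\<lambda>x. F u x - F v x))\<^sup>2 \<le> nrm (\<lambda>x. u x - v x) * nrm (\<lambda>x. F u x - F v x)"
    "nrm (\<lambda>x. F u x - F v x) \<le> poincare\<^sup>2 * nrm (\<lambda>x. u x - v x)" by (rule *; assumption)+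
qed

lemma linearized_estimate:
  assumes "u \<in> Lp 2 \<Omega>" "h \<in> Lp 2 \<Omega>" and y: "poisson y (\<lambda>x. h x - active u x * y x)"
  shows "nrm y \<le> poincare\<^sup>2 * nrm h"
proof -
  have sgn: "0 \<le> active u x * y x * y x" for x
    using active_range(1)[of u x] by (simp add: mult.assoc)
  show ?thesis
    by (rule energy_estimate(2)[OF y assms(2) active_Lp2[OF assms(1) poissonD(2)[OF y]] sgn])
qed

lemma G_bound:
  assumes "u \<in> Lp 2 \<Omega>" "h \<in> Lp 2 \<Omega>"
  shows "nrm (G u h) \<le> poincare\<^sup>2 * nrm h"
  by (rule linearized_estimate[OF assms G_poisson[OF assms]])

lemma G_unique:
  assumes u: "u \<in> Lp 2 \<Omega>" and h: "h \<in> Lp 2 \<Omega>" and y: "poisson y (\<lambda>x. h x - active u x * y x)"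
  shows "AE x in lebesgue_on \<Omega>. G u h x = y x"
proof -
  let ?d = "\<lambda>x. G u h x - y x"
  have "(\<lambda>x. (h x - active u x * G u h x) - (h x - active u x * y x)) = (\<lambda>x. 0 - active u x * ?d x)"
    by (auto simp: algebra_simps)
  then have "poisson ?d (\<lambda>x. 0 - active u x * ?d x)"
    using poisson_diff[OF G_poisson[OF u h] y] by simp
  from linearized_estimate[OF u Lp2_zero this] have "nrm ?d = 0"
    using L2_norm_nonneg[of \<Omega> ?d] by simp
  then have "AE x in lebesgue_on \<Omega>. ?d x = 0"
    by (intro L2_norm_eq_0_AE Lp2_diff G_Lp2 u h poissonD(2)[OF y])
  then show ?thesis by simp
qed

lemma G_selfadjoint:
  assumes u: "u \<in> Lp 2 \<Omega>" and h: "h \<in> Lp 2 \<Omega>" and k: "k \<in> Lp 2 \<Omega>"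
  shows "inn (G u h) k = inn h (G u k)"
proof -
  note ph = poissonD[OF G_poisson[OF u h]] and pk = poissonD[OF G_poisson[OF u k]]
  have "energy (G u h) (G u k) = inn h (G u k) - inn (\<lambda>x. active u x * G u h x) (G u k)"
    using ph(4)[OF pk(1)] by (simp add: L2_inner_diff_left h active_Lp2 u ph(2) pk(2))
  moreover have "energy (G u k) (G u h) = inn k (G u h) - inn (\<lambda>x. active u x * G u k x) (G u h)"
    using pk(4)[OF ph(1)] by (simp add: L2_inner_diff_left k active_Lp2 u ph(2) pk(2))
  moreover have "inn (\<lambda>x. active u x * G u h x) (G u k) = inn (\<lambda>x. active u x * G u k x) (G u h)"
    by (simp add: L2_inner_def mult_ac)
  ultimately show ?thesis by (simp add: energy_commute[of "G u k"] L2_inner_commute[of \<Omega> k])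
qed

text \<open>
  The adjoint is a choice among representatives that all agree with \<open>G u k\<close> almost everywhere.
\<close>

lemma adjoint_G:
  assumes u: "u \<in> Lp 2 \<Omega>" and k: "k \<in> Lp 2 \<Omega>"
  shows "L2_adjoint \<Omega> (G u) k \<in> Lp 2 \<Omega>"
    "AE x in lebesgue_on \<Omega>. L2_adjoint \<Omega> (G u) k x = G u k x"
proof -
  let ?a = "L2_adjoint \<Omega> (G u) k"
  have "G u k \<in> Lp 2 \<Omega> \<and> (\<forall>h\<in>Lp 2 \<Omega>. inn (G u h) k = inn h (G u k))"
    using G_selfadjoint G_Lp2 u k by blast
  then have a: "?a \<in> Lp 2 \<Omega> \<and> (\<forall>h\<in>Lp 2 \<Omega>. inn (G u h) k = inn h ?a)"
    unfolding L2_adjoint_def by (rule someI[of "\<lambda>g. g \<in> Lp 2 \<Omega> \<and> (\<forall>h\<in>Lp 2 \<Omega>. inn (G u h) k = inn h g)"])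
  then show aL: "?a \<in> Lp 2 \<Omega>" by simp
  have dL: "(\<lambda>x. ?a x - G u k x) \<in> Lp 2 \<Omega>" by (intro Lp2_diff aL G_Lp2 u k)
  have "inn (\<lambda>x. ?a x - G u k x) (\<lambda>x. ?a x - G u k x)
      = inn (\<lambda>x. ?a x - G u k x) ?a - inn (\<lambda>x. ?a x - G u k x) (G u k)"
    by (intro L2_inner_diff_right aL G_Lp2 u k dL)
  also have "\<dots> = 0" using a dL G_selfadjoint[OF u dL k] by simp
  finally have "AE x in lebesgue_on \<Omega>. ?a x - G u k x = 0"
    by (intro L2_norm_eq_0_AE dL) (simp add: L2_norm_eq)
  then show "AE x in lebesgue_on \<Omega>. ?a x = G u k x" by simp
qed

text \<open>
  Small differences of states make the image of the difference of the controls under \<^emph>\<open>every\<close>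
  linearised solution operator small: \<open>G w (u - v) - (F u - F v)\<close> solves a linearised equation
  whose right-hand side is bounded by \<open>|F u - F v|\<close>.
\<close>

lemma G_le_state_difference:
  assumes w: "w \<in> Lp 2 \<Omega>" and u: "u \<in> Lp 2 \<Omega>" and v: "v \<in> Lp 2 \<Omega>"
  shows "nrm (G w (\<lambda>x. u x - v x)) \<le> (1 + poincare\<^sup>2) * nrm (\<lambda>x. F u x - F v x)"
proof -
  let ?e = "\<lambda>x. u x - v x" and ?z = "\<lambda>x. F u x - F v x"
  let ?\<eta> = "G w ?e"
  let ?g = "\<lambda>x. (max (F u x) 0 - max (F v x) 0) - active w x * ?z x"
  have eL: "?e \<in> Lp 2 \<Omega>" and zL: "?z \<in> Lp 2 \<Omega>" by (intro Lp2_diff u v F_Lp2)+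
  have gL: "?g \<in> Lp 2 \<Omega>" by (intro Lp2_diff positive_part_Lp2 active_Lp2 F_Lp2 w u v zL)
  have "(\<lambda>x. (?e x - active w x * ?\<eta> x) - (?e x - (max (F u x) 0 - max (F v x) 0)))
     = (\<lambda>x. ?g x - active w x * (?\<eta> x - ?z x))" by (auto simp: algebra_simps)
  then have "poisson (\<lambda>x. ?\<eta> x - ?z x) (\<lambda>x. ?g x - active w x * (?\<eta> x - ?z x))"
    using poisson_diff[OF G_poisson[OF w eL] F_difference_poisson[OF u v]] by simp
  from linearized_estimate[OF w gL this]
  have "nrm (\<lambda>x. ?\<eta> x - ?z x) \<le> poincare\<^sup>2 * nrm ?g" .
  also have "nrm ?g \<le> nrm ?z"
    by (intro L2_norm_mono gL zL) (auto simp: active_def indicator_def max_def)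
  finally have "nrm (\<lambda>x. ?\<eta> x - ?z x) \<le> poincare\<^sup>2 * nrm ?z" by (simp add: mult_left_mono)
  moreover have "nrm ?\<eta> \<le> nrm (\<lambda>x. ?\<eta> x - ?z x) + nrm ?z"
    using L2_norm_triangle[OF Lp2_diff[OF G_Lp2[OF w eL] zL] zL] by simp
  ultimately show ?thesis by (simp add: algebra_simps)
qed

end

section \<open>The tangential cone condition\<close>

text \<open>
  Hoelder's inequality on \<open>S\<close> with exponents \<open>2/p\<close> and \<open>2/(2-p)\<close>. It is obtained by integrating
  Young's inequality \<open>x\<^sup>\<theta> \<le> \<theta> x + 1 - \<theta>\<close> for \<open>\<theta> = p/2\<close>, where \<open>x\<close> is \<open>z\<^sup>2\<close> divided by its mean value
  \<open>\<parallel>z\<parallel>\<^sup>2 / s\<close>: this is the scaling for which the result is sharp.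
\<close>

lemma Lp_norm_le_small_support:
  fixes h z :: "'a::euclidean_space \<Rightarrow> real"
  assumes p: "0 < p" "p < 2" and h: "h \<in> borel_measurable (lebesgue_on \<Omega>)" and z: "z \<in> Lp 2 \<Omega>"
    and le: "\<And>x. x \<in> \<Omega> \<Longrightarrow> \<bar>h x\<bar> \<le> \<bar>z x\<bar>"
    and S: "S \<in> lmeasurable" "S \<subseteq> \<Omega>" "\<Omega> \<in> sets lebesgue" "\<And>x. x \<in> \<Omega> \<Longrightarrow> x \<notin> S \<Longrightarrow> h x = 0"
    and s: "measure lebesgue S \<le> s" "0 < s"
  shows "h \<in> Lp p \<Omega>" "Lp_norm p \<Omega> h \<le> s powr ((2 - p) / (2 * p)) * Lp_norm 2 \<Omega> z"
proof -
  let ?M = "lebesgue_on \<Omega>"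
  define \<theta> where "\<theta> = p / 2"
  have \<theta>: "0 < \<theta>" "\<theta> < 1" using p by (auto simp: \<theta>_def)
  note [measurable] = h Lp2_measurable[OF z]
  have Sm [measurable]: "S \<in> sets ?M" using S by (auto simp: sets_restrict_space_iff)
  have mS: "measure ?M S = measure lebesgue S" using S by (intro measure_restrict_space) auto
  have iS: "integrable ?M (indicator S :: 'a \<Rightarrow> real)"
    using S Sm by (intro integrable_real_indicator) (auto simp: emeasure_restrict_space fmeasurable_def)
  have iz: "integrable ?M (\<lambda>x. (z x)\<^sup>2)" using z by (simp add: Lp2_iff)
  define I where "I = (\<integral>x. \<bar>h x\<bar> powr p \<partial>?M)"
  define A where "A = (Lp_norm 2 \<Omega> z)\<^sup>2"
  have A_int: "(\<integral>x. (z x)\<^sup>2 \<partial>?M) = A" 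
    unfolding A_def L2_norm_sq L2_inner_def by (simp add: power2_eq_square)
  have pointwise: "\<bar>h x\<bar> powr p \<le> (B / s) powr \<theta> * ((1 - \<theta>) * indicator S x + \<theta> * (s / B) * (z x)\<^sup>2)"
    if B: "B > 0" and x: "x \<in> \<Omega>" for B x
  proof (cases "h x = 0")
    case True
    then show ?thesis using \<theta> B s by (auto intro!: mult_nonneg_nonneg add_nonneg_nonneg)
  next
    case False
    then have xS: "x \<in> S" using S(4) x by blast
    have zx: "z x \<noteq> 0" using le[OF x] False by auto
    have "\<bar>h x\<bar> powr p \<le> \<bar>z x\<bar> powr p" using le[OF x] p by (intro powr_mono2) auto
    also have "\<bar>z x\<bar> powr p = ((z x)\<^sup>2) powr \<theta>"
    proof -
      have "((z x)\<^sup>2) powr \<theta> = (\<bar>z x\<bar> powr 2) powr \<theta>" using zx by simp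
      then show ?thesis by (simp only: powr_powr \<theta>_def) simp
    qed
    also have "\<dots> = ((B / s) * ((s / B) * (z x)\<^sup>2)) powr \<theta>" using B s by simp
    also have "\<dots> = (B / s) powr \<theta> * ((s / B) * (z x)\<^sup>2) powr \<theta>"
      by (rule powr_mult)
    also have "((s / B) * (z x)\<^sup>2) powr \<theta> \<le> \<theta> * ((s / B) * (z x)\<^sup>2) + (1 - \<theta>) * 1"
      using Youngs_inequality_0[of \<theta> "1 - \<theta>" "(s / B) * (z x)\<^sup>2" 1] \<theta> B s zx by simp
    finally show ?thesis using xS B s by (simp add: mult_left_mono algebra_simps)
  qed
  have int_bound: "integrable ?M (\<lambda>x. (B / s) powr \<theta> * ((1 - \<theta>) * indicator S x + \<theta> * (s / B) * (z x)\<^sup>2))" for B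
    using iS iz by (intro integrable_mult_right Bochner_Integration.integrable_add) auto
  have int_h: "integrable ?M (\<lambda>x. \<bar>h x\<bar> powr p)"
    by (rule Bochner_Integration.integrable_bound[OF int_bound[of 1]])
      (use pointwise[of 1] in \<open>auto intro!: AE_I2 order_trans[OF _ abs_ge_self]\<close>)
  then show "h \<in> Lp p \<Omega>" using h by (simp add: Lp_def)
  have I_le: "I \<le> A powr \<theta> * s powr (1 - \<theta>)"
  proof (cases "A = 0")
    case True
    then have "AE x in ?M. z x = 0" by (intro L2_norm_eq_0_AE z) (simp add: A_def)
    then have "AE x in ?M. \<bar>h x\<bar> powr p = 0"
      using AE_space by eventually_elim (use le in force)
    then have "I = 0" unfolding I_def by (rule integral_eq_zero_AE)
    then show ?thesis by simp
  next
    case False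
    then have A: "A > 0" by (simp add: A_def)
    have "I \<le> (\<integral>x. (A / s) powr \<theta> * ((1 - \<theta>) * indicator S x + \<theta> * (s / A) * (z x)\<^sup>2) \<partial>?M)"
      unfolding I_def using int_h int_bound pointwise[OF A] by (intro integral_mono) auto
    also have "\<dots> = (A / s) powr \<theta> * ((1 - \<theta>) * measure lebesgue S + \<theta> * (s / A) * A)"
      using iS iz by (simp add: A_int mS[symmetric] S(2) Int_absorb1 Int_absorb2 inf_commute)
    also have "\<dots> \<le> (A / s) powr \<theta> * ((1 - \<theta>) * s + \<theta> * (s / A) * A)"
      using s \<theta> by (intro mult_left_mono add_right_mono) auto
    also have "\<dots> = (A / s) powr \<theta> * s powr 1" using A s by (simp add: algebra_simps)
    also have "\<dots> = A powr \<theta> * s powr (1 - \<theta>)"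
      using A s by (simp add: powr_divide powr_diff)
    finally show ?thesis .
  qed
  have "Lp_norm p \<Omega> h = I powr (1 / p)" by (simp add: Lp_norm_def I_def)
  also have "\<dots> \<le> (A powr \<theta> * s powr (1 - \<theta>)) powr (1 / p)"
    using I_le p by (intro powr_mono2) (auto simp: I_def)
  also have "\<dots> = A powr (\<theta> * (1 / p)) * s powr ((1 - \<theta>) * (1 / p))"
    by (simp add: powr_mult powr_powr)
  also have "\<theta> * (1 / p) = 1 / 2" using p by (simp add: \<theta>_def)
  also have "A powr (1 / 2) = Lp_norm 2 \<Omega> z" by (simp add: A_def powr_half_sqrt)
  also have "(1 - \<theta>) * (1 / p) = (2 - p) / (2 * p)" using p by (simp add: \<theta>_def field_simps)
  finally show "Lp_norm p \<Omega> h \<le> s powr ((2 - p) / (2 * p)) * Lp_norm 2 \<Omega> z" by (simp add: mult.commute)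
qed

context bounded_open
begin

lemma L2_norm_le_of_C_norm_le:
  assumes f: "f \<in> Lp 2 \<Omega>" and M: "C_norm_le \<Omega> f M" "0 \<le> M"
  shows "nrm f \<le> M * measure lebesgue \<Omega> powr (1 / 2)"
proof -
  obtain c where c: "continuous_on (closure \<Omega>) c" "AE x in lebesgue_on \<Omega>. f x = c x"
    "(SUP x\<in>closure \<Omega>. \<bar>c x\<bar>) \<le> M" using M by (auto simp: C_norm_le_def)
  have "compact (closure \<Omega>)" using bounded_dom by simp
  then have "compact ((\<lambda>x. \<bar>c x\<bar>) ` closure \<Omega>)"
    using c(1) by (intro compact_continuous_image continuous_intros)
  then have bdd: "bdd_above ((\<lambda>x. \<bar>c x\<bar>) ` closure \<Omega>)"
    by (intro bounded_imp_bdd_above compact_imp_bounded)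
  have cM: "\<bar>c x\<bar> \<le> M" if "x \<in> \<Omega>" for x
    using cSUP_upper[OF _ bdd, of x] that closure_subset[of \<Omega>] c(3) by (meson order_trans subsetD)
  have constL: "(\<lambda>x. M) \<in> Lp 2 \<Omega>"
    by (rule Lp2_bounded[OF lmeasurable_dom, of _ M]) (use M in auto)
  have "AE x in lebesgue_on \<Omega>. norm (f x) \<le> norm M"
    using c(2) AE_space by eventually_elim (use cM M in auto)
  then have "nrm f \<le> nrm (\<lambda>x. M)" by (intro L2_norm_mono f constL)
  also have "nrm (\<lambda>x. M) = sqrt (M\<^sup>2 * measure lebesgue \<Omega>)"
    using lebesgue_dom by (simp add: L2_norm_eq L2_inner_def measure_restrict_space power2_eq_square mult.commute)
  also have "\<dots> = M * measure lebesgue \<Omega> powr (1 / 2)"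
    using M by (simp add: real_sqrt_mult powr_half_sqrt)
  finally show ?thesis .
qed

text \<open>
  The linearisation error \<open>F v - F u - G u (v - u)\<close> equals \<open>G u h\<close>, where \<open>h\<close> is the remainder of
  the positive part. Pointwise \<open>h\<close> vanishes unless \<open>F u\<close> and \<open>F v\<close> have different signs, and there
  \<open>|h| = |F v| \<le> |F u - F v|\<close>.
\<close>

lemma linearisation_error:
  assumes u: "u \<in> Lp 2 \<Omega>" and v: "v \<in> Lp 2 \<Omega>"
  obtains h where "h \<in> Lp 2 \<Omega>" "\<And>x. \<bar>h x\<bar> \<le> \<bar>F v x - F u x\<bar>"
    "\<And>x. h x \<noteq> 0 \<Longrightarrow> \<bar>F v x\<bar> \<le> \<bar>F v x - F u x\<bar>"
    "AE x in lebesgue_on \<Omega>. G u h x = F v x - F u x - G u (\<lambda>x. v x - u x) x"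
proof -
  let ?e = "\<lambda>x. v x - u x" and ?z = "\<lambda>x. F v x - F u x"
  let ?h = "\<lambda>x. active u x * ?z x - (max (F v x) 0 - max (F u x) 0)"
  let ?\<omega> = "\<lambda>x. ?z x - G u ?e x"
  have eL: "?e \<in> Lp 2 \<Omega>" and zL: "?z \<in> Lp 2 \<Omega>" by (intro Lp2_diff u v F_Lp2)+
  have hL: "?h \<in> Lp 2 \<Omega>" by (intro Lp2_diff positive_part_Lp2 active_Lp2 F_Lp2 u v)
  have "(\<lambda>x. (?e x - (max (F v x) 0 - max (F u x) 0)) - (?e x - active u x * G u ?e x))
      = (\<lambda>x. ?h x - active u x * ?\<omega> x)" by (auto simp: algebra_simps)
  then have "poisson ?\<omega> (\<lambda>x. ?h x - active u x * ?\<omega> x)"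
    using poisson_diff[OF F_difference_poisson[OF v u] G_poisson[OF u eL]] by simp
  from G_unique[OF u hL this] have "AE x in lebesgue_on \<Omega>. G u ?h x = ?\<omega> x" .
  moreover have "\<bar>?h x\<bar> \<le> \<bar>?z x\<bar>" "?h x \<noteq> 0 \<Longrightarrow> \<bar>F v x\<bar> \<le> \<bar>?z x\<bar>" for x
    by (cases "0 < F u x"; cases "0 < F v x"; simp add: active_def)+
  ultimately show thesis using that[OF hL] by blast
qed

lemma measurable_sublevel:
  assumes "f \<in> Lp 2 \<Omega>" "Measurable.pred borel P"
  shows "{x \<in> \<Omega>. P (f x :: real)} \<in> sets lebesgue"
proof -
  note [measurable] = Lp2_measurable[OF assms(1)] assms(2)
  have "{x \<in> space (lebesgue_on \<Omega>). P (f x)} \<in> sets (lebesgue_on \<Omega>)" by measurable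
  then show ?thesis using lebesgue_dom by (simp add: sets_restrict_space_iff)
qed

lemma lmeasurable_sublevel:
  assumes "f \<in> Lp 2 \<Omega>" "Measurable.pred borel P"
  shows "{x \<in> \<Omega>. P (f x :: real)} \<in> lmeasurable"
  using measurable_sublevel[OF assms] bounded_dom
  by (intro bounded_set_imp_lmeasurable) (auto intro: bounded_subset)

lemma Chebyshev:
  fixes z :: "'a \<Rightarrow> real"
  assumes z: "z \<in> Lp 2 \<Omega>" and "0 < e"
  shows "measure lebesgue {x \<in> \<Omega>. e < \<bar>z x\<bar>} \<le> (nrm z)\<^sup>2 / e\<^sup>2"
proof -
  let ?S = "{x \<in> \<Omega>. e < \<bar>z x\<bar>}"
  have S: "?S \<in> lmeasurable" by (rule lmeasurable_sublevel[OF z]) measurable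
  have Sm: "?S \<in> sets (lebesgue_on \<Omega>)"
    using S lebesgue_dom by (auto simp: sets_restrict_space_iff)
  have "e\<^sup>2 * measure lebesgue ?S = (\<integral>x. e\<^sup>2 * indicator ?S x \<partial>lebesgue_on \<Omega>)"
    using S lebesgue_dom Sm Int_absorb2[of ?S \<Omega>] by (simp add: measure_restrict_space)
  also have "\<dots> \<le> (\<integral>x. z x * z x \<partial>lebesgue_on \<Omega>)"
  proof (intro integral_mono integrable_mult_right integrable_real_indicator Sm Lp2_mult_integrable z)
    show "emeasure (lebesgue_on \<Omega>) ?S < \<infinity>"
      using S lebesgue_dom by (auto simp: emeasure_restrict_space fmeasurable_def)
    fix x
    have "e\<^sup>2 \<le> \<bar>z x\<bar>\<^sup>2" if "e < \<bar>z x\<bar>" using that \<open>0 < e\<close> by (intro power_mono) auto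
    then show "e\<^sup>2 * indicator ?S x \<le> z x * z x" by (auto simp: indicator_def power2_eq_square)
  qed
  also have "\<dots> = (nrm z)\<^sup>2" by (simp add: L2_norm_sq L2_inner_def)
  finally show ?thesis using \<open>0 < e\<close> by (simp add: field_simps)
qed

lemma sublevel_measure_tendsto:
  fixes y :: "'a \<Rightarrow> real"
  assumes y: "y \<in> Lp 2 \<Omega>"
  shows "(\<lambda>n. measure lebesgue {x \<in> \<Omega>. \<bar>y x\<bar> \<le> inverse (real (Suc n))})
    \<longlonglongrightarrow> measure lebesgue {x \<in> \<Omega>. y x = 0}"
proof -
  let ?A = "\<lambda>n. {x \<in> \<Omega>. \<bar>y x\<bar> \<le> inverse (real (Suc n))}"
  have A: "?A n \<in> lmeasurable" for n by (rule lmeasurable_sublevel[OF y]) measurable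
  have "(\<lambda>n. measure lebesgue (?A n)) \<longlonglongrightarrow> measure lebesgue (\<Inter>n. ?A n)"
  proof (rule Lim_measure_decseq)
    show "range ?A \<subseteq> sets lebesgue" using A by auto
    show "decseq ?A"
      by (auto simp: decseq_def intro: order_trans le_imp_inverse_le)
    show "emeasure lebesgue (?A n) \<noteq> \<infinity>" for n using A[of n] by (auto simp: fmeasurable_def)
  qed
  moreover have "(\<Inter>n. ?A n) = {x \<in> \<Omega>. y x = 0}"
  proof (intro set_eqI iffI)
    fix x assume x: "x \<in> (\<Inter>n. ?A n)"
    have "\<bar>y x\<bar> \<le> 0"
      by (rule LIMSEQ_le_const[OF LIMSEQ_inverse_real_of_nat]) (use x in auto)
    then show "x \<in> {x \<in> \<Omega>. y x = 0}" using x by auto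
  qed auto
  ultimately show ?thesis by simp
qed

text \<open>
  Near \<open>v\<close> the tangential cone condition holds with constant \<open>\<mu>\<close>: outside the set where \<open>F v\<close> is
  small, a change of sign forces \<open>F u - F v\<close> to be large, which by Chebyshev's inequality happens
  only on a set of small measure when \<open>u\<close> is close to \<open>v\<close>.
\<close>

proposition tangential_cone:
  assumes v: "v \<in> Lp 2 \<Omega>" and p: "0 < p" "p < 2" and L: "0 < L"
    and L_bound: "\<And>u h. u \<in> Lp 2 \<Omega> \<Longrightarrow> h \<in> Lp p \<Omega> \<Longrightarrow> C_norm_le \<Omega> (G u h) (L * Lp_norm p \<Omega> h)"
    and small: "L * measure lebesgue \<Omega> powr (1 / 2)
      * measure lebesgue {x \<in> \<Omega>. F v x = 0} powr ((2 - p) / (2 * p)) < \<mu>"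
  obtains \<rho> where "0 < \<rho>" "\<And>u. u \<in> Lp 2 \<Omega> \<Longrightarrow> nrm (\<lambda>x. u x - v x) \<le> \<rho> \<Longrightarrow>
    nrm (\<lambda>x. F v x - F u x - G u (\<lambda>x. v x - u x) x) \<le> \<mu> * nrm (\<lambda>x. F v x - F u x)"
proof -
  let ?c = "L * measure lebesgue \<Omega> powr (1 / 2)" and ?q = "(2 - p) / (2 * p)"
  let ?A = "\<lambda>e. {x \<in> \<Omega>. \<bar>F v x\<bar> \<le> e}"
  have q: "?q > 0" using p by simp
  have Fv: "F v \<in> Lp 2 \<Omega>" by (rule F_Lp2[OF v])
  have "(\<lambda>n. measure lebesgue (?A (inverse (real (Suc n)))) + inverse (real (Suc n)))
    \<longlonglongrightarrow> measure lebesgue {x \<in> \<Omega>. F v x = 0} + 0"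
    by (intro tendsto_add sublevel_measure_tendsto Fv LIMSEQ_inverse_real_of_nat)
  then have "(\<lambda>n. ?c * (measure lebesgue (?A (inverse (real (Suc n)))) + inverse (real (Suc n))) powr ?q)
    \<longlonglongrightarrow> ?c * (measure lebesgue {x \<in> \<Omega>. F v x = 0} + 0) powr ?q"
    by (intro tendsto_mult tendsto_const tendsto_powr') (use q in \<open>auto intro!: always_eventually add_nonneg_nonneg\<close>)
  then have "\<forall>\<^sub>F n in sequentially. ?c * (measure lebesgue (?A (inverse (real (Suc n)))) + inverse (real (Suc n))) powr ?q < \<mu>"
    using small by (intro order_tendstoD) auto
  then obtain n where n: "?c * (measure lebesgue (?A (inverse (real (Suc n)))) + inverse (real (Suc n))) powr ?q < \<mu>"
    by (auto simp: eventually_sequentially)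
  define e where "e = inverse (real (Suc n))"
  define s where "s = measure lebesgue (?A e) + e"
  have e: "e > 0" by (simp add: e_def)
  have s: "s > 0" using e by (simp add: s_def add_nonneg_pos)
  have n': "?c * s powr ?q < \<mu>" using n unfolding s_def e_def .
  \<comment> \<open>Then \<open>\<parallel>F v - F u\<parallel> \<le> e\<^sup>3\<^sup>/\<^sup>2\<close>, and Chebyshev's inequality bounds the exceptional set by \<open>e\<close>.\<close>
  define \<rho> where "\<rho> = e * sqrt e / poincare\<^sup>2"
  have \<rho>: "\<rho> > 0" using e poincare(1) by (simp add: \<rho>_def)
  show thesis
  proof (rule that[OF \<rho>])
    fix u assume u: "u \<in> Lp 2 \<Omega>" and near: "nrm (\<lambda>x. u x - v x) \<le> \<rho>"
    let ?z = "\<lambda>x. F v x - F u x"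
    have zL: "?z \<in> Lp 2 \<Omega>" by (intro Lp2_diff F_Lp2 u v)
    obtain h where h: "h \<in> Lp 2 \<Omega>" "\<And>x. \<bar>h x\<bar> \<le> \<bar>?z x\<bar>" "\<And>x. h x \<noteq> 0 \<Longrightarrow> \<bar>F v x\<bar> \<le> \<bar>?z x\<bar>"
      "AE x in lebesgue_on \<Omega>. G u h x = ?z x - G u (\<lambda>x. v x - u x) x"
      by (rule linearisation_error[OF u v]) blast
    let ?S = "{x \<in> \<Omega>. h x \<noteq> 0}" and ?B = "{x \<in> \<Omega>. e < \<bar>?z x\<bar>}"
    have S: "?S \<in> lmeasurable" by (rule lmeasurable_sublevel[OF h(1)]) measurable
    have A: "?A e \<in> lmeasurable" by (rule lmeasurable_sublevel[OF Fv]) measurable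
    have B: "?B \<in> lmeasurable" by (rule lmeasurable_sublevel[OF zL]) measurable
    have "nrm ?z \<le> poincare\<^sup>2 * nrm (\<lambda>x. v x - u x)" by (rule F_estimates(2)[OF v u])
    also have "\<dots> \<le> poincare\<^sup>2 * \<rho>"
      using near L2_norm_diff_commute[of \<Omega> v u] by (intro mult_left_mono) auto
    also have "\<dots> = e * sqrt e" using poincare(1) by (simp add: \<rho>_def)
    finally have "(nrm ?z)\<^sup>2 \<le> (e * sqrt e)\<^sup>2" by (intro power_mono) auto
    then have z2: "(nrm ?z)\<^sup>2 \<le> e\<^sup>2 * e" using e by (simp add: power_mult_distrib)
    have "?S \<subseteq> ?A e \<union> ?B" using h(3) by force
    then have "measure lebesgue ?S \<le> measure lebesgue (?A e \<union> ?B)"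
      using A B S by (intro measure_mono_fmeasurable) auto
    also have "\<dots> \<le> measure lebesgue (?A e) + measure lebesgue ?B"
      using A B by (intro measure_Un_le) auto
    also have "measure lebesgue ?B \<le> (nrm ?z)\<^sup>2 / e\<^sup>2" by (rule Chebyshev[OF zL e])
    also have "\<dots> \<le> e" using z2 e by (simp add: divide_le_eq mult.commute)
    finally have Ss: "measure lebesgue ?S \<le> s" by (simp add: s_def)
    note hp = Lp_norm_le_small_support[OF p Lp2_measurable[OF h(1)] zL h(2) S _ lebesgue_dom _ Ss s]
    have hp1: "h \<in> Lp p \<Omega>" and hp2: "Lp_norm p \<Omega> h \<le> s powr ?q * nrm ?z"
      by (rule hp; auto)+
    have "nrm (\<lambda>x. ?z x - G u (\<lambda>x. v x - u x) x) = nrm (G u h)"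
      by (rule L2_norm_cong_AE[symmetric])
        (intro G_Lp2 Lp2_diff u v h F_Lp2)+
    also have "\<dots> \<le> L * Lp_norm p \<Omega> h * measure lebesgue \<Omega> powr (1 / 2)"
      using L by (intro L2_norm_le_of_C_norm_le L_bound G_Lp2 u h hp1) (auto simp: Lp_norm_def)
    also have "\<dots> = ?c * Lp_norm p \<Omega> h" by simp
    also have "\<dots> \<le> ?c * (s powr ?q * nrm ?z)" using L by (intro mult_left_mono hp2) auto
    also have "\<dots> = ?c * s powr ?q * nrm ?z" by simp
    also have "\<dots> \<le> \<mu> * nrm ?z" using n' by (intro mult_right_mono) auto
    finally show "nrm (\<lambda>x. ?z x - G u (\<lambda>x. v x - u x) x) \<le> \<mu> * nrm ?z" .
  qed
qed

end

section \<open>Convergence of the iteration\<close>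

text \<open>
  If \<open>c < a\<^sub>m (1 + \<Sum>j<m. a\<^sub>j)\<close> for all \<open>m < M\<close>, then \<open>a\<^sub>m\<^sup>2\<close> is at least a constant multiple of
  \<open>1 / (m + 1)\<close>, because partial sums of a square summable sequence are \<open>O(\<surd>m)\<close>; the divergence
  of the harmonic series bounds \<open>M\<close> in terms of \<open>c\<close> and \<open>\<Sum>a\<^sub>j\<^sup>2\<close> only.
\<close>

lemma square_summable_weighted_small:
  fixes c Q :: real
  assumes c: "0 < c" and Q: "0 \<le> Q"
  shows "\<exists>M::nat. \<forall>a. (\<forall>j. 0 \<le> a j) \<longrightarrow> (\<Sum>j<M. (a j)\<^sup>2) \<le> Q \<longrightarrow>
    (\<exists>m<M. a m * (1 + (\<Sum>j<m. a j)) \<le> c)"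
proof -
  define D where "D = c\<^sup>2 / (2 * (1 + Q))"
  have D: "D > 0" using c Q by (simp add: D_def)
  obtain M :: nat where M: "exp (Q / D) < real M" using reals_Archimedean2 by blast
  have M0: "0 < real M" using M exp_gt_zero less_trans by blast
  have "Q / D < ln (real M)" using M by (metis exp_gt_zero exp_less_cancel_iff exp_ln less_trans)
  also have "\<dots> \<le> ln (real M + 1)" using M0 by (intro ln_mono) auto
  also have "\<dots> \<le> harm M" by (rule ln_le_harm)
  finally have "Q < D * harm M" using D by (simp add: divide_less_eq mult.commute)
  also have "harm M = (\<Sum>m<M. inverse (real (Suc m)))"
    unfolding harm_def by (intro sum.reindex_bij_witness[of _ Suc "\<lambda>k. k - 1"]) auto
  finally have big: "Q < (\<Sum>m<M. D * inverse (real (Suc m)))" by (simp add: sum_distrib_left)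
  show ?thesis
  proof (rule exI[of _ M], intro allI impI)
    fix a :: "nat \<Rightarrow> real" assume a: "\<forall>j. 0 \<le> a j" and sq: "(\<Sum>j<M. (a j)\<^sup>2) \<le> Q"
    show "\<exists>m<M. a m * (1 + (\<Sum>j<m. a j)) \<le> c"
    proof (rule ccontr)
      assume "\<not> ?thesis"
      then have gt: "c < a m * (1 + (\<Sum>j<m. a j))" if "m < M" for m using that by force
      have "D * inverse (real (Suc m)) \<le> (a m)\<^sup>2" if m: "m < M" for m
      proof -
        let ?S = "\<Sum>j<m. a j"
        have "?S\<^sup>2 \<le> real m * (\<Sum>j<m. (a j)\<^sup>2)"
          using Cauchy_Schwarz_ineq_sum[of "\<lambda>j. 1" a "{..<m}"] by simp
        also have "\<dots> \<le> real m * Q"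
          using sq sum_mono2[of "{..<M}" "{..<m}" "\<lambda>j. (a j)\<^sup>2"] m
          by (intro mult_left_mono) auto
        finally have S2: "?S\<^sup>2 \<le> real m * Q" .
        have "(1 + ?S)\<^sup>2 \<le> 2 + 2 * ?S\<^sup>2"
          using sum_squares_bound[of 1 ?S] by (simp add: power2_sum)
        also have "\<dots> \<le> 2 + 2 * (real m * Q)" using S2 by simp
        also have "\<dots> \<le> 2 * (1 + Q) * real (Suc m)" using Q by (simp add: algebra_simps)
        finally have S: "(1 + ?S)\<^sup>2 \<le> 2 * (1 + Q) * real (Suc m)" .
        have "c\<^sup>2 \<le> (a m * (1 + ?S))\<^sup>2" using gt[OF m] c by (intro power_mono) auto
        also have "\<dots> = (a m)\<^sup>2 * (1 + ?S)\<^sup>2" by (rule power_mult_distrib)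
        also have "\<dots> \<le> (a m)\<^sup>2 * (2 * (1 + Q) * real (Suc m))" by (intro mult_left_mono S) auto
        finally show ?thesis using Q unfolding D_def
          by (simp add: divide_simps mult_ac del: of_nat_Suc)
      qed
      then have "(\<Sum>m<M. D * inverse (real (Suc m))) \<le> (\<Sum>m<M. (a m)\<^sup>2)" by (intro sum_mono) auto
      then show False using big sq by linarith
    qed
  qed
qed

context bounded_open
begin

lemma nrm_add_scale_sq:
  fixes e g :: "'a \<Rightarrow> real"
  assumes "e \<in> Lp 2 \<Omega>" "g \<in> Lp 2 \<Omega>"
  shows "(nrm (\<lambda>x. e x + c * g x))\<^sup>2 = (nrm e)\<^sup>2 + 2 * c * inn g e + c\<^sup>2 * (nrm g)\<^sup>2"
  unfolding L2_norm_sq using assms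
  by (simp add: L2_inner_add_left L2_inner_add_right L2_inner_scale_left
      L2_inner_scale_right Lp2_add Lp2_scale L2_inner_commute[of \<Omega> e g] power2_eq_square algebra_simps)

text \<open>
  Although the equation is ill-posed, small differences of states force weak smallness of bounded
  differences of controls: against elements of \<open>H10\<close> one may use the equation, and \<open>H10\<close> is dense.
\<close>

lemma weak_stability:
  assumes v: "v \<in> Lp 2 \<Omega>" and k: "k \<in> Lp 2 \<Omega>" and \<rho>: "0 < \<rho>" and \<epsilon>: "0 < \<epsilon>"
  obtains C where "0 \<le> C" "\<And>u. u \<in> Lp 2 \<Omega> \<Longrightarrow> nrm (\<lambda>x. u x - v x) \<le> \<rho> \<Longrightarrow>
    inn k (\<lambda>x. u x - v x) \<le> \<epsilon> + C * nrm (\<lambda>x. F u x - F v x)"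
proof -
  have "\<epsilon> / (2 * \<rho>) > 0" using \<rho> \<epsilon> by simp
  then obtain \<phi> where \<phi>: "\<phi> \<in> test_functions \<Omega>" "nrm (\<lambda>x. k x - \<phi> x) < \<epsilon> / (2 * \<rho>)"
    by (rule test_functions_dense[OF open_dom bounded_dom k])
  have \<phi>H: "\<phi> \<in> H10 \<Omega>" by (rule test_functions_H10[OF \<phi>(1)])
  note \<phi>L = H10_D(1)[OF \<phi>H]
  let ?V = "gnrm \<phi>"
  define C where "C = \<rho> * ?V\<^sup>2 / (2 * \<epsilon>) + nrm \<phi>"
  have "0 \<le> C" using \<rho> \<epsilon> by (simp add: C_def)
  then show thesis
  proof (rule that)
    fix u assume u: "u \<in> Lp 2 \<Omega>" and near: "nrm (\<lambda>x. u x - v x) \<le> \<rho>"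
    let ?e = "\<lambda>x. u x - v x" and ?z = "\<lambda>x. F u x - F v x"
    let ?q = "\<lambda>x. max (F u x) 0 - max (F v x) 0"
    have L: "?e \<in> Lp 2 \<Omega>" "?z \<in> Lp 2 \<Omega>" "?q \<in> Lp 2 \<Omega>" "(\<lambda>x. k x - \<phi> x) \<in> Lp 2 \<Omega>"
      by (intro Lp2_diff positive_part_Lp2 F_Lp2 u v k \<phi>L)+
    note pz = F_difference_poisson[OF u v]
    have "inn k ?e = inn (\<lambda>x. k x - \<phi> x) ?e + inn ?e \<phi>"
      by (simp add: L2_inner_diff_left k \<phi>L L L2_inner_commute[of \<Omega> ?e \<phi>])
    moreover have "inn (\<lambda>x. k x - \<phi> x) ?e \<le> \<epsilon> / 2"
    proof -
      have "inn (\<lambda>x. k x - \<phi> x) ?e \<le> nrm (\<lambda>x. k x - \<phi> x) * nrm ?e" by (intro L2_inner_le L)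
      also have "\<dots> \<le> \<epsilon> / (2 * \<rho>) * \<rho>" using \<phi>(2) near \<rho> \<epsilon> by (intro mult_mono) auto
      finally show ?thesis using \<rho> by simp
    qed
    moreover have "inn ?e \<phi> = energy ?z \<phi> + inn ?q \<phi>"
      using poissonD(4)[OF pz \<phi>H] by (simp add: L2_inner_diff_left[OF L(1,3) \<phi>L])
    moreover have "inn ?q \<phi> \<le> nrm \<phi> * nrm ?z"
    proof -
      have "nrm ?q \<le> nrm ?z" by (intro L2_norm_mono L) (auto simp: max_def)
      then show ?thesis
        using L2_inner_le[OF L(3) \<phi>L] mult_right_mono[of "nrm ?q" "nrm ?z" "nrm \<phi>"]
        by (simp add: mult.commute)
    qed
    moreover have "energy ?z \<phi> \<le> \<epsilon> / 2 + \<rho> * ?V\<^sup>2 / (2 * \<epsilon>) * nrm ?z"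
    proof -
      let ?g = "gnrm ?z"
      have "?g\<^sup>2 \<le> nrm ?e * nrm ?z" by (rule F_estimates(1)[OF u v])
      also have "\<dots> \<le> \<rho> * nrm ?z" using near by (intro mult_right_mono) auto
      finally have g: "?g\<^sup>2 \<le> \<rho> * nrm ?z" .
      have "energy ?z \<phi> \<le> ?g * ?V"
        using energy_le[OF H10_H1[OF poissonD(1)[OF pz]] H10_H1[OF \<phi>H]] by simp
      moreover have "2 * \<epsilon> * (?g * ?V) \<le> \<epsilon>\<^sup>2 + ?g\<^sup>2 * ?V\<^sup>2"
        using sum_squares_bound[of \<epsilon> "?g * ?V"] by (simp add: power_mult_distrib)
      moreover have "?g\<^sup>2 * ?V\<^sup>2 \<le> \<rho> * nrm ?z * ?V\<^sup>2" by (intro mult_right_mono g) auto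
      ultimately have "2 * \<epsilon> * energy ?z \<phi> \<le> \<epsilon>\<^sup>2 + \<rho> * nrm ?z * ?V\<^sup>2"
        using \<epsilon> by (smt (verit) mult_left_mono)
      then show ?thesis using \<epsilon> by (simp add: field_simps power2_eq_square)
    qed
    ultimately show "inn k ?e \<le> \<epsilon> + C * nrm ?z" by (simp add: C_def algebra_simps)
  qed
qed

end

text \<open>
  The bound on \<open>\<Lambda>\<close> controls the quadratic term of a step, which involves the squared norm of \<open>G u\<close>
  on \<open>L\<^sup>2\<close>, and the norm is at most the square of the Poincare constant. The bound on \<open>\<tau>\<close> makes the noise cost at most half of the descent that the
  cone condition provides.
\<close>

locale landweber = bounded_open \<Omega> for \<Omega> :: "'a::euclidean_space set" +
  fixes v u0 :: "'a \<Rightarrow> real" and \<rho> \<mu> l \<Lambda> \<tau> :: real and w :: "nat \<Rightarrow> real"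
  assumes v: "v \<in> Lp 2 \<Omega>" and u0: "u0 \<in> Lp 2 \<Omega>" and \<rho>: "0 < \<rho>" and \<mu>: "0 < \<mu>" "\<mu> < 1"
    and cone: "\<And>u. u \<in> Lp 2 \<Omega> \<Longrightarrow> nrm (\<lambda>x. u x - v x) \<le> \<rho> \<Longrightarrow>
      nrm (\<lambda>x. F v x - F u x - G u (\<lambda>x. v x - u x) x) \<le> \<mu> * nrm (\<lambda>x. F v x - F u x)"
    and start: "nrm (\<lambda>x. u0 x - v x) \<le> \<rho>"
    and l: "0 < l" and w: "\<And>n. l \<le> w n" "\<And>n. w n \<le> \<Lambda>"
    and step_size: "\<Lambda> * poincare ^ 4 \<le> (1 - \<mu>) / 2"
    and \<tau>: "2 * (1 + \<mu>) \<le> \<tau> * (1 - \<mu>)"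
begin

abbreviation U where "U \<equiv> BL_iterate \<Omega> w u0"

definition res where "res y n = nrm (\<lambda>x. y x - F (U y n) x)"
definition err where "err y n = nrm (\<lambda>x. U y n x - v x)"
definition serr where "serr y n = nrm (\<lambda>x. F (U y n) x - F v x)"

lemma nonneg: "0 \<le> res y n" "0 \<le> err y n" "0 \<le> serr y n"
  by (simp_all add: res_def err_def serr_def)

lemma w_pos: "0 < w n" "0 < \<Lambda>"
  using l w[of n] by linarith+

lemma \<tau>_ge: "2 \<le> \<tau>"
proof -
  have "2 * (1 - \<mu>) \<le> 2 * (1 + \<mu>)" using \<mu> by simp
  also note \<tau>
  finally have "2 * (1 - \<mu>) \<le> \<tau> * (1 - \<mu>)" .
  then show ?thesis by (rule mult_right_le_imp_le) (use \<mu> in simp)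
qed

lemma U_Suc: "U y (Suc n) = (\<lambda>x. U y n x + w n * L2_adjoint \<Omega> (G (U y n)) (\<lambda>z. y z - F (U y n) z) x)"
  by (simp add: Let_def)

context
  fixes y :: "'a \<Rightarrow> real"
  assumes y: "y \<in> Lp 2 \<Omega>"
begin

lemma U_Lp2: "U y n \<in> Lp 2 \<Omega>"
proof (induction n)
  case (Suc n)
  have "(\<lambda>z. y z - F (U y n) z) \<in> Lp 2 \<Omega>" by (intro Lp2_diff y F_Lp2 Suc)
  then show ?case unfolding U_Suc by (intro Lp2_add Suc Lp2_scale adjoint_G(1))
qed (simp add: u0)

lemma residual_Lp2: "(\<lambda>z. y z - F (U y n) z) \<in> Lp 2 \<Omega>"
  by (intro Lp2_diff y F_Lp2 U_Lp2)

lemma error_Lp2: "(\<lambda>x. U y n x - v x) \<in> Lp 2 \<Omega>"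
  by (intro Lp2_diff v U_Lp2)

lemma error_Suc_AE:
  "AE x in lebesgue_on \<Omega>. U y (Suc n) x - v x = (U y n x - v x) + w n * G (U y n) (\<lambda>z. y z - F (U y n) z) x"
  using adjoint_G(2)[OF U_Lp2[of n] residual_Lp2[of n]] unfolding U_Suc by eventually_elim simp

lemma error_Suc_Lp2:
  "(\<lambda>x. (U y n x - v x) + w n * G (U y n) (\<lambda>z. y z - F (U y n) z) x) \<in> Lp 2 \<Omega>"
  by (intro Lp2_add error_Lp2 Lp2_scale G_Lp2 U_Lp2 residual_Lp2)

lemma error_inner:
  assumes k: "k \<in> Lp 2 \<Omega>"
  shows "inn (\<lambda>x. U y m x - v x) k = inn (\<lambda>x. u0 x - v x) k
    + (\<Sum>j<m. w j * inn (\<lambda>z. y z - F (U y j) z) (G (U y j) k))"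
proof (induction m)
  case (Suc m)
  let ?R = "\<lambda>z. y z - F (U y m) z"
  have "inn (\<lambda>x. U y (Suc m) x - v x) k = inn (\<lambda>x. (U y m x - v x) + w m * G (U y m) ?R x) k"
    by (intro L2_inner_cong_AE error_Lp2 error_Suc_Lp2 k error_Suc_AE) auto
  also have "\<dots> = inn (\<lambda>x. U y m x - v x) k + w m * inn (G (U y m) ?R) k"
    by (simp add: L2_inner_add_left[OF error_Lp2 Lp2_scale[OF G_Lp2[OF U_Lp2 residual_Lp2]] k] L2_inner_scale_left)
  also have "inn (G (U y m) ?R) k = inn ?R (G (U y m) k)"
    by (rule G_selfadjoint[OF U_Lp2 residual_Lp2 k])
  finally show ?case using Suc by simp
qed simp

text \<open>
  The central estimate. Expanding the iterate in the increments of the iteration, every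
  increment is paired with \<open>G (U y j) (U y m - v)\<close>, which is small as soon as the state at step \<open>m\<close> is
  accurate, whatever \<open>j\<close> is. This replaces continuity of \<open>G\<close> in its base point, which can fail.
\<close>

lemma error_bound:
  "(err y m)\<^sup>2 \<le> inn (\<lambda>x. u0 x - v x) (\<lambda>x. U y m x - v x)
    + \<Lambda> * (1 + poincare\<^sup>2) * serr y m * (\<Sum>j<m. res y j)"
proof -
  let ?e = "\<lambda>x. U y m x - v x" and ?R = "\<lambda>j z. y z - F (U y j) z"
  have "w j * inn (?R j) (G (U y j) ?e) \<le> \<Lambda> * (1 + poincare\<^sup>2) * serr y m * res y j" for j
  proof -
    have "inn (?R j) (G (U y j) ?e) \<le> res y j * nrm (G (U y j) ?e)"
      unfolding res_def by (intro L2_inner_le residual_Lp2 G_Lp2 U_Lp2 error_Lp2)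
    also have "\<dots> \<le> res y j * ((1 + poincare\<^sup>2) * serr y m)"
      unfolding serr_def by (intro mult_left_mono G_le_state_difference U_Lp2 v nonneg)
    finally have "w j * inn (?R j) (G (U y j) ?e) \<le> w j * (res y j * ((1 + poincare\<^sup>2) * serr y m))"
      using w_pos(1)[of j] by (intro mult_left_mono) auto
    also have "\<dots> \<le> \<Lambda> * (res y j * ((1 + poincare\<^sup>2) * serr y m))"
      using w(2)[of j] nonneg by (intro mult_right_mono) auto
    finally show ?thesis by (simp add: mult_ac)
  qed
  then have "(\<Sum>j<m. w j * inn (?R j) (G (U y j) ?e)) \<le> (\<Sum>j<m. \<Lambda> * (1 + poincare\<^sup>2) * serr y m * res y j)"
    by (intro sum_mono)
  then show ?thesis
    using error_inner[OF error_Lp2, of m m] by (simp add: err_def L2_norm_sq sum_distrib_left)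
qed

lemma error_Suc:
  "(err y (Suc n))\<^sup>2 = (err y n)\<^sup>2
    - 2 * w n * inn (\<lambda>z. y z - F (U y n) z) (G (U y n) (\<lambda>x. v x - U y n x))
    + (w n)\<^sup>2 * (nrm (G (U y n) (\<lambda>z. y z - F (U y n) z)))\<^sup>2"
proof -
  let ?e = "\<lambda>x. U y n x - v x" and ?R = "\<lambda>z. y z - F (U y n) z"
  let ?g = "G (U y n) ?R"
  have eL: "?e \<in> Lp 2 \<Omega>" by (rule error_Lp2)
  have gL: "?g \<in> Lp 2 \<Omega>" by (intro G_Lp2 U_Lp2 residual_Lp2)
  have "err y (Suc n) = nrm (\<lambda>x. ?e x + w n * ?g x)"
    unfolding err_def by (intro L2_norm_cong_AE error_Lp2 error_Suc_Lp2 error_Suc_AE)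
  then have "(err y (Suc n))\<^sup>2 = (err y n)\<^sup>2 + 2 * w n * inn ?g ?e + (w n)\<^sup>2 * (nrm ?g)\<^sup>2"
    by (simp only: nrm_add_scale_sq[OF eL gL] err_def)
  moreover have "inn ?g ?e = - inn ?g (\<lambda>x. v x - U y n x)"
    by (simp add: L2_inner_diff_right gL v U_Lp2)
  moreover have "inn ?g (\<lambda>x. v x - U y n x) = inn ?R (G (U y n) (\<lambda>x. v x - U y n x))"
    by (intro G_selfadjoint U_Lp2 residual_Lp2 Lp2_diff v)
  ultimately show ?thesis by simp
qed

context
  fixes \<delta> :: real
  assumes noise: "nrm (\<lambda>x. y x - F v x) \<le> \<delta>"
begin

lemma \<delta>_nonneg: "0 \<le> \<delta>"
  using noise L2_norm_nonneg order_trans by blast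

lemma serr_le: "serr y n \<le> res y n + \<delta>"
proof -
  have "serr y n = nrm (\<lambda>x. F v x - F (U y n) x)" unfolding serr_def by (rule L2_norm_diff_commute)
  also have "\<dots> \<le> nrm (\<lambda>x. F v x - y x) + res y n"
    unfolding res_def by (intro L2_norm_triangle3 F_Lp2 v y U_Lp2)
  also have "nrm (\<lambda>x. F v x - y x) = nrm (\<lambda>x. y x - F v x)" by (rule L2_norm_diff_commute)
  finally show ?thesis using noise by simp
qed

text \<open>
  By the cone condition \<open>G u\<^sub>n (v - u\<^sub>n)\<close> is the residual up to an error of at most \<open>\<mu>\<close> times its norm and
  up to noise, so a step along \<open>G u\<^sub>n r\<^sub>n\<close> points towards \<open>v\<close>. As long as the discrepancy
  principle is not met, the noise is dominated by the residual.
\<close>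

lemma descent:
  assumes near: "err y n \<le> \<rho>" and unmet: "\<tau> * \<delta> < res y n"
  shows "(err y (Suc n))\<^sup>2 + l * (1 - \<mu>) / 2 * (res y n)\<^sup>2 \<le> (err y n)\<^sup>2"
proof -
  let ?R = "\<lambda>z. y z - F (U y n) z" and ?d = "\<lambda>x. v x - U y n x"
  let ?q = "G (U y n) ?d" and ?z = "\<lambda>x. F v x - F (U y n) x"
  let ?\<omega> = "\<lambda>x. ?z x - ?q x"
  let ?a = "res y n"
  have qL: "?q \<in> Lp 2 \<Omega>" by (intro G_Lp2 U_Lp2 Lp2_diff v)
  have zL: "?z \<in> Lp 2 \<Omega>" by (intro Lp2_diff F_Lp2 v U_Lp2)
  have \<omega>L: "?\<omega> \<in> Lp 2 \<Omega>" by (intro Lp2_diff zL qL)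
  have nL: "(\<lambda>x. y x - F v x) \<in> Lp 2 \<Omega>" by (intro Lp2_diff F_Lp2 v y)
  have z_le: "nrm ?z \<le> ?a + \<delta>"
    using serr_le[of n] unfolding serr_def by (simp add: L2_norm_diff_commute[of \<Omega> "F v"])
  have "nrm ?\<omega> \<le> \<mu> * nrm ?z" using near by (intro cone U_Lp2) (simp add: err_def)
  also have "\<dots> \<le> \<mu> * (?a + \<delta>)" using \<mu> z_le by (intro mult_left_mono) auto
  finally have \<omega>_le: "nrm ?\<omega> \<le> \<mu> * (?a + \<delta>)" .
  have "?q = (\<lambda>x. (?R x - (y x - F v x)) - ?\<omega> x)" by auto
  then have "inn ?R ?q = inn ?R (\<lambda>x. (?R x - (y x - F v x)) - ?\<omega> x)" by simp
  also have "\<dots> = inn ?R (\<lambda>x. ?R x - (y x - F v x)) - inn ?R ?\<omega>"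
    by (intro L2_inner_diff_right Lp2_diff[OF residual_Lp2 nL] \<omega>L residual_Lp2)
  also have "inn ?R (\<lambda>x. ?R x - (y x - F v x)) = inn ?R ?R - inn ?R (\<lambda>x. y x - F v x)"
    by (intro L2_inner_diff_right residual_Lp2 nL)
  finally have "inn ?R ?q = ?a\<^sup>2 - inn ?R (\<lambda>x. y x - F v x) - inn ?R ?\<omega>"
    by (simp add: res_def L2_norm_sq)
  moreover have "inn ?R (\<lambda>x. y x - F v x) \<le> ?a * \<delta>"
    using L2_inner_le[OF residual_Lp2[of n] nL] mult_left_mono[OF noise nonneg(1)[of y n]]
    unfolding res_def by linarith
  moreover have "inn ?R ?\<omega> \<le> ?a * (\<mu> * (?a + \<delta>))"
    using L2_inner_le[OF residual_Lp2[of n] \<omega>L] mult_left_mono[OF \<omega>_le nonneg(1)[of y n]]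
    unfolding res_def by linarith
  ultimately have "(1 - \<mu>) * ?a\<^sup>2 - (1 + \<mu>) * \<delta> * ?a \<le> inn ?R ?q"
    by (simp add: algebra_simps power2_eq_square)
  moreover have "(1 + \<mu>) * \<delta> * ?a \<le> (1 - \<mu>) / 2 * ?a\<^sup>2"
  proof -
    have "2 * (1 + \<mu>) * \<delta> \<le> \<tau> * (1 - \<mu>) * \<delta>" by (intro mult_right_mono \<tau> \<delta>_nonneg)
    also have "\<dots> \<le> (1 - \<mu>) * ?a" using mult_left_mono[of "\<tau> * \<delta>" ?a "1 - \<mu>"] unmet \<mu> by (simp add: mult_ac)
    finally have "2 * (1 + \<mu>) * \<delta> * ?a \<le> (1 - \<mu>) * ?a * ?a" by (intro mult_right_mono nonneg)
    then show ?thesis by (simp add: power2_eq_square field_simps)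
  qed
  ultimately have "(1 - \<mu>) * ?a\<^sup>2 \<le> 2 * inn ?R ?q" by (simp add: field_simps)
  then have "w n * ((1 - \<mu>) * ?a\<^sup>2) \<le> w n * (2 * inn ?R ?q)"
    using w_pos(1)[of n] by (intro mult_left_mono) auto
  moreover have "(w n)\<^sup>2 * (nrm (G (U y n) ?R))\<^sup>2 \<le> w n * ((1 - \<mu>) / 2 * ?a\<^sup>2)"
  proof -
    have "nrm (G (U y n) ?R) \<le> poincare\<^sup>2 * ?a" unfolding res_def by (intro G_bound U_Lp2 residual_Lp2)
    then have "(nrm (G (U y n) ?R))\<^sup>2 \<le> (poincare\<^sup>2 * ?a)\<^sup>2" by (intro power_mono) auto
    also have "\<dots> = poincare ^ 4 * ?a\<^sup>2" by (simp add: power_mult_distrib flip: power_mult)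
    finally have "(w n)\<^sup>2 * (nrm (G (U y n) ?R))\<^sup>2 \<le> (w n)\<^sup>2 * (poincare ^ 4 * ?a\<^sup>2)"
      by (intro mult_left_mono) auto
    also have "\<dots> = w n * ((w n * poincare ^ 4) * ?a\<^sup>2)" by (simp add: power2_eq_square mult_ac)
    also have "\<dots> \<le> w n * ((\<Lambda> * poincare ^ 4) * ?a\<^sup>2)"
      using w_pos(1)[of n] w(2)[of n] by (intro mult_left_mono mult_right_mono) auto
    also have "\<dots> \<le> w n * ((1 - \<mu>) / 2 * ?a\<^sup>2)"
      using w_pos(1)[of n] step_size by (intro mult_left_mono mult_right_mono) auto
    finally show ?thesis .
  qed
  moreover have "l * ((1 - \<mu>) / 2 * ?a\<^sup>2) \<le> w n * ((1 - \<mu>) / 2 * ?a\<^sup>2)"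
    using w(1)[of n] \<mu> by (intro mult_right_mono) auto
  moreover have "w n * ((1 - \<mu>) / 2 * ?a\<^sup>2) + w n * ((1 - \<mu>) / 2 * ?a\<^sup>2) = w n * ((1 - \<mu>) * ?a\<^sup>2)"
    by (simp flip: distrib_left distrib_right)
  moreover have "l * (1 - \<mu>) / 2 * ?a\<^sup>2 = l * ((1 - \<mu>) / 2 * ?a\<^sup>2)" by simp
  moreover have "w n * (2 * inn ?R ?q) = 2 * w n * inn ?R ?q" by simp
  ultimately show ?thesis unfolding error_Suc by linarith
qed

lemma before_stopping:
  assumes "\<And>j. j < n \<Longrightarrow> \<tau> * \<delta> < res y j"
  shows "(err y n)\<^sup>2 + l * (1 - \<mu>) / 2 * (\<Sum>j<n. (res y j)\<^sup>2) \<le> \<rho>\<^sup>2" "err y n \<le> \<rho>"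
    "m \<le> n \<Longrightarrow> err y n \<le> err y m"
proof -
  have \<kappa>: "0 \<le> l * (1 - \<mu>) / 2" using l \<mu> by simp
  have "(err y n)\<^sup>2 + l * (1 - \<mu>) / 2 * (\<Sum>j<n. (res y j)\<^sup>2) \<le> \<rho>\<^sup>2 \<and> err y n \<le> \<rho> \<and>
      (\<forall>m\<le>n. err y n \<le> err y m)"
    using assms
  proof (induction n)
    case 0
    then show ?case using start by (simp add: err_def power_mono)
  next
    case (Suc n)
    have IH: "(err y n)\<^sup>2 + l * (1 - \<mu>) / 2 * (\<Sum>j<n. (res y j)\<^sup>2) \<le> \<rho>\<^sup>2"
      "err y n \<le> \<rho>" "\<And>m. m \<le> n \<Longrightarrow> err y n \<le> err y m" using Suc by auto
    have d: "(err y (Suc n))\<^sup>2 + l * (1 - \<mu>) / 2 * (res y n)\<^sup>2 \<le> (err y n)\<^sup>2"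
      using Suc.prems[of n] by (intro descent IH) auto
    have "0 \<le> l * (1 - \<mu>) / 2 * (res y n)\<^sup>2" by (intro mult_nonneg_nonneg \<kappa>) auto
    then have "(err y (Suc n))\<^sup>2 \<le> (err y n)\<^sup>2" using d by linarith
    then have le: "err y (Suc n) \<le> err y n" by (rule power2_le_imp_le) (rule nonneg)
    then have "\<forall>m\<le>Suc n. err y (Suc n) \<le> err y m"
      using IH(3) by (auto simp: le_Suc_eq intro: order_trans)
    moreover have "err y (Suc n) \<le> \<rho>" using le IH(2) by (rule order_trans)
    ultimately show ?case using IH(1) d by (simp add: algebra_simps)
  qed
  then show "(err y n)\<^sup>2 + l * (1 - \<mu>) / 2 * (\<Sum>j<n. (res y j)\<^sup>2) \<le> \<rho>\<^sup>2" "err y n \<le> \<rho>"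
    "m \<le> n \<Longrightarrow> err y n \<le> err y m" by auto
qed

lemma residuals_square_summable:
  assumes "\<And>j. j < n \<Longrightarrow> \<tau> * \<delta> < res y j"
  shows "(\<Sum>j<n. (res y j)\<^sup>2) \<le> \<rho>\<^sup>2 / (l * (1 - \<mu>) / 2)"
proof -
  have "l * (1 - \<mu>) / 2 * (\<Sum>j<n. (res y j)\<^sup>2) \<le> \<rho>\<^sup>2"
    using before_stopping(1)[of n, OF assms] zero_le_power2[of "err y n"] by linarith
  moreover have "0 < l * (1 - \<mu>) / 2" using l \<mu> by simp
  ultimately show ?thesis by (simp add: pos_le_divide_eq mult.commute)
qed

lemma stops:
  assumes "0 < \<delta>"
  shows "\<exists>n. res y n \<le> \<tau> * \<delta>"
proof (rule ccontr)
  assume "\<not> ?thesis"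
  then have unmet: "\<tau> * \<delta> < res y n" for n by (meson not_le)
  have pos: "0 < (\<tau> * \<delta>)\<^sup>2" using \<tau>_ge assms by simp
  obtain n :: nat where n: "\<rho>\<^sup>2 / (l * (1 - \<mu>) / 2) < real n * (\<tau> * \<delta>)\<^sup>2"
    using ex_less_of_nat_mult[OF pos] by blast
  have "(\<Sum>j<n. (\<tau> * \<delta>)\<^sup>2) \<le> (\<Sum>j<n. (res y j)\<^sup>2)"
    using \<tau>_ge assms by (intro sum_mono power_mono less_imp_le[OF unmet]) auto
  then show False using residuals_square_summable[OF unmet, of n] n by simp
qed

end

end

text \<open>
  The error is below \<open>\<epsilon>\<close> at any step that is reached before stopping and that is either late or the
  stopping step itself, for all data with noise level at most \<open>d\<close>. Exact data are the case \<open>\<delta> = 0\<close>.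
\<close>

definition accurate :: "real \<Rightarrow> nat \<Rightarrow> real \<Rightarrow> bool" where
  "accurate \<epsilon> M d \<longleftrightarrow> (\<forall>\<delta> y n. y \<in> Lp 2 \<Omega> \<longrightarrow> nrm (\<lambda>x. y x - F v x) \<le> \<delta> \<longrightarrow> \<delta> \<le> d \<longrightarrow>
    (\<forall>j<n. \<tau> * \<delta> < res y j) \<longrightarrow> M \<le> n \<or> res y n \<le> \<tau> * \<delta> \<longrightarrow> err y n < \<epsilon>)"

text \<open>
  Both the number \<open>M\<close> of steps and the noise level \<open>d\<close> are uniform in the data. If the iteration
  runs for at least \<open>M\<close> steps, some earlier step is good enough, and errors decrease until the
  iteration stops; otherwise only boundedly many steps were made and the discrepancy at
  the stopping index is of the order of the noise.
\<close>

lemma uniform_convergence: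
  assumes \<epsilon>: "0 < \<epsilon>"
  obtains M :: nat and d where "0 < d" "accurate \<epsilon> M d"
proof -
  define \<eta> where "\<eta> = \<epsilon>\<^sup>2 / 4"
  have \<eta>: "0 < \<eta>" using \<epsilon> by (simp add: \<eta>_def)
  have e0L: "(\<lambda>x. u0 x - v x) \<in> Lp 2 \<Omega>" by (intro Lp2_diff u0 v)
  obtain C' where C': "0 \<le> C'" "\<And>u. u \<in> Lp 2 \<Omega> \<Longrightarrow> nrm (\<lambda>x. u x - v x) \<le> \<rho> \<Longrightarrow>
    inn (\<lambda>x. u0 x - v x) (\<lambda>x. u x - v x) \<le> \<eta> + C' * nrm (\<lambda>x. F u x - F v x)"
    by (rule weak_stability[OF v e0L \<rho> \<eta>]) blast
  define K where "K = \<Lambda> * (1 + poincare\<^sup>2)"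
  have K: "0 < K" using w_pos(2) by (simp add: K_def add_pos_nonneg)
  define C where "C = C' + K"
  have C: "0 < C" "C' \<le> C" "K \<le> C" using C'(1) K by (auto simp: C_def)
  have key: "(err y m)\<^sup>2 \<le> \<eta> + C * (serr y m * (1 + (\<Sum>j<m. res y j)))"
    if y: "y \<in> Lp 2 \<Omega>" and near: "err y m \<le> \<rho>" for y m
  proof -
    let ?S = "\<Sum>j<m. res y j"
    have S: "0 \<le> ?S" by (intro sum_nonneg nonneg)
    have "(err y m)\<^sup>2 \<le> \<eta> + C' * serr y m + K * serr y m * ?S"
      using error_bound[OF y, of m] C'(2)[OF U_Lp2[OF y], of m] near
      by (simp add: err_def serr_def K_def)
    also have "C' * serr y m \<le> C * serr y m" by (intro mult_right_mono C nonneg)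
    also have "K * serr y m * ?S \<le> C * serr y m * ?S" by (intro mult_right_mono C nonneg S)
    finally show ?thesis by (simp add: algebra_simps)
  qed
  define Q where "Q = \<rho>\<^sup>2 / (l * (1 - \<mu>) / 2)"
  have Q: "0 \<le> Q" using l \<mu> by (simp add: Q_def)
  have "0 < \<eta> / (2 * C)" using \<eta> C by simp
  obtain M :: nat where M: "\<forall>a. (\<forall>j. 0 \<le> a j) \<longrightarrow> (\<Sum>j<M. (a j)\<^sup>2) \<le> Q \<longrightarrow>
    (\<exists>m<M. a m * (1 + (\<Sum>j<m. a j)) \<le> \<eta> / (2 * C))"
    using square_summable_weighted_small[OF \<open>0 < \<eta> / (2 * C)\<close> Q] ..
  define B where "B = C * ((\<tau> + 1) * (1 + (real M + Q)))"
  have B: "0 < B" using C \<tau>_ge Q by (simp add: B_def add_pos_nonneg)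
  show thesis
  proof (rule that; (unfold accurate_def, intro allI impI)?)
    show "0 < \<eta> / B" using \<eta> B by simp
  next
    fix \<delta> y n
    assume y: "y \<in> Lp 2 \<Omega>" and noise: "nrm (\<lambda>x. y x - F v x) \<le> \<delta>" and \<delta>: "\<delta> \<le> \<eta> / B"
      and unmet': "\<forall>j<n. \<tau> * \<delta> < res y j" and stop: "M \<le> n \<or> res y n \<le> \<tau> * \<delta>"
    have unmet: "\<tau> * \<delta> < res y j" if "j < n" for j using unmet' that by blast
    note \<delta>0 = \<delta>_nonneg[OF y noise]
    note near = before_stopping(2)[OF y noise] and mono = before_stopping(3)[OF y noise]
    note sq = residuals_square_summable[OF y noise, folded Q_def]
    have "(err y n)\<^sup>2 \<le> \<eta> + \<eta>"
    proof (cases "M \<le> n")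
      case True
      have "(\<Sum>j<M. (res y j)\<^sup>2) \<le> Q" using True by (intro sq unmet) simp
      then obtain m where m: "m < M" "res y m * (1 + (\<Sum>j<m. res y j)) \<le> \<eta> / (2 * C)"
        using M[rule_format, of "res y"] nonneg(1)[of y] by blast
      have S: "0 \<le> (\<Sum>j<m. res y j)" by (intro sum_nonneg nonneg)
      have "m < n" using m True by simp
      have "\<delta> \<le> \<tau> * \<delta>" using mult_right_mono[OF _ \<delta>0, of 1 \<tau>] \<tau>_ge by simp
      then have "serr y m \<le> 2 * res y m"
        using serr_le[OF y noise, of m] unmet[OF \<open>m < n\<close>] by linarith
      then have "serr y m * (1 + (\<Sum>j<m. res y j)) \<le> 2 * res y m * (1 + (\<Sum>j<m. res y j))"
        using S by (intro mult_right_mono) auto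
      also have "\<dots> \<le> \<eta> / C" using m(2) C by (simp add: field_simps)
      finally have "C * (serr y m * (1 + (\<Sum>j<m. res y j))) \<le> \<eta>"
        using C by (simp add: pos_le_divide_eq mult.commute)
      moreover have "err y m \<le> \<rho>" using \<open>m < n\<close> unmet by (intro near) auto
      ultimately have "(err y m)\<^sup>2 \<le> \<eta> + \<eta>" using key[OF y, of m] by linarith
      moreover have "err y n \<le> err y m" using \<open>m < n\<close> unmet by (intro mono) auto
      ultimately show ?thesis using power_mono[OF _ nonneg(2), of y n "err y m" 2] by linarith
    next
      case False
      then have "res y n \<le> \<tau> * \<delta>" using stop by simp
      then have z: "serr y n \<le> (\<tau> + 1) * \<delta>" using serr_le[OF y noise, of n] by (simp add: algebra_simps)
      have "res y j \<le> 1 + (res y j)\<^sup>2" for j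
        using sum_squares_bound[of 1 "res y j"] nonneg(1)[of y j] by simp
      then have "(\<Sum>j<n. res y j) \<le> (\<Sum>j<n. 1 + (res y j)\<^sup>2)" by (intro sum_mono)
      also have "\<dots> = real n + (\<Sum>j<n. (res y j)\<^sup>2)" by (simp add: sum.distrib)
      also have "\<dots> \<le> real M + Q" using False by (intro add_mono sq unmet) auto
      finally have S: "(\<Sum>j<n. res y j) \<le> real M + Q" .
      have "serr y n * (1 + (\<Sum>j<n. res y j)) \<le> ((\<tau> + 1) * \<delta>) * (1 + (real M + Q))"
        using z S \<delta>0 \<tau>_ge by (intro mult_mono) (auto intro!: add_nonneg_nonneg sum_nonneg nonneg)
      then have "C * (serr y n * (1 + (\<Sum>j<n. res y j))) \<le> C * (((\<tau> + 1) * \<delta>) * (1 + (real M + Q)))"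
        using C by (intro mult_left_mono) auto
      also have "\<dots> = B * \<delta>" by (simp add: B_def)
      also have "\<dots> \<le> \<eta>" using \<delta> B by (simp add: pos_le_divide_eq mult.commute)
      finally show ?thesis using key[OF y near[of n, OF unmet]] by linarith
    qed
    also have "\<dots> < \<epsilon>\<^sup>2" using \<epsilon> by (simp add: \<eta>_def)
    finally show "err y n < \<epsilon>" using \<epsilon> by (intro power_less_imp_less_base[of "err y n" 2 \<epsilon>]) auto
  qed
qed

lemma discrepancy_met_iff: "discrepancy_met \<Omega> \<tau> w u0 \<delta> y n \<longleftrightarrow> res y n \<le> \<tau> * \<delta>"
  by (simp add: discrepancy_met_def res_def)

lemma stopping_index_props:
  assumes "\<exists>n. discrepancy_met \<Omega> \<tau> w u0 \<delta> y n"
  defines "N \<equiv> stopping_index \<Omega> \<tau> w u0 \<delta> y"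
  shows "res y N \<le> \<tau> * \<delta>" "j < N \<Longrightarrow> \<tau> * \<delta> < res y j"
proof -
  show "res y N \<le> \<tau> * \<delta>"
    using LeastI_ex[OF assms(1)] by (simp add: N_def stopping_index_def discrepancy_met_iff)
  show "\<tau> * \<delta> < res y j" if "j < N"
    using not_less_Least[OF that[unfolded N_def stopping_index_def]]
    by (simp add: discrepancy_met_iff not_le)
qed

proposition finite_stopping:
  assumes "0 < \<delta>" "y \<in> Lp 2 \<Omega>" "nrm (\<lambda>x. y x - F v x) \<le> \<delta>"
  shows "\<exists>n. discrepancy_met \<Omega> \<tau> w u0 \<delta> y n"
  using stops[OF assms(2,3,1)] by (simp add: discrepancy_met_iff)

proposition exact_data:
  "((\<exists>n. discrepancy_met \<Omega> \<tau> w u0 0 (F v) n) \<and>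
      (AE x in lebesgue_on \<Omega>. U (F v) (stopping_index \<Omega> \<tau> w u0 0 (F v)) x = v x)) \<or>
   ((\<nexists>n. discrepancy_met \<Omega> \<tau> w u0 0 (F v) n) \<and>
      (\<lambda>n. nrm (\<lambda>x. U (F v) n x - v x)) \<longlonglongrightarrow> 0)"
proof -
  have y: "F v \<in> Lp 2 \<Omega>" by (rule F_Lp2[OF v])
  have noise: "nrm (\<lambda>x. F v x - F v x) \<le> 0" by simp
  show ?thesis
  proof (cases "\<exists>n. discrepancy_met \<Omega> \<tau> w u0 0 (F v) n")
    case True
    let ?N = "stopping_index \<Omega> \<tau> w u0 0 (F v)"
    have "err (F v) ?N < \<epsilon>" if \<epsilon>: "0 < \<epsilon>" for \<epsilon>
    proof -
      obtain M d where "0 < d" and *: "accurate \<epsilon> M d"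
        by (rule uniform_convergence[OF \<epsilon>])
      show ?thesis
        using *[unfolded accurate_def] y noise less_imp_le[OF \<open>0 < d\<close>] stopping_index_props[OF True] by blast
    qed
    then have "err (F v) ?N = 0" using nonneg(2)[of "F v" ?N] by (metis less_irrefl less_eq_real_def)
    then have "AE x in lebesgue_on \<Omega>. U (F v) ?N x - v x = 0"
      unfolding err_def by (intro L2_norm_eq_0_AE error_Lp2[OF y])
    then show ?thesis using True by simp
  next
    case False
    then have unmet: "\<tau> * 0 < res (F v) n" for n by (simp add: discrepancy_met_iff not_le)
    have "(\<lambda>n. err (F v) n) \<longlonglongrightarrow> 0"
    proof (rule LIMSEQ_I)
      fix \<epsilon> :: real assume \<epsilon>: "0 < \<epsilon>"
      obtain M d where "0 < d" and *: "accurate \<epsilon> M d"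
        by (rule uniform_convergence[OF \<epsilon>])
      have "err (F v) n < \<epsilon>" if "M \<le> n" for n
        using *[unfolded accurate_def] y noise less_imp_le[OF \<open>0 < d\<close>] unmet that by blast
      then show "\<exists>no. \<forall>n\<ge>no. norm (err (F v) n - 0) < \<epsilon>" using nonneg(2) by auto
    qed
    then show ?thesis using False by (simp add: err_def)
  qed
qed

proposition regularization:
  assumes \<delta>: "\<And>k. 0 < \<delta> k" "\<delta> \<longlonglongrightarrow> 0"
    and y: "\<And>k. y k \<in> Lp 2 \<Omega>" "\<And>k. nrm (\<lambda>x. y k x - F v x) \<le> \<delta> k"
  shows "(\<lambda>k. nrm (\<lambda>x. U (y k) (stopping_index \<Omega> \<tau> w u0 (\<delta> k) (y k)) x - v x)) \<longlonglongrightarrow> 0"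
proof -
  let ?N = "\<lambda>k. stopping_index \<Omega> \<tau> w u0 (\<delta> k) (y k)"
  have "(\<lambda>k. err (y k) (?N k)) \<longlonglongrightarrow> 0"
  proof (rule LIMSEQ_I)
    fix \<epsilon> :: real assume \<epsilon>: "0 < \<epsilon>"
    obtain M d where "0 < d" and *: "accurate \<epsilon> M d"
        by (rule uniform_convergence[OF \<epsilon>])
    obtain k0 where k0: "\<And>k. k \<ge> k0 \<Longrightarrow> \<delta> k < d"
      using order_tendstoD(2)[OF \<delta>(2) \<open>0 < d\<close>] by (auto simp: eventually_sequentially)
    have "err (y k) (?N k) < \<epsilon>" if "k \<ge> k0" for k
      using *[unfolded accurate_def] y less_imp_le[OF k0[OF that]] stopping_index_props[OF finite_stopping[OF \<delta>(1) y]] by blast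
    then show "\<exists>no. \<forall>k\<ge>no. norm (err (y k) (?N k) - 0) < \<epsilon>" using nonneg(2) by auto
  qed
  then show ?thesis by (simp add: err_def)
qed

end

section \<open>The regularization property\<close>

theorem corollary3p11:
  fixes \<Omega> :: "'a::euclidean_space set"
    and udag ydag :: "'a \<Rightarrow> real"
    and p p' \<mu> L_p :: real
  assumes dim: "DIM('a) \<in> {2, 3}"
    and dom: "bounded_lipschitz_domain \<Omega>"
    and udag: "udag \<in> Lp 2 \<Omega>"
    and ydag: "ydag = F_op \<Omega> udag"
    and p: "real DIM('a) / 2 < p" "p < 2"
    and p': "p' = 2 * p / (2 - p)"
    and L_p_pos: "0 < L_p"
    and L_p: "\<forall>u\<in>Lp 2 \<Omega>. \<forall>h\<in>Lp p \<Omega>. C_norm_le \<Omega> (G_op \<Omega> u h) (L_p * Lp_norm p \<Omega> h)"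
    and \<mu>: "0 < \<mu>" "\<mu> < 1"
    and small: "L_p * measure lebesgue \<Omega> powr (1 / 2)
      * (2 * measure lebesgue {x \<in> \<Omega>. F_op \<Omega> udag x = 0}) powr (1 / p') < \<mu>"
  shows "\<exists>\<rho>>0. \<exists>l \<Lambda> \<tau>. 0 < l \<and> l \<le> \<Lambda> \<and> 1 < \<tau> \<and>
    (\<forall>u0\<in>Lp 2 \<Omega>. \<forall>w.
       Lp_norm 2 \<Omega> (\<lambda>x. u0 x - udag x) \<le> \<rho> \<and> (\<forall>n. l \<le> w n \<and> w n \<le> \<Lambda>) \<longrightarrow>
       (\<forall>\<delta>>0. \<forall>y\<in>Lp 2 \<Omega>. Lp_norm 2 \<Omega> (\<lambda>x. y x - ydag x) \<le> \<delta> \<longrightarrow>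
          (\<exists>n. discrepancy_met \<Omega> \<tau> w u0 \<delta> y n)) \<and>
       (((\<exists>n. discrepancy_met \<Omega> \<tau> w u0 0 ydag n) \<and>
           (AE x in lebesgue_on \<Omega>.
              BL_iterate \<Omega> w u0 ydag (stopping_index \<Omega> \<tau> w u0 0 ydag) x = udag x)) \<or>
        ((\<nexists>n. discrepancy_met \<Omega> \<tau> w u0 0 ydag n) \<and>
           (\<lambda>n. Lp_norm 2 \<Omega> (\<lambda>x. BL_iterate \<Omega> w u0 ydag n x - udag x)) \<longlonglongrightarrow> 0)) \<and>
       (\<forall>\<delta> y. (\<forall>k. \<delta> k > 0) \<and> \<delta> \<longlonglongrightarrow> 0 \<and>
          (\<forall>k. y k \<in> Lp 2 \<Omega> \<and> Lp_norm 2 \<Omega> (\<lambda>x. y k x - ydag x) \<le> \<delta> k) \<longrightarrow>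
          (\<lambda>k. Lp_norm 2 \<Omega> (\<lambda>x.
             BL_iterate \<Omega> w u0 (y k) (stopping_index \<Omega> \<tau> w u0 (\<delta> k) (y k)) x - udag x))
            \<longlonglongrightarrow> 0))"
proof -
  interpret bounded_open \<Omega>
    using dom by unfold_locales (auto simp: bounded_lipschitz_domain_def)
  have p0: "0 < p" using p(1) dim by auto
  let ?Z = "{x \<in> \<Omega>. F_op \<Omega> udag x = 0}"
  have exponent: "1 / p' = (2 - p) / (2 * p)" using p' p0 p(2) by simp
  have "measure lebesgue ?Z powr (1 / p') \<le> (2 * measure lebesgue ?Z) powr (1 / p')"
    unfolding exponent using p0 p(2) by (intro powr_mono2) auto
  then have "L_p * measure lebesgue \<Omega> powr (1 / 2) * measure lebesgue ?Z powr (1 / p')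
      \<le> L_p * measure lebesgue \<Omega> powr (1 / 2) * (2 * measure lebesgue ?Z) powr (1 / p')"
    using L_p_pos by (intro mult_left_mono) auto
  then have small': "L_p * measure lebesgue \<Omega> powr (1 / 2)
      * measure lebesgue ?Z powr ((2 - p) / (2 * p)) < \<mu>"
    using small unfolding exponent by linarith
  obtain \<rho> where \<rho>: "0 < \<rho>" and cone: "\<And>u. u \<in> Lp 2 \<Omega> \<Longrightarrow> nrm (\<lambda>x. u x - udag x) \<le> \<rho> \<Longrightarrow>
    nrm (\<lambda>x. F udag x - F u x - G u (\<lambda>x. udag x - u x) x) \<le> \<mu> * nrm (\<lambda>x. F udag x - F u x)"
    by (rule tangential_cone[OF udag p0 p(2) L_p_pos _ small']) (use L_p in auto)
  define \<Lambda> where "\<Lambda> = (1 - \<mu>) / (2 * poincare ^ 4)"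
  define \<tau> where "\<tau> = 2 * (1 + \<mu>) / (1 - \<mu>)"
  have "0 < \<Lambda>" using \<mu> poincare(1) by (simp add: \<Lambda>_def)
  then have \<Lambda>_half: "0 < \<Lambda> / 2" "\<Lambda> / 2 \<le> \<Lambda>" by simp_all
  have \<tau>: "1 < \<tau>" using \<mu> by (simp add: \<tau>_def field_simps)
  have loc: "landweber \<Omega> udag u0 \<rho> \<mu> (\<Lambda> / 2) \<Lambda> \<tau> w"
    if "u0 \<in> Lp 2 \<Omega>" "nrm (\<lambda>x. u0 x - udag x) \<le> \<rho>" "\<forall>n. \<Lambda> / 2 \<le> w n \<and> w n \<le> \<Lambda>"
    for u0 and w :: "nat \<Rightarrow> real"
  proof unfold_locales
    show "\<Lambda> * poincare ^ 4 \<le> (1 - \<mu>) / 2" using poincare(1) by (simp add: \<Lambda>_def)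
    show "2 * (1 + \<mu>) \<le> \<tau> * (1 - \<mu>)" using \<mu> by (simp add: \<tau>_def)
  qed (use that udag \<rho> \<mu> cone \<Lambda>_half in auto)
  show ?thesis
  proof (rule exI[of _ \<rho>], intro conjI \<rho>, rule exI[of _ "\<Lambda> / 2"], rule exI[of _ \<Lambda>], rule exI[of _ \<tau>],
      intro conjI \<Lambda>_half \<tau> ballI allI impI; (elim conjE)?)
    fix u0 \<delta> and w :: "nat \<Rightarrow> real" and y :: "'a \<Rightarrow> real"
    assume "u0 \<in> Lp 2 \<Omega>" "nrm (\<lambda>x. u0 x - udag x) \<le> \<rho>" "\<forall>n. \<Lambda> / 2 \<le> w n \<and> w n \<le> \<Lambda>"
      and "0 < \<delta>" "y \<in> Lp 2 \<Omega>" "nrm (\<lambda>x. y x - ydag x) \<le> \<delta>"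
    then show "\<exists>n. discrepancy_met \<Omega> \<tau> w u0 \<delta> y n"
      using landweber.finite_stopping[OF loc] unfolding ydag by blast
  next
    fix u0 and w :: "nat \<Rightarrow> real"
    assume "u0 \<in> Lp 2 \<Omega>" "nrm (\<lambda>x. u0 x - udag x) \<le> \<rho>" "\<forall>n. \<Lambda> / 2 \<le> w n \<and> w n \<le> \<Lambda>"
    then show "((\<exists>n. discrepancy_met \<Omega> \<tau> w u0 0 ydag n) \<and>
           (AE x in lebesgue_on \<Omega>.
              BL_iterate \<Omega> w u0 ydag (stopping_index \<Omega> \<tau> w u0 0 ydag) x = udag x)) \<or>
        ((\<nexists>n. discrepancy_met \<Omega> \<tau> w u0 0 ydag n) \<and>
           (\<lambda>n. nrm (\<lambda>x. BL_iterate \<Omega> w u0 ydag n x - udag x)) \<longlonglongrightarrow> 0)"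
      unfolding ydag by (rule landweber.exact_data[OF loc])
  next
    fix u0 \<delta> and w :: "nat \<Rightarrow> real" and y :: "nat \<Rightarrow> 'a \<Rightarrow> real"
    assume "u0 \<in> Lp 2 \<Omega>" "nrm (\<lambda>x. u0 x - udag x) \<le> \<rho>" "\<forall>n. \<Lambda> / 2 \<le> w n \<and> w n \<le> \<Lambda>"
      and "\<forall>k. 0 < \<delta> k" "\<delta> \<longlonglongrightarrow> 0" "\<forall>k. y k \<in> Lp 2 \<Omega> \<and> nrm (\<lambda>x. y k x - ydag x) \<le> \<delta> k"
    then show "(\<lambda>k. nrm (\<lambda>x. BL_iterate \<Omega> w u0 (y k) (stopping_index \<Omega> \<tau> w u0 (\<delta> k) (y k)) x - udag x))
        \<longlonglongrightarrow> 0"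
      unfolding ydag by (intro landweber.regularization[OF loc]) auto
  qed
qed

end
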